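(* There is an algorithm that, given graphs $G$ and $H$ with $V(H)\subseteq V(G)$, decides whether $H$ is a labeled contraction of $G$ in time $O\left((\delta(G)+2k)^k\cdot (n+m)\right)$, where $k=|V(G)|-|V(H)|$ is the number of contractions, $n=|V(G)|$ and $m=|E(G)|$.
   Context: Graphs are finite, simple and undirected; vertices are treated as uniquely labeled objects, and two graphs are equal iff they have the same vertex set and the same edge set. For an edge $uv$ of $G$, the labeled contraction $(u,v)$ yields $G/(u,v)$: add an edge between $u$ and every vertex of $N_G(v)\setminus N_G[u]$, then delete $v$. $H$ is a labeled contraction of $G$ if some sequence of such contractions (each applied to an edge of the current graph) turns $G$ into a graph equal to $H$; each contraction removes exactly one vertex, so exactly $|V(G)|-|V(H)|$ contractions are used. $\delta(G)$ is the degeneracy of $G$: the smallest integer $d$ such that every subgraph of $G$ has a vertex of degree at most $d$. *)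

theory Defs
  imports Main
begin

section \<open>Labeled contractions of finite simple graphs\<close>

type_synonym 'a graph = "'a set \<times> 'a set set"

abbreviation verts :: "'a graph \<Rightarrow> 'a set" where
  "verts G \<equiv> fst G"

abbreviation edges :: "'a graph \<Rightarrow> 'a set set" where
  "edges G \<equiv> snd G"

definition simple_graph :: "'a graph \<Rightarrow> bool" where
  "simple_graph G \<longleftrightarrow> finite (verts G) \<and> (\<forall>e\<in>edges G. e \<subseteq> verts G \<and> card e = 2)"

definition nbhd :: "'a graph \<Rightarrow> 'a \<Rightarrow> 'a set" where
  "nbhd G v = {w. {v, w} \<in> edges G}"

definition closed_nbhd :: "'a graph \<Rightarrow> 'a \<Rightarrow> 'a set" where
  "closed_nbhd G v = insert v (nbhd G v)"

definition add_edges :: "'a graph \<Rightarrow> 'a \<Rightarrow> 'a set \<Rightarrow> 'a graph" where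
  "add_edges G u W = (verts G, edges G \<union> {{u, w} | w. w \<in> W})"

definition delete_vertex :: "'a graph \<Rightarrow> 'a \<Rightarrow> 'a graph" where
  "delete_vertex G v = (verts G - {v}, {e \<in> edges G. v \<notin> e})"

definition contract :: "'a graph \<Rightarrow> 'a \<Rightarrow> 'a \<Rightarrow> 'a graph" where
  "contract G u v = delete_vertex (add_edges G u (nbhd G v - closed_nbhd G u)) v"

inductive contraction_step :: "'a graph \<Rightarrow> 'a graph \<Rightarrow> bool" where
  "{u, v} \<in> edges G \<Longrightarrow> contraction_step G (contract G u v)"

definition labeled_contraction_of :: "'a graph \<Rightarrow> 'a graph \<Rightarrow> bool" where
  "labeled_contraction_of H G \<longleftrightarrow> contraction_step\<^sup>*\<^sup>* G H"

definition subgraph :: "'a graph \<Rightarrow> 'a graph \<Rightarrow> bool" where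
  "subgraph K G \<longleftrightarrow> simple_graph K \<and> verts K \<subseteq> verts G \<and> edges K \<subseteq> edges G"

definition degree :: "'a graph \<Rightarrow> 'a \<Rightarrow> nat" where
  "degree G v = card (nbhd G v)"

text \<open>The subgraph without vertices is excluded, as no vertex could satisfy the condition.\<close>

definition degeneracy :: "'a graph \<Rightarrow> nat" where
  "degeneracy G =
     (LEAST d. \<forall>K. subgraph K G \<and> verts K \<noteq> {} \<longrightarrow> (\<exists>v\<in>verts K. degree K v \<le> d))"


section \<open>Random access machine programs with uniform cost\<close>

text \<open>
  The machine model is the uniform-cost RAM whose only arithmetic operations are addition and
  (truncated) subtraction on natural numbers, programmed with structured control flow.  Memory is
  organised as a family of unbounded arrays: the first argument of a memory is the name
  of the array, the second one the index.  Array names occurring in programs are literals, whereas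
  indices are computed.  A program thus mentions only finitely many arrays, and interleaving
  them in one address space gives a RAM with a single memory at the cost of a constant factor.
\<close>

type_synonym memory = "nat \<Rightarrow> nat \<Rightarrow> nat"

datatype aexp =
    Const nat
  | Read nat aexp
  | Plus aexp aexp
  | Minus aexp aexp

datatype bexp =
    Less aexp aexp
  | Equal aexp aexp
  | Neg bexp
  | Conj bexp bexp

datatype com =
    Skip
  | Write nat aexp aexp
  | Seq com com
  | Cond bexp com com
  | While bexp com

fun aval :: "aexp \<Rightarrow> memory \<Rightarrow> nat" where
  "aval (Const c) M = c"
| "aval (Read a e) M = M a (aval e M)"
| "aval (Plus e f) M = aval e M + aval f M"
| "aval (Minus e f) M = aval e M - aval f M"

fun bval :: "bexp \<Rightarrow> memory \<Rightarrow> bool" where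
  "bval (Less e f) M \<longleftrightarrow> aval e M < aval f M"
| "bval (Equal e f) M \<longleftrightarrow> aval e M = aval f M"
| "bval (Neg b) M \<longleftrightarrow> \<not> bval b M"
| "bval (Conj b c) M \<longleftrightarrow> bval b M \<and> bval c M"

fun acost :: "aexp \<Rightarrow> nat" where
  "acost (Const c) = 1"
| "acost (Read a e) = 1 + acost e"
| "acost (Plus e f) = 1 + acost e + acost f"
| "acost (Minus e f) = 1 + acost e + acost f"

fun bcost :: "bexp \<Rightarrow> nat" where
  "bcost (Less e f) = 1 + acost e + acost f"
| "bcost (Equal e f) = 1 + acost e + acost f"
| "bcost (Neg b) = 1 + bcost b"
| "bcost (Conj b c) = 1 + bcost b + bcost c"

definition store :: "memory \<Rightarrow> nat \<Rightarrow> nat \<Rightarrow> nat \<Rightarrow> memory" where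
  "store M a i x = M(a := (M a)(i := x))"

text \<open>
  \<open>exec P M t M'\<close>: started in memory \<open>M\<close>, the program \<open>P\<close> halts after \<open>t\<close> elementary
  operations with memory \<open>M'\<close>.  A program that does not halt has no such \<open>t\<close> and \<open>M'\<close>.
\<close>

inductive exec :: "com \<Rightarrow> memory \<Rightarrow> nat \<Rightarrow> memory \<Rightarrow> bool" where
  Skip: "exec Skip M 1 M"
| Write: "exec (Write a e f) M (1 + acost e + acost f) (store M a (aval e M) (aval f M))"
| Seq: "exec P M t M' \<Longrightarrow> exec Q M' t' M'' \<Longrightarrow> exec (Seq P Q) M (t + t') M''"
| CondTrue: "bval b M \<Longrightarrow> exec P M t M' \<Longrightarrow> exec (Cond b P Q) M (1 + bcost b + t) M'"
| CondFalse: "\<not> bval b M \<Longrightarrow> exec Q M t M' \<Longrightarrow> exec (Cond b P Q) M (1 + bcost b + t) M'"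
| WhileFalse: "\<not> bval b M \<Longrightarrow> exec (While b P) M (1 + bcost b) M"
| WhileTrue: "bval b M \<Longrightarrow> exec P M t M' \<Longrightarrow> exec (While b P) M' t' M'' \<Longrightarrow>
    exec (While b P) M (1 + bcost b + t + t') M''"

inductive_cases exec_SkipE: "exec Skip M t M'"
inductive_cases exec_WriteE: "exec (Write a e f) M t M'"
inductive_cases exec_SeqE: "exec (Seq P Q) M t M'"
inductive_cases exec_CondE: "exec (Cond b P Q) M t M'"
inductive_cases exec_WhileE: "exec (While b P) M t M'"

lemma exec_deterministic:
  "exec P M t M' \<Longrightarrow> exec P M u N \<Longrightarrow> u = t \<and> N = M'"
proof (induction arbitrary: u N rule: exec.induct)
  case (Skip M)
  then show ?case by (auto elim: exec_SkipE)
next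
  case (Write a e f M)
  then show ?case by (auto elim: exec_WriteE)
next
  case (Seq P M t M' Q t' M'')
  from Seq.prems obtain s s' M1 where
    "u = s + s'" "exec P M s M1" "exec Q M1 s' N"
    by (auto elim: exec_SeqE)
  with Seq.IH show ?case by blast
next
  case (CondTrue b M P t M' Q)
  from CondTrue.prems CondTrue.hyps(1) obtain s where
    "u = 1 + bcost b + s" "exec P M s N"
    by (auto elim: exec_CondE)
  with CondTrue.IH show ?case by blast
next
  case (CondFalse b M Q t M' P)
  from CondFalse.prems CondFalse.hyps(1) obtain s where
    "u = 1 + bcost b + s" "exec Q M s N"
    by (auto elim: exec_CondE)
  with CondFalse.IH show ?case by blast
next
  case (WhileFalse b M P)
  then show ?case by (auto elim: exec_WhileE)
next
  case (WhileTrue b M P t M' t' M'')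
  from WhileTrue.prems WhileTrue.hyps(1) obtain s s' M1 where
    "u = 1 + bcost b + s + s'" "exec P M s M1" "exec (While b P) M1 s' N"
    by (auto elim: exec_WhileE)
  with WhileTrue.IH show ?case by blast
qed


section \<open>Input and output\<close>

text \<open>
  A graph is given by its vertices and edges, each listed exactly once, in arbitrary order and
  with the endpoints of an edge in arbitrary order.  Vertex labels are arbitrary natural numbers.
\<close>

definition lists_graph :: "nat list \<Rightarrow> (nat \<times> nat) list \<Rightarrow> nat graph \<Rightarrow> bool" where
  "lists_graph vs es G \<longleftrightarrow>
     distinct vs \<and> set vs = verts G \<and>
     distinct (map (\<lambda>(u, v). {u, v}) es) \<and> set (map (\<lambda>(u, v). {u, v}) es) = edges G"

definition graph_code :: "nat list \<Rightarrow> (nat \<times> nat) list \<Rightarrow> nat list" where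
  "graph_code vs es = [length vs, length es] @ vs @ concat (map (\<lambda>(u, v). [u, v]) es)"

text \<open>The input occupies the beginning of array 0; all other cells are initially 0.\<close>

definition input_memory :: "nat list \<Rightarrow> memory" where
  "input_memory xs = (\<lambda>a i. if a = 0 \<and> i < length xs then xs ! i else 0)"

text \<open>The answer is read off from the first cell of array 1.\<close>

definition answer :: "memory \<Rightarrow> nat" where
  "answer M = M 1 0"

end

theory Submission
  imports Defs
begin

text \<open>
  A graph \<open>H\<close> is a labeled contraction of \<open>G\<close> iff every vertex \<open>v\<close> outside \<open>H\<close> can be given a parent
  among its neighbours in \<open>G\<close> such that following parents always ends in \<open>H\<close>, and identifying each
  vertex with the end of its path turns the edges of \<open>G\<close> into those of \<open>H\<close>.  If the parent \<open>u\<close> of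
  \<open>v\<close> lies in \<open>H\<close>, then all neighbours of \<open>v\<close> in \<open>H\<close> are equal or \<open>H\<close>-adjacent to \<open>u\<close>.  The vertices
  \<open>u\<close> with this property form a clique of \<open>H\<close>, and without the at most \<open>k\<close> vertices that absorb
  something it is a clique of \<open>G\<close>; hence it has at most \<open>\<delta> + k + 1\<close> elements.  Together with the
  at most \<open>k - 1\<close> neighbours outside \<open>H\<close> this leaves at most \<open>\<delta> + 2 k\<close> candidates for each parent.
  The algorithm tries all choices of candidates, each in linear time.

  If \<open>H\<close> is not a contraction of \<open>G\<close>, some \<open>v\<close> may have more candidates.  With \<open>b\<close> the largest
  number of candidates, the algorithm therefore first peels off vertices of degree less than
  \<open>b - 2 k\<close> and rejects if nothing remains, as then \<open>\<delta> + 2 k < b\<close>; otherwise \<open>b \<le> \<delta> + 2 k\<close>.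
\<close>

section \<open>Contractions as rooted forests\<close>

text \<open>A contraction may use an edge that exists only because of earlier contractions, whereas
  a parent must be a neighbour in \<open>G\<close>. Once this is reconciled, the order of the
  contractions disappears and only one choice per removed vertex remains. The time bound is tight in
  two places. An adjacency matrix of \<open>H\<close> is used but never cleared as a whole: the
  memory is initially 0, and only cells that belong to edges of \<open>H\<close> are ever written.
  Listing the candidates costs linear time per removed vertex, and this factor \<open>k + 1\<close>
  is absorbed by \<open>k + 1 <= 2 * (degeneracy G + 2 * k) ^ k\<close>. The degeneracy itself is
  never computed; comparing it with a single threshold takes one peeling pass. Programs are verified
  by weakest preconditions over a memory and a credit of remaining time, with generous constants.
  Loops whose iterations differ in cost keep the credit inside the invariant and charge it to a
  potential.\<close>

inductive rooted :: "('a \<Rightarrow> 'a) \<Rightarrow> 'a set \<Rightarrow> 'a \<Rightarrow> 'a \<Rightarrow> bool" for p S where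
  base: "s \<in> S \<Longrightarrow> rooted p S s s"
| step: "x \<notin> S \<Longrightarrow> rooted p S (p x) s \<Longrightarrow> rooted p S x s"

lemma rooted_in: "rooted p S x s \<Longrightarrow> s \<in> S"
  by (induction rule: rooted.induct)

lemma rooted_base_iff: "x \<in> S \<Longrightarrow> rooted p S x s \<longleftrightarrow> s = x"
  by (auto elim: rooted.cases intro: rooted.base)

lemma rooted_step_iff: "x \<notin> S \<Longrightarrow> rooted p S x s \<longleftrightarrow> rooted p S (p x) s"
  by (auto elim: rooted.cases intro: rooted.step)

lemma rooted_unique: "rooted p S x s \<Longrightarrow> rooted p S x t \<Longrightarrow> s = t"
  by (induction rule: rooted.induct) (simp_all add: rooted_base_iff rooted_step_iff)

text \<open>A path that starts in \<open>V\<close> stays in \<open>V\<close> and stops in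
  \<open>S\<close>, so parents are compared on \<open>V - S\<close> alone. This relates a
  mathematical parent function to an array whose other cells are arbitrary.\<close>

lemma rooted_cong:
  "rooted p S x s \<Longrightarrow> x \<in> V \<Longrightarrow> (\<And>y. y \<in> V - S \<Longrightarrow> p y = q y \<and> q y \<in> V) \<Longrightarrow> rooted q S x s"
proof (induction rule: rooted.induct)
  case (base s)
  then show ?case by (auto intro: rooted.base)
next
  case (step x s)
  from step.prems step.hyps have "p x = q x" "q x \<in> V" by auto
  with step show ?case by (auto intro: rooted.step)
qed

text \<open>As \<open>rooted\<close> is inductive, a vertex whose path of parents runs into a cycle
  has no root at all; a set that avoids \<open>S\<close> and is closed under parents certifies
  this.\<close>

lemma not_rooted_closed:
  "rooted p S x s \<Longrightarrow> (\<And>y. y \<in> A \<Longrightarrow> y \<notin> S \<and> p y \<in> A) \<Longrightarrow> x \<notin> A"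
  by (induction rule: rooted.induct) blast+

definition quotient_edges :: "'a graph \<Rightarrow> ('a \<Rightarrow> 'a) \<Rightarrow> 'a set \<Rightarrow> 'a set set" where
  "quotient_edges G p S =
     {{s, t} | s t. s \<noteq> t \<and> (\<exists>a b. {a, b} \<in> edges G \<and> rooted p S a s \<and> rooted p S b t)}"

definition contraction_forest :: "'a graph \<Rightarrow> 'a graph \<Rightarrow> ('a \<Rightarrow> 'a) \<Rightarrow> bool" where
  "contraction_forest G H p \<longleftrightarrow>
     (\<forall>v\<in>verts G - verts H. {v, p v} \<in> edges G) \<and>
     (\<forall>v\<in>verts G. \<exists>s. rooted p (verts H) v s) \<and>
     edges H = quotient_edges G p (verts H)"

section \<open>Effect of a single contraction on the graph and its quotient\<close>

lemma simple_graph_edgeD: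
  assumes "simple_graph G" "{a, b} \<in> edges G"
  shows "a \<noteq> b" "a \<in> verts G" "b \<in> verts G"
  using assms by (auto simp: simple_graph_def)

lemma simple_graph_edgeE:
  assumes "simple_graph G" "e \<in> edges G"
  obtains a b where "e = {a, b}" "a \<noteq> b" "a \<in> verts G" "b \<in> verts G"
  using assms by (metis card_2_iff insert_subset simple_graph_def)

lemma verts_contract: "verts (contract G u v) = verts G - {v}"
  by (simp add: contract_def delete_vertex_def add_edges_def)

lemma edges_contract:
  assumes "simple_graph G" "{u, v} \<in> edges G"
  shows "{a, b} \<in> edges (contract G u v) \<longleftrightarrow> a \<noteq> v \<and> b \<noteq> v \<and>
    ({a, b} \<in> edges G \<or> a = u \<and> b \<noteq> u \<and> {v, b} \<in> edges G \<or> b = u \<and> a \<noteq> u \<and> {v, a} \<in> edges G)"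
proof -
  have "u \<noteq> v" using simple_graph_edgeD[OF assms] by blast
  then show ?thesis
    by (auto simp: contract_def delete_vertex_def add_edges_def nbhd_def closed_nbhd_def
        doubleton_eq_iff insert_commute)
qed

lemma simple_graph_contract:
  assumes "simple_graph G" "{u, v} \<in> edges G"
  shows "simple_graph (contract G u v)"
proof -
  have "u \<noteq> v" "u \<in> verts G" using simple_graph_edgeD[OF assms] by blast+
  moreover have "w \<in> verts G" "w \<noteq> v" if "{v, w} \<in> edges G" for w
    using simple_graph_edgeD[OF assms(1) that] by auto
  ultimately show ?thesis using assms(1)
    by (auto simp: simple_graph_def contract_def delete_vertex_def add_edges_def nbhd_def
        closed_nbhd_def card_insert_if)
qed

text \<open>Replacing \<open>v\<close> by \<open>u\<close> at both ends of an edge of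
  \<open>G\<close> gives an edge of the contracted graph or a loop, and a loop cannot join distinct
  roots because \<open>u\<close> and \<open>v\<close> share their root. Conversely, an edge
  inherited from \<open>v\<close> is traced back to \<open>v\<close>.\<close>

lemma quotient_edges_contract:
  assumes "simple_graph G" "{u, v} \<in> edges G"
    and same: "\<And>x s. x \<in> verts G \<Longrightarrow> x \<noteq> v \<Longrightarrow> rooted p S x s \<longleftrightarrow> rooted q S x s"
    and uv: "\<And>s. rooted p S v s \<longleftrightarrow> rooted p S u s"
  shows "quotient_edges G p S = quotient_edges (contract G u v) q S"
proof -
  have ne: "u \<noteq> v" and uV: "u \<in> verts G" and vV: "v \<in> verts G"
    using simple_graph_edgeD[OF assms(1,2)] by auto
  have "(\<exists>a b. {a, b} \<in> edges G \<and> rooted p S a s \<and> rooted p S b t) \<longleftrightarrow>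
        (\<exists>a b. {a, b} \<in> edges (contract G u v) \<and> rooted q S a s \<and> rooted q S b t)"
    (is "?L \<longleftrightarrow> ?R") if st: "s \<noteq> t" for s t
  proof
    assume ?L
    then obtain a b where ab: "{a, b} \<in> edges G" "rooted p S a s" "rooted p S b t" by blast
    define a' b' where "a' = (if a = v then u else a)" and "b' = (if b = v then u else b)"
    have V: "a \<in> verts G" "b \<in> verts G" "a \<noteq> b" using simple_graph_edgeD[OF assms(1) ab(1)] by auto
    have r: "rooted p S a' s" "rooted p S b' t" using ab uv by (auto simp: a'_def b'_def)
    have "a' \<noteq> b'" using r rooted_unique st by metis
    then have "{a', b'} \<in> edges (contract G u v)"
      using ab(1) ne V(3) by (auto simp: edges_contract[OF assms(1,2)] a'_def b'_def insert_commute)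
    moreover have "rooted q S a' s" "rooted q S b' t"
      using r same V uV ne by (auto simp: a'_def b'_def)
    ultimately show ?R by blast
  next
    assume ?R
    then obtain a b where ab: "{a, b} \<in> edges (contract G u v)" "rooted q S a s" "rooted q S b t"
      by blast
    have V: "a \<in> verts G" "b \<in> verts G" "a \<noteq> v" "b \<noteq> v"
      using simple_graph_edgeD[OF simple_graph_contract[OF assms(1,2)] ab(1)]
      by (auto simp: verts_contract)
    have r: "rooted p S a s" "rooted p S b t" using ab V same by auto
    from ab(1) consider "{a, b} \<in> edges G" | "a = u" "{v, b} \<in> edges G" | "b = u" "{v, a} \<in> edges G"
      by (auto simp: edges_contract[OF assms(1,2)])
    then show ?L
    proof cases
      case 1 then show ?thesis using r by blast
    next
      case 2 then show ?thesis using r uv by blast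
    next
      case 3
      then have "{a, v} \<in> edges G" by (simp add: insert_commute)
      then show ?thesis using r uv 3 by blast
    qed
  qed
  then show ?thesis unfolding quotient_edges_def by (simp cong: conj_cong)
qed

text \<open>Roots are unique, so one implication together with the existence of a root on the left
  already gives the equivalence.\<close>

lemma rooted_eqI:
  assumes "\<And>s. rooted p S x s \<Longrightarrow> rooted q S y s" "\<exists>s. rooted p S x s"
  shows "rooted p S x s \<longleftrightarrow> rooted q S y s"
  using assms rooted_unique by metis

lemma contraction_step_verts:
  "contraction_step\<^sup>*\<^sup>* G H \<Longrightarrow> verts H \<subseteq> verts G"
proof (induction rule: rtranclp_induct)
  case (step y z)
  from step.hyps(2) have "verts z \<subseteq> verts y"
    by (auto elim!: contraction_step.cases simp: verts_contract)
  with step.IH show ?case by blast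
qed simp

text \<open>Undoes a contraction inside a forest. A parent edge of the contracted graph may exist
  only because \<open>v\<close> passed its neighbours on to \<open>u\<close>; each such edge has
  \<open>u\<close> as an end and is routed through \<open>v\<close>, which leaves the roots of all
  vertices other than \<open>v\<close> unchanged.\<close>

lemma contraction_forest_step:
  assumes simple: "simple_graph G" and e: "{u, v} \<in> edges G"
    and S: "verts H \<subseteq> verts G - {v}"
    and cf: "contraction_forest (contract G u v) H q"
  shows "\<exists>p. contraction_forest G H p"
proof -
  let ?S = "verts H" and ?G = "contract G u v"
  have ne: "u \<noteq> v" and uV: "u \<in> verts G" and vV: "v \<in> verts G"
    using simple_graph_edgeD[OF simple e] by auto
  have vS: "v \<notin> ?S" using S by blast
  have qe: "{x, q x} \<in> edges ?G" if "x \<in> verts G - ?S" "x \<noteq> v" for x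
    using cf that by (auto simp: contraction_forest_def verts_contract)
  (* If u lies outside H and reached its parent only through an edge inherited from v,
     then v becomes the parent of u; otherwise u becomes the parent of v. *)
  define turn where "turn \<longleftrightarrow> u \<notin> ?S \<and> {u, q u} \<notin> edges G"
  define p where "p x = (if x = v then (if turn then q u else u)
      else if x = u then (if turn then v else q u)
      else if q x = u \<and> {x, u} \<notin> edges G then v else q x)" for x
  have pe: "{x, p x} \<in> edges G" if "x \<in> verts G - ?S" for x
  proof (cases "x = v")
    case True
    show ?thesis
    proof (cases turn)
      case t: True
      then have "{u, q u} \<in> edges ?G" using qe[of u] uV ne by (auto simp: turn_def)
      then have "{v, q u} \<in> edges G" using t
        by (auto simp: turn_def edges_contract[OF simple e])
      then show ?thesis using True t by (simp add: p_def)
    next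
      case False
      then show ?thesis using True e by (simp add: p_def insert_commute)
    qed
  next
    case False
    note q = qe[OF that False]
    show ?thesis
    proof (cases "x = u")
      case True
      then show ?thesis using that e ne by (auto simp: p_def turn_def)
    next
      case xu: False
      then show ?thesis using q False
        by (auto simp: p_def edges_contract[OF simple e] insert_commute)
    qed
  qed
  have step: "rooted q ?S x s \<Longrightarrow> x \<in> verts G - {v} \<Longrightarrow> rooted p ?S x s" for x s
  proof (induction rule: rooted.induct)
    case (base s)
    then show ?case by (auto intro: rooted.base)
  next
    case (step x s)
    have "q x \<in> verts G - {v}"
      using simple_graph_edgeD(3)[OF simple_graph_contract[OF simple e] qe[of x]] step
      by (auto simp: verts_contract)
    then have IH: "rooted p ?S (q x) s" using step.IH by blast
    show ?case
    proof (cases "x = u")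
      case True
      have "p u = (if turn then v else q u)" "turn \<Longrightarrow> p v = q u" using ne by (auto simp: p_def)
      then show ?thesis using True IH step.hyps vS
        by (cases turn) (simp_all add: rooted_step_iff[of u] rooted_step_iff[of v])
    next
      case xu: False
      show ?thesis
      proof (cases "q x = u \<and> {x, u} \<notin> edges G")
        case True
        \<comment> \<open>In the turned case \<open>v\<close> has the parent \<open>q u\<close>, so
          the path of \<open>x\<close> skips \<open>u\<close> but ends in the same root; otherwise
          \<open>u\<close> is the parent of \<open>v\<close>.\<close>
        have "rooted p ?S v s"
        proof (cases turn)
          case t: True
          then have "u \<notin> ?S" by (simp add: turn_def)
          then show ?thesis using IH True t ne by (simp add: rooted_step_iff[of u] p_def)
        next
          case False
          then show ?thesis using IH True vS by (simp add: rooted_step_iff[of v] p_def)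
        qed
        moreover have "p x = v" using True xu step.prems by (simp add: p_def)
        ultimately show ?thesis using step.hyps by (simp add: rooted_step_iff[of x])
      next
        case False
        then have "p x = q x" using xu step.prems by (auto simp: p_def)
        then show ?thesis using IH step.hyps by (simp add: rooted_step_iff[of x])
      qed
    qed
  qed
  have tot: "\<exists>s. rooted q ?S x s" if "x \<in> verts G" "x \<noteq> v" for x
    using cf that by (auto simp: contraction_forest_def verts_contract)
  have same: "rooted p ?S x s \<longleftrightarrow> rooted q ?S x s" if "x \<in> verts G" "x \<noteq> v" for x s
    using rooted_eqI[of q ?S x p x s] step tot that by blast
  \<comment> \<open>One of the two vertices is the parent of the other: \<open>v\<close> of
    \<open>u\<close> if \<open>turn\<close> holds, \<open>u\<close> of \<open>v\<close>
    otherwise.\<close>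
  have uv: "rooted p ?S v s \<longleftrightarrow> rooted p ?S u s" for s
    using vS ne by (auto simp: rooted_step_iff[of v] rooted_step_iff[of u] p_def turn_def)
  have "\<exists>s. rooted p ?S x s" if "x \<in> verts G" for x
    using that tot[of x] tot[of u] same uv ne uV by metis
  moreover have "edges H = quotient_edges G p ?S"
    using quotient_edges_contract[OF simple e same uv] cf by (simp add: contraction_forest_def)
  ultimately show ?thesis using pe by (auto simp: contraction_forest_def)
qed

lemma contraction_forest_refl:
  assumes "simple_graph G"
  shows "contraction_forest G G id"
proof -
  have "edges G = quotient_edges G id (verts G)"
  proof (intro set_eqI iffI)
    fix e assume e: "e \<in> edges G"
    then obtain a b where "e = {a, b}" "a \<noteq> b" "a \<in> verts G" "b \<in> verts G"
      using assms simple_graph_edgeE by metis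
    then show "e \<in> quotient_edges G id (verts G)"
      using e unfolding quotient_edges_def by (blast intro: rooted.base)
  next
    fix e assume "e \<in> quotient_edges G id (verts G)"
    then obtain s t a b where *: "e = {s, t}" "{a, b} \<in> edges G" "rooted id (verts G) a s"
      "rooted id (verts G) b t"
      unfolding quotient_edges_def by blast
    moreover have "a \<in> verts G" "b \<in> verts G" using simple_graph_edgeD[OF assms *(2)] by auto
    ultimately show "e \<in> edges G" by (auto simp: rooted_base_iff)
  qed
  then show ?thesis by (auto simp: contraction_forest_def intro: rooted.base)
qed

lemma contraction_imp_forest:
  assumes "contraction_step\<^sup>*\<^sup>* G H" "simple_graph G"
  shows "\<exists>p. contraction_forest G H p"
  using assms
proof (induction rule: converse_rtranclp_induct)
  case base
  then show ?case using contraction_forest_refl by blast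
next
  case (step G G')
  from step.hyps(1) obtain u v where e: "{u, v} \<in> edges G" and G': "G' = contract G u v"
    by (auto elim: contraction_step.cases)
  have "verts H \<subseteq> verts G - {v}"
    using contraction_step_verts[OF step.hyps(2)] by (simp add: G' verts_contract)
  moreover have "\<exists>p. contraction_forest (contract G u v) H p"
    using step.IH simple_graph_contract[OF step.prems e] by (simp add: G')
  ultimately show ?case using contraction_forest_step[OF step.prems e] by blast
qed

text \<open>Any removed vertex \<open>v\<close> may be contracted first, into its parent
  \<open>u\<close>: its children become children of \<open>u\<close>, along edges that the
  contraction creates whenever they are missing.\<close>

lemma forest_imp_contraction:
  assumes "simple_graph G" "simple_graph H" "verts H \<subseteq> verts G" "contraction_forest G H p"
  shows "contraction_step\<^sup>*\<^sup>* G H"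
  using assms
proof (induction "card (verts G - verts H)" arbitrary: G p)
  case 0
  let ?S = "verts H"
  have "finite (verts G)" using 0 by (simp add: simple_graph_def)
  then have V: "verts G = ?S" using 0 by auto
  have r: "rooted p ?S a s \<longleftrightarrow> s = a" if "a \<in> verts G" for a s
    using that V by (auto simp: rooted_base_iff)
  have "quotient_edges G p ?S = edges G"
  proof (intro set_eqI iffI)
    fix e assume e: "e \<in> edges G"
    then obtain a b where "e = {a, b}" "a \<noteq> b" "a \<in> verts G" "b \<in> verts G"
      using \<open>simple_graph G\<close> simple_graph_edgeE by metis
    then show "e \<in> quotient_edges G p ?S" using e r unfolding quotient_edges_def by blast
  next
    fix e assume "e \<in> quotient_edges G p ?S"
    then obtain s t a b where *: "e = {s, t}" "{a, b} \<in> edges G" "rooted p ?S a s" "rooted p ?S b t"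
      unfolding quotient_edges_def by blast
    moreover have "a \<in> verts G" "b \<in> verts G" using simple_graph_edgeD[OF \<open>simple_graph G\<close> *(2)] by auto
    ultimately show "e \<in> edges G" using r by auto
  qed
  then have "edges H = edges G" using 0 by (simp add: contraction_forest_def)
  then have "G = H" using V by (simp add: prod_eq_iff)
  then show ?case by simp
next
  case (Suc c)
  let ?S = "verts H"
  have fin: "finite (verts G)" using Suc.prems by (simp add: simple_graph_def)
  obtain v where v: "v \<in> verts G - ?S" using Suc(2) by (metis card.empty nat.distinct(1) ex_in_conv)
  define u where "u = p v"
  have "{v, u} \<in> edges G" using v Suc.prems by (auto simp: contraction_forest_def u_def)
  then have e: "{u, v} \<in> edges G" by (simp add: insert_commute)
  have ne: "u \<noteq> v" and uV: "u \<in> verts G" using simple_graph_edgeD[OF Suc.prems(1) e] by auto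
  have tot: "\<exists>s. rooted p ?S x s" if "x \<in> verts G" for x
    using Suc.prems that by (auto simp: contraction_forest_def)
  \<comment> \<open>If \<open>v\<close> were the parent of \<open>u\<close>, redirecting would make
    \<open>u\<close> its own parent; but then \<open>u\<close> and \<open>v\<close> form a cycle and
    have no root.\<close>
  have pu: "p u \<noteq> v" if "u \<notin> ?S"
  proof
    assume "p u = v"
    then have "x \<notin> {u, v}" if "rooted p ?S x s" for x s
      using not_rooted_closed[OF that, of "{u, v}"] v \<open>u \<notin> ?S\<close> by (auto simp: u_def)
    then show False using tot uV by blast
  qed
  define q where "q x = (if p x = v then u else p x)" for x
  have qr: "rooted p ?S x s \<Longrightarrow> rooted q ?S (if x = v then u else x) s" for x s
  proof (induction rule: rooted.induct)
    case (base s)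
    then show ?case using v by (auto intro: rooted.base)
  next
    case (step x s)
    show ?case
    proof (cases "x = v")
      case True
      then show ?thesis using step ne by (simp add: u_def)
    next
      case False
      then show ?thesis using step by (auto simp: q_def intro!: rooted.step[of x])
    qed
  qed
  have same: "rooted p ?S x s \<longleftrightarrow> rooted q ?S x s" if "x \<in> verts G" "x \<noteq> v" for x s
    using rooted_eqI[of p ?S x q x s] qr[of x] tot that by auto
  have uv: "rooted p ?S v s \<longleftrightarrow> rooted p ?S u s" for s
    using v by (simp add: rooted_step_iff[of v] u_def)
  have cf: "contraction_forest (contract G u v) H q"
    unfolding contraction_forest_def
  proof (intro conjI ballI)
    fix x assume x: "x \<in> verts (contract G u v) - ?S"
    then have "{x, p x} \<in> edges G" "x \<noteq> v"
      using Suc.prems by (auto simp: contraction_forest_def verts_contract)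
    then show "{x, q x} \<in> edges (contract G u v)" using pu x ne
      by (auto simp: q_def edges_contract[OF Suc.prems(1) e] insert_commute verts_contract)
  next
    fix x assume "x \<in> verts (contract G u v)"
    then show "\<exists>s. rooted q ?S x s" using tot[of x] same[of x] by (auto simp: verts_contract)
  next
    show "edges H = quotient_edges (contract G u v) q ?S"
      using quotient_edges_contract[OF Suc.prems(1) e same uv] Suc.prems(4)
      by (simp add: contraction_forest_def)
  qed
  have "verts (contract G u v) - ?S = (verts G - ?S) - {v}" by (auto simp: verts_contract)
  then have "c = card (verts (contract G u v) - ?S)"
    using Suc(2) v fin by simp
  then have "contraction_step\<^sup>*\<^sup>* (contract G u v) H"
    using Suc(1)[OF _ simple_graph_contract[OF Suc.prems(1) e] Suc.prems(2) _ cf] Suc.prems(3) v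
    by (auto simp: verts_contract)
  then show ?case using contraction_step.intros[OF e] by (rule converse_rtranclp_into_rtranclp[rotated])
qed

theorem labeled_contraction_iff_forest:
  assumes "simple_graph G" "simple_graph H" "verts H \<subseteq> verts G"
  shows "labeled_contraction_of H G \<longleftrightarrow> (\<exists>p. contraction_forest G H p)"
  using assms contraction_imp_forest forest_imp_contraction
  unfolding labeled_contraction_of_def by blast

section \<open>Degeneracy and the number of candidates\<close>

lemma finite_nbhd: "simple_graph G \<Longrightarrow> finite (nbhd G v)"
  by (rule finite_subset[of _ "verts G"]) (auto simp: nbhd_def simple_graph_def)

lemma le_degeneracyI:
  assumes simple: "simple_graph G" and A: "A \<subseteq> verts G" "A \<noteq> {}"
    and deg: "\<And>x. x \<in> A \<Longrightarrow> d \<le> card (nbhd G x \<inter> A)"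
  shows "d \<le> degeneracy G"
proof -
  let ?P = "\<lambda>d. \<forall>K. subgraph K G \<and> verts K \<noteq> {} \<longrightarrow> (\<exists>v\<in>verts K. degree K v \<le> d)"
  \<comment> \<open>Some number satisfies the condition, so \<open>LEAST\<close> attains it.\<close>
  have "?P (card (verts G))"
  proof (intro allI impI)
    fix K assume K: "subgraph K G \<and> verts K \<noteq> {}"
    then obtain v where v: "v \<in> verts K" by blast
    have "nbhd K v \<subseteq> verts G" using K by (fastforce simp: nbhd_def subgraph_def simple_graph_def)
    then have "degree K v \<le> card (verts G)"
      unfolding degree_def using simple by (intro card_mono) (auto simp: simple_graph_def)
    then show "\<exists>v\<in>verts K. degree K v \<le> card (verts G)" using v by blast
  qed
  then have P: "?P (degeneracy G)" unfolding degeneracy_def by (rule LeastI)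
  let ?K = "(A, {e \<in> edges G. e \<subseteq> A})"
  have "subgraph ?K G"
    using simple A finite_subset[of A "verts G"] by (auto simp: subgraph_def simple_graph_def)
  with P A obtain v where v: "v \<in> A" "degree ?K v \<le> degeneracy G" by fastforce
  moreover have "nbhd ?K v = nbhd G v \<inter> A" using v by (auto simp: nbhd_def)
  ultimately show ?thesis using deg[of v] by (simp add: degree_def)
qed

text \<open>By minimality, a number below the degeneracy fails for some nonempty subgraph, all of
  whose degrees are therefore larger; passing to the subgraph induced by its vertices can only
  increase degrees.\<close>

lemma degeneracy_core:
  assumes simple: "simple_graph G" and ne: "verts G \<noteq> {}" and d: "d \<le> degeneracy G"
  obtains A where "A \<subseteq> verts G" "A \<noteq> {}" "\<And>x. x \<in> A \<Longrightarrow> d \<le> card (nbhd G x \<inter> A)"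
proof (cases d)
  case 0
  then show ?thesis using that[of "verts G"] ne by blast
next
  case (Suc d')
  then have "d' < degeneracy G" using d by simp
  from not_less_Least[OF this[unfolded degeneracy_def]] obtain K where
    K: "subgraph K G" "verts K \<noteq> {}" "\<And>v. v \<in> verts K \<Longrightarrow> d' < degree K v"
    by (metis not_le)
  show ?thesis
  proof (rule that[of "verts K"])
    fix x assume x: "x \<in> verts K"
    have "nbhd K x \<subseteq> nbhd G x \<inter> verts K"
      using K(1) by (auto simp: nbhd_def subgraph_def simple_graph_def)
    then have "degree K x \<le> card (nbhd G x \<inter> verts K)"
      unfolding degree_def using finite_nbhd[OF simple] by (intro card_mono) auto
    then show "d \<le> card (nbhd G x \<inter> verts K)" using K(3)[OF x] Suc by simp
  qed (use K in \<open>auto simp: subgraph_def\<close>)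
qed

text \<open>Of a neighbour outside \<open>H\<close> nothing is demanded locally, since the vertex of
  \<open>H\<close> in which it ends depends on the other parents.\<close>

definition candidates :: "'a graph \<Rightarrow> 'a graph \<Rightarrow> 'a \<Rightarrow> 'a set" where
  "candidates G H v =
     {u \<in> nbhd G v. u \<in> verts H \<longrightarrow> nbhd G v \<inter> verts H \<subseteq> closed_nbhd H u}"

text \<open>A parent in \<open>H\<close> is already the root of \<open>v\<close>, so every edge from
  \<open>v\<close> to another vertex \<open>w\<close> of \<open>H\<close> is mapped to an edge
  between that parent and \<open>w\<close>.\<close>

lemma forest_candidate:
  assumes "contraction_forest G H p" and v: "v \<in> verts G - verts H"
  shows "p v \<in> candidates G H v"
proof -
  let ?S = "verts H"
  have e: "{v, p v} \<in> edges G" using assms by (auto simp: contraction_forest_def)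
  have "w \<in> closed_nbhd H (p v)" if pv: "p v \<in> ?S" and w: "{v, w} \<in> edges G" "w \<in> ?S" for w
  proof (cases "w = p v")
    case False
    have "rooted p ?S v (p v)" using v pv by (simp add: rooted_step_iff[of v] rooted_base_iff)
    moreover have "rooted p ?S w w" using w by (simp add: rooted_base_iff)
    ultimately have "{p v, w} \<in> quotient_edges G p ?S"
      using False w unfolding quotient_edges_def by blast
    then show ?thesis using assms by (simp add: contraction_forest_def closed_nbhd_def nbhd_def)
  qed (simp add: closed_nbhd_def)
  then show ?thesis using e by (auto simp: candidates_def nbhd_def)
qed

text \<open>Every edge of \<open>H\<close> is the image of an edge of \<open>G\<close> under the
  root map. This justifies rejecting at once when \<open>H\<close> has more edges than
  \<open>G\<close>.\<close>

lemma forest_card_edges: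
  assumes simple: "simple_graph G" and cf: "contraction_forest G H p"
  shows "card (edges H) \<le> card (edges G)"
proof -
  let ?S = "verts H"
  define f where "f x = (THE s. rooted p ?S x s)" for x
  have f: "f x = s" if "rooted p ?S x s" for x s
    unfolding f_def using that by (intro the_equality) (auto dest: rooted_unique)
  have "edges G \<subseteq> Pow (verts G)" "finite (verts G)" using simple by (auto simp: simple_graph_def)
  then have fin: "finite (edges G)" using finite_subset by blast
  have "edges H \<subseteq> (\<lambda>e. f ` e) ` edges G"
  proof
    fix e assume "e \<in> edges H"
    then have "e \<in> quotient_edges G p ?S" using cf by (simp add: contraction_forest_def)
    then obtain s t a b where *: "e = {s, t}" "{a, b} \<in> edges G" "rooted p ?S a s" "rooted p ?S b t"
      unfolding quotient_edges_def by blast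
    then have "e = f ` {a, b}" using f by simp
    then show "e \<in> (\<lambda>e. f ` e) ` edges G" using *(2) by blast
  qed
  then have "card (edges H) \<le> card ((\<lambda>e. f ` e) ` edges G)" using fin by (intro card_mono) auto
  also have "\<dots> \<le> card (edges G)" using fin by (rule card_image_le)
  finally show ?thesis .
qed

lemma forest_card_candidates:
  assumes simple: "simple_graph G" and S: "verts H \<subseteq> verts G" and cf: "contraction_forest G H p"
    and v: "v \<in> verts G - verts H"
  shows "card (candidates G H v) \<le> degeneracy G + 2 * card (verts G - verts H)"
proof -
  let ?S = "verts H" and ?R = "verts G - verts H"
  define X where "X = candidates G H v \<inter> ?S"
  define T where "T = {s. \<exists>w\<in>?R. rooted p ?S w s}"
  have fR: "finite ?R" and fV: "finite (verts G)" using simple by (auto simp: simple_graph_def)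
  have fX: "finite X" unfolding X_def using fV S finite_subset by blast
  have "T \<subseteq> (\<lambda>w. THE s. rooted p ?S w s) ` ?R"
  proof
    fix s assume "s \<in> T"
    then obtain w where w: "w \<in> ?R" "rooted p ?S w s" by (auto simp: T_def)
    then have "(THE s. rooted p ?S w s) = s" by (intro the_equality) (auto dest: rooted_unique)
    then show "s \<in> (\<lambda>w. THE s. rooted p ?S w s) ` ?R" using w by force
  qed
  then have fT: "finite T" and cT: "card T \<le> card ?R"
    using fR by (auto intro: finite_subset surj_card_le)
  \<comment> \<open>An edge of \<open>H\<close> is the image of an edge of \<open>G\<close>; outside
    \<open>T\<close> a vertex of \<open>H\<close> is the image of itself alone, so that edge already
    joins \<open>x\<close> and \<open>y\<close>.\<close>
  have adj: "{x, y} \<in> edges G" if "x \<in> X - T" "y \<in> X - T" "x \<noteq> y" for x y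
  proof -
    have "{x, y} \<in> edges H"
      using that by (auto simp: X_def candidates_def closed_nbhd_def nbhd_def)
    then have "{x, y} \<in> quotient_edges G p ?S" using cf by (simp add: contraction_forest_def)
    then obtain s t a b where *: "{x, y} = {s, t}" "{a, b} \<in> edges G" "rooted p ?S a s"
      "rooted p ?S b t"
      unfolding quotient_edges_def by blast
    have st: "s \<notin> T" "t \<notin> T" using *(1) that by (auto simp: doubleton_eq_iff)
    have "a \<in> verts G" "b \<in> verts G" using simple_graph_edgeD[OF simple *(2)] by auto
    then have "a \<in> ?S" "b \<in> ?S" using st * by (auto simp: T_def)
    then have "a = s" "b = t" using * by (auto simp: rooted_base_iff)
    then show ?thesis using * by simp
  qed
  have cX: "card X \<le> degeneracy G + card ?R + 1"
  proof (cases "X - T = {}")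
    case True
    then have "card X \<le> card T" using fT by (intro card_mono) auto
    then show ?thesis using cT by simp
  next
    case False
    have "card (X - T) - 1 \<le> degeneracy G"
    proof (rule le_degeneracyI[OF simple _ False])
      show "X - T \<subseteq> verts G" using S by (auto simp: X_def)
      fix x assume x: "x \<in> X - T"
      have "(X - T) - {x} \<subseteq> nbhd G x \<inter> (X - T)" using adj x by (auto simp: nbhd_def)
      then have "card ((X - T) - {x}) \<le> card (nbhd G x \<inter> (X - T))"
        using fX by (intro card_mono) auto
      then show "card (X - T) - 1 \<le> card (nbhd G x \<inter> (X - T))" using x fX by simp
    qed
    moreover have "card X \<le> card (X - T) + card T"
      using card_mono[of "(X - T) \<union> T" X] card_Un_le[of "X - T" T] fX fT by force
    ultimately show ?thesis using cT by simp
  qed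
  \<comment> \<open>As \<open>v\<close> is not its own neighbour, at most \<open>card ?R - 1\<close>
    candidates lie outside \<open>H\<close>; this cancels the extra 1 in the bound for
    \<open>X\<close>.\<close>
  have "candidates G H v \<subseteq> X \<union> (?R - {v})"
    using simple_graph_edgeD[OF simple] by (auto simp: X_def candidates_def nbhd_def)
  then have "card (candidates G H v) \<le> card (X \<union> (?R - {v}))"
    using fX fR by (intro card_mono) auto
  also have "\<dots> \<le> card X + card (?R - {v})" by (rule card_Un_le)
  also have "card (?R - {v}) = card ?R - 1" using v fR by simp
  finally have "card (candidates G H v) \<le> card X + (card ?R - 1)" .
  moreover have "card ?R \<noteq> 0" using v fR by auto
  ultimately show ?thesis using cX by linarith
qed

section \<open>Weakest preconditions with time credits\<close>

text \<open>Keeps costs in the form of numerals.\<close>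
declare One_nat_def [simp del]

text \<open>A numeral is positive, so truncated subtraction cannot make the left side hold by
  accident. The simplifier thereby collects successive payments into one comparison with the
  credit.\<close>

lemma le_diff_iff_add_le [simp]: "numeral w \<le> c - a \<longleftrightarrow> numeral w + a \<le> (c::nat)"
  using zero_less_numeral[of w, where ?'a = nat] by linarith

text \<open>\<open>Q\<close> is a predicate of the final memory and the part of the credit \<open>c\<close> that is left.\<close>

definition wp :: "com \<Rightarrow> (memory \<Rightarrow> nat \<Rightarrow> bool) \<Rightarrow> memory \<Rightarrow> nat \<Rightarrow> bool" where
  "wp P Q M c \<longleftrightarrow> (\<exists>t M'. exec P M t M' \<and> t \<le> c \<and> Q M' (c - t))"

lemma wp_Skip [simp]: "wp Skip Q M c \<longleftrightarrow> 1 \<le> c \<and> Q M (c - 1)"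
  unfolding wp_def by (metis exec.Skip exec_SkipE)

lemma wp_Write [simp]:
  "wp (Write a e f) Q M c \<longleftrightarrow>
     1 + acost e + acost f \<le> c \<and> Q (store M a (aval e M) (aval f M)) (c - (1 + acost e + acost f))"
  unfolding wp_def by (metis exec.Write exec_WriteE)

lemma wp_Seq [simp]: "wp (Seq P P') Q M c \<longleftrightarrow> wp P (wp P' Q) M c"
proof
  assume "wp (Seq P P') Q M c"
  then obtain t M' where "exec (Seq P P') M t M'" and t: "t \<le> c" "Q M' (c - t)"
    by (auto simp: wp_def)
  then obtain t1 t2 M1 where *: "t = t1 + t2" "exec P M t1 M1" "exec P' M1 t2 M'"
    by (blast elim: exec_SeqE)
  with t have "t1 \<le> c" "t2 \<le> c - t1" "Q M' (c - t1 - t2)" by auto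
  with * show "wp P (wp P' Q) M c" unfolding wp_def by blast
next
  assume "wp P (wp P' Q) M c"
  then obtain t1 t2 M1 M' where *: "exec P M t1 M1" "t1 \<le> c" "exec P' M1 t2 M'" "t2 \<le> c - t1"
    "Q M' (c - t1 - t2)"
    by (auto simp: wp_def)
  then have "exec (Seq P P') M (t1 + t2) M'" "t1 + t2 \<le> c" "Q M' (c - (t1 + t2))"
    by (auto intro: exec.Seq)
  then show "wp (Seq P P') Q M c" unfolding wp_def by blast
qed

lemma wp_Cond [simp]:
  "wp (Cond b P P') Q M c \<longleftrightarrow>
     1 + bcost b \<le> c \<and> (if bval b M then wp P Q M (c - (1 + bcost b)) else wp P' Q M (c - (1 + bcost b)))"
proof -
  have "exec (Cond b P P') M t M' \<longleftrightarrow> (\<exists>t'. t = 1 + bcost b + t' \<and> exec (if bval b M then P else P') M t' M')"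
    for t M'
    by (auto elim!: exec_CondE intro: exec.CondTrue[simplified] exec.CondFalse[simplified])
  then have "wp (Cond b P P') Q M c \<longleftrightarrow> (\<exists>t M'. exec (if bval b M then P else P') M t M' \<and>
      1 + bcost b + t \<le> c \<and> Q M' (c - (1 + bcost b + t)))"
    unfolding wp_def by metis
  moreover have "1 + bcost b + t \<le> c \<and> Q M' (c - (1 + bcost b + t)) \<longleftrightarrow>
      1 + bcost b \<le> c \<and> t \<le> c - (1 + bcost b) \<and> Q M' (c - (1 + bcost b) - t)" for t M'
    by auto
  ultimately show ?thesis unfolding wp_def by auto
qed

lemma wp_conseq: "wp P Q M c \<Longrightarrow> (\<And>M' c'. Q M' c' \<Longrightarrow> R M' c') \<Longrightarrow> wp P R M c"
  unfolding wp_def by blast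

text \<open>Every iteration consumes a unit of the credit \<open>c\<close>, so no separate termination
  measure is needed.\<close>

lemma wp_While:
  assumes "I M c"
    and step: "\<And>M c. I M c \<Longrightarrow> bval b M \<Longrightarrow> 1 + bcost b \<le> c \<and> wp P I M (c - (1 + bcost b))"
    and exit: "\<And>M c. I M c \<Longrightarrow> \<not> bval b M \<Longrightarrow> 1 + bcost b \<le> c \<and> Q M (c - (1 + bcost b))"
  shows "wp (While b P) Q M c"
  using assms(1)
proof (induction c arbitrary: M rule: less_induct)
  case (less c)
  show ?case
  proof (cases "bval b M")
    case False
    then show ?thesis using exit[OF less.prems False] unfolding wp_def
      by (blast intro: exec.WhileFalse)
  next
    case True
    from step[OF less.prems True] obtain t M' where
      t: "1 + bcost b \<le> c" "exec P M t M'" "t \<le> c - (1 + bcost b)" "I M' (c - (1 + bcost b) - t)"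
      by (auto simp: wp_def)
    then have "wp (While b P) Q M' (c - (1 + bcost b) - t)" by (intro less.IH) auto
    then obtain t' M'' where "exec (While b P) M' t' M''" "t' \<le> c - (1 + bcost b) - t"
      "Q M'' (c - (1 + bcost b) - t - t')"
      by (auto simp: wp_def)
    moreover from this(1) have "exec (While b P) M (1 + bcost b + t + t') M''"
      using True t by (blast intro: exec.WhileTrue)
    ultimately show ?thesis using t unfolding wp_def
      by (intro exI[of _ "1 + bcost b + t + t'"] exI[of _ M'']) (auto simp: add.assoc)
  qed
qed

lemma store_apply [simp]: "store M a i x b = (if b = a then (M a)(i := x) else M b)"
  by (simp add: store_def)

abbreviation Var :: "nat \<Rightarrow> aexp" where "Var x \<equiv> Read x (Const 0)"

abbreviation Assign :: "nat \<Rightarrow> aexp \<Rightarrow> com" (infix "::=" 62) where "x ::= e \<equiv> Write x (Const 0) e"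

abbreviation Then :: "com \<Rightarrow> com \<Rightarrow> com" (infixr ";;" 60) where "P ;; Q \<equiv> Seq P Q"

abbreviation Or :: "bexp \<Rightarrow> bexp \<Rightarrow> bexp" where "Or b c \<equiv> Neg (Conj (Neg b) (Neg c))"

definition For :: "nat \<Rightarrow> nat \<Rightarrow> com \<Rightarrow> com" where
  "For i x P = (i ::= Const 0 ;;
     While (Less (Var i) (Var x)) (P ;; i ::= Plus (Var i) (Const 1)))"

text \<open>The invariant may mention the credit, which admits bodies whose cost is amortised over
  the iterations. The 3 pays for setting the counter to 0, one 6 for the loop test and the other 6
  for the increment.\<close>

lemma wp_For_credit:
  assumes init: "3 \<le> c" "I 0 (store M i 0 0) (c - 3)"
    and lim: "\<And>j M c. I j M c \<Longrightarrow> M x 0 = N"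
    and body: "\<And>j M c. j < N \<Longrightarrow> I j M c \<Longrightarrow> M i 0 = j \<Longrightarrow> 6 \<le> c \<and>
      wp P (\<lambda>M' c'. M' i 0 = j \<and> 6 \<le> c' \<and> I (Suc j) (store M' i 0 (Suc j)) (c' - 6)) M (c - 6)"
    and post: "\<And>M c. I N M c \<Longrightarrow> M i 0 = N \<Longrightarrow> 6 \<le> c \<and> Q M (c - 6)"
  shows "wp (For i x P) Q M c"
proof -
  let ?inv = "\<lambda>M c. \<exists>j. j \<le> N \<and> I j M c \<and> M i 0 = j"
  have "wp (While (Less (Var i) (Var x)) (P ;; i ::= Plus (Var i) (Const 1))) Q (store M i 0 0) (c - 3)"
  proof (rule wp_While[where I = ?inv])
    show "?inv (store M i 0 0) (c - 3)" using init by (auto intro!: exI[of _ 0])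
  next
    fix M' c' assume "?inv M' c'" and b: "bval (Less (Var i) (Var x)) M'"
    then obtain j where j: "I j M' c'" "M' i 0 = j" by blast
    then have jN: "j < N" using b lim[OF j(1)] by simp
    from body[OF jN j] have "6 \<le> c'"
      and "wp P (wp (i ::= Plus (Var i) (Const 1)) ?inv) M' (c' - 6)"
      using jN by (auto elim!: wp_conseq simp: Suc_eq_plus1)
    then show "1 + bcost (Less (Var i) (Var x)) \<le> c' \<and>
        wp (P ;; i ::= Plus (Var i) (Const 1)) ?inv M' (c' - (1 + bcost (Less (Var i) (Var x))))"
      by simp
  next
    fix M' c' assume "?inv M' c'" and b: "\<not> bval (Less (Var i) (Var x)) M'"
    then obtain j where j: "j \<le> N" "I j M' c'" "M' i 0 = j" by blast
    then have "j = N" using b lim[OF j(2)] by simp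
    then show "1 + bcost (Less (Var i) (Var x)) \<le> c' \<and> Q M' (c' - (1 + bcost (Less (Var i) (Var x))))"
      using post[of M' c'] j by simp
  qed
  then show ?thesis using init by (simp add: For_def del: store_apply)
qed

text \<open>\<open>T\<close> bounds every iteration of the body. The 20 covers loop test and
  increment, 12 in all; the additional iteration in \<open>N + 1\<close> covers the initialisation
  and the final test.\<close>

lemma wp_For:
  assumes init: "I 0 (store M i 0 0)"
    and lim: "\<And>j M. I j M \<Longrightarrow> M x 0 = N"
    and credit: "(N + 1) * (T + 20) \<le> c"
    and body: "\<And>j M c. j < N \<Longrightarrow> I j M \<Longrightarrow> M i 0 = j \<Longrightarrow> T \<le> c \<Longrightarrow>
      wp P (\<lambda>M' c'. M' i 0 = j \<and> I (Suc j) (store M' i 0 (Suc j)) \<and> c \<le> c' + T) M c"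
    and post: "\<And>M c'. I N M \<Longrightarrow> M i 0 = N \<Longrightarrow> c \<le> c' + (N + 1) * (T + 20) \<Longrightarrow> Q M c'"
  shows "wp (For i x P) Q M c"
\<comment> \<open>Of the two inequalities in the invariant, the first limits what has been spent so
  far, the second says what is still in reserve.\<close>
proof (rule wp_For_credit[where N = N and
      I = "\<lambda>j M' c'. I j M' \<and> c \<le> c' + j * (T + 20) + 3 \<and> (N - j) * (T + 20) + 7 \<le> c'"])
  have split: "(N + 1) * (T + 20) = N * (T + 20) + T + 20" by (simp only: add_mult_distrib mult_1 add.assoc)
  then show "3 \<le> c" using credit by linarith
  show "I 0 (store M i 0 0) \<and> c \<le> c - 3 + 0 * (T + 20) + 3 \<and> (N - 0) * (T + 20) + 7 \<le> c - 3"
    using init credit split by auto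
  show "M x 0 = N" if "I j M \<and> c \<le> c' + j * (T + 20) + 3 \<and> (N - j) * (T + 20) + 7 \<le> c'" for j M c'
    using that lim by blast
next
  fix j M' c' assume jN: "j < N" and i: "M' i 0 = j"
    and "I j M' \<and> c \<le> c' + j * (T + 20) + 3 \<and> (N - j) * (T + 20) + 7 \<le> c'"
  then have j: "I j M'" "c \<le> c' + j * (T + 20) + 3" "(N - j) * (T + 20) + 7 \<le> c'" by auto
  have "(N - j) * (T + 20) = (N - Suc j) * (T + 20) + (T + 20)"
    using jN by (metis Suc_diff_Suc add.commute mult_Suc)
  then have c': "(N - Suc j) * (T + 20) + T + 27 \<le> c'" using j(3) by linarith
  have "wp P (\<lambda>M'' c''. M'' i 0 = j \<and> I (Suc j) (store M'' i 0 (Suc j)) \<and> c' - 6 \<le> c'' + T) M' (c' - 6)"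
    using c' by (intro body[OF jN j(1) i]) linarith
  then have "wp P (\<lambda>M'' c''. M'' i 0 = j \<and> 6 \<le> c'' \<and> I (Suc j) (store M'' i 0 (Suc j)) \<and>
      c \<le> c'' - 6 + Suc j * (T + 20) + 3 \<and> (N - Suc j) * (T + 20) + 7 \<le> c'' - 6) M' (c' - 6)"
  proof (rule wp_conseq)
    fix M'' c'' assume *: "M'' i 0 = j \<and> I (Suc j) (store M'' i 0 (Suc j)) \<and> c' - 6 \<le> c'' + T"
    have "Suc j * (T + 20) = j * (T + 20) + T + 20" by simp
    moreover have "c' \<le> c'' + T + 6" using * c' by linarith
    ultimately have "6 \<le> c''" "c \<le> c'' - 6 + Suc j * (T + 20) + 3"
      "(N - Suc j) * (T + 20) + 7 \<le> c'' - 6"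
      using c' j(2) by linarith+
    with * show "M'' i 0 = j \<and> 6 \<le> c'' \<and> I (Suc j) (store M'' i 0 (Suc j)) \<and>
        c \<le> c'' - 6 + Suc j * (T + 20) + 3 \<and> (N - Suc j) * (T + 20) + 7 \<le> c'' - 6" by blast
  qed
  moreover have "6 \<le> c'" using c' by simp
  ultimately show "6 \<le> c' \<and> wp P (\<lambda>M'' c''. M'' i 0 = j \<and> 6 \<le> c'' \<and>
      I (Suc j) (store M'' i 0 (Suc j)) \<and> c \<le> c'' - 6 + Suc j * (T + 20) + 3 \<and>
      (N - Suc j) * (T + 20) + 7 \<le> c'' - 6) M' (c' - 6)" by blast
next
  fix M' c' assume "I N M' \<and> c \<le> c' + N * (T + 20) + 3 \<and> (N - N) * (T + 20) + 7 \<le> c'" "M' i 0 = N"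
  then show "6 \<le> c' \<and> Q M' (c' - 6)" by (auto simp: add_mult_distrib intro!: post)
qed

abbreviation same :: "nat set \<Rightarrow> memory \<Rightarrow> memory \<Rightarrow> bool" where
  "same A M M' \<equiv> \<forall>a. a \<notin> A \<longrightarrow> M' a = M a"

definition holds :: "(nat \<Rightarrow> nat) \<Rightarrow> nat list \<Rightarrow> bool" where
  "holds f xs \<longleftrightarrow> (\<forall>i<length xs. f i = xs ! i)"

lemma holds_Nil [simp]: "holds f []"
  by (simp add: holds_def)

lemma holds_snoc [simp]: "holds (f(length xs := x)) (xs @ [x]) \<longleftrightarrow> holds f xs"
  by (auto simp: holds_def nth_append less_Suc_eq)

section \<open>Reading the input and listing neighbours\<close>

text \<open>
  Array 0 is the input and array 1 the output.  Registers (prefix \<open>r\<close>) are arrays of which only cell 0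
  is used.  Most other arrays are indexed by vertex labels.  Two-dimensional data lie at \<open>row x + i\<close>
  with \<open>i < n\<close>, where \<open>row x\<close> is \<open>n\<close> times the position of \<open>x\<close> in the vertex list; these offsets are
  computed once by addition, as the machine has no multiplication.
\<close>

abbreviation (input) "rN \<equiv> (2::nat)"
abbreviation (input) "rM \<equiv> (3::nat)"
abbreviation (input) "rVB \<equiv> (4::nat)"
abbreviation (input) "rEB \<equiv> (5::nat)"
abbreviation (input) "rHN \<equiv> (6::nat)"
abbreviation (input) "rHM \<equiv> (7::nat)"
abbreviation (input) "rHV \<equiv> (8::nat)"
abbreviation (input) "rHE \<equiv> (9::nat)"
abbreviation (input) "rK \<equiv> (10::nat)"
abbreviation (input) "rB \<equiv> (11::nat)"
abbreviation (input) "aRow \<equiv> (12::nat)"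
abbreviation (input) "aCol \<equiv> (13::nat)"
abbreviation (input) "aIn \<equiv> (14::nat)"
abbreviation (input) "aRem \<equiv> (15::nat)"
abbreviation (input) "aNb \<equiv> (16::nat)"
abbreviation (input) "aDeg \<equiv> (17::nat)"
abbreviation (input) "aCand \<equiv> (18::nat)"
abbreviation (input) "aLen \<equiv> (19::nat)"
abbreviation (input) "rI \<equiv> (20::nat)"
abbreviation (input) "rJ \<equiv> (21::nat)"
abbreviation (input) "rX \<equiv> (22::nat)"
abbreviation (input) "rY \<equiv> (23::nat)"
abbreviation (input) "rZ \<equiv> (24::nat)"
abbreviation (input) "rA \<equiv> (25::nat)"
abbreviation (input) "rD \<equiv> (26::nat)"
abbreviation (input) "rL \<equiv> (27::nat)"
abbreviation (input) "rOk \<equiv> (28::nat)"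
abbreviation (input) "rGo \<equiv> (29::nat)"
abbreviation (input) "rQH \<equiv> (30::nat)"
abbreviation (input) "rQT \<equiv> (31::nat)"
abbreviation (input) "rD0 \<equiv> (32::nat)"
abbreviation (input) "aMk \<equiv> (33::nat)"
abbreviation (input) "aCt \<equiv> (34::nat)"
abbreviation (input) "aRd \<equiv> (35::nat)"
abbreviation (input) "aQ \<equiv> (36::nat)"
abbreviation (input) "aDg \<equiv> (37::nat)"
abbreviation (input) "aW \<equiv> (38::nat)"
abbreviation (input) "aRes \<equiv> (39::nat)"
abbreviation (input) "aPar \<equiv> (40::nat)"
abbreviation (input) "aMat \<equiv> (41::nat)"

abbreviation incr :: "nat \<Rightarrow> com" where "incr x \<equiv> x ::= Plus (Var x) (Const 1)"

abbreviation incr_at :: "nat \<Rightarrow> aexp \<Rightarrow> com" where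
  "incr_at a e \<equiv> Write a e (Plus (Read a e) (Const 1))"

abbreviation item :: "nat \<Rightarrow> nat \<Rightarrow> aexp" where "item b i \<equiv> Read 0 (Plus (Var b) (Var i))"

abbreviation edge1 :: "nat \<Rightarrow> nat \<Rightarrow> aexp" where
  "edge1 b i \<equiv> Read 0 (Plus (Plus (Var b) (Var i)) (Var i))"

abbreviation edge2 :: "nat \<Rightarrow> nat \<Rightarrow> aexp" where
  "edge2 b i \<equiv> Read 0 (Plus (Plus (Plus (Var b) (Var i)) (Var i)) (Const 1))"

definition read_header :: com where
  "read_header =
     rN ::= Read 0 (Const 0) ;; rM ::= Read 0 (Const 1) ;;
     rVB ::= Const 2 ;; rEB ::= Plus (Const 2) (Var rN) ;;
     rHV ::= Plus (Plus (Var rEB) (Var rM)) (Var rM) ;;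
     rHN ::= Read 0 (Var rHV) ;; rHM ::= Read 0 (Plus (Var rHV) (Const 1)) ;;
     rHV ::= Plus (Var rHV) (Const 2) ;; rHE ::= Plus (Var rHV) (Var rHN)"

definition number_vertices :: com where
  "number_vertices =
     rA ::= Const 0 ;;
     For rI rN (rX ::= item rVB rI ;; Write aRow (Var rX) (Var rA) ;; Write aCol (Var rX) (Var rI) ;;
       rA ::= Plus (Var rA) (Var rN))"

definition mark_kept :: com where
  "mark_kept = For rI rHN (Write aIn (item rHV rI) (Const 1))"

definition list_removed :: com where
  "list_removed =
     For rI rN (rX ::= item rVB rI ;;
       Cond (Equal (Read aIn (Var rX)) (Const 0)) (Write aRem (Var rK) (Var rX) ;; incr rK) Skip)"

definition list_neighbours :: com where
  "list_neighbours =
     For rI rM (rX ::= edge1 rEB rI ;; rY ::= edge2 rEB rI ;;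
       Write aNb (Plus (Read aRow (Var rX)) (Read aDeg (Var rX))) (Var rY) ;;
       incr_at aDeg (Var rX) ;;
       Write aNb (Plus (Read aRow (Var rY)) (Read aDeg (Var rY))) (Var rX) ;;
       incr_at aDeg (Var rY))"

text \<open>Neighbours appear in the order of the edge list, so that appending an edge extends the
  same two lists that the loop of \<open>list_neighbours\<close> extends.\<close>

definition adjl :: "(nat \<times> nat) list \<Rightarrow> nat \<Rightarrow> nat list" where
  "adjl es x = concat (map (\<lambda>(a, b). if a = x then [b] else if b = x then [a] else []) es)"

lemma adjl_Nil [simp]: "adjl [] x = []"
  by (simp add: adjl_def)

lemma adjl_append: "adjl (es @ fs) x = adjl es x @ adjl fs x"
  unfolding adjl_def map_append concat_append ..

lemma adjl_single: "adjl [(a, b)] x = (if a = x then [b] else if b = x then [a] else [])"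
  unfolding adjl_def list.map concat.simps prod.case append_Nil2 ..

lemma adjl_snoc:
  "a \<noteq> b \<Longrightarrow> adjl (es @ [(a, b)]) = (adjl es)(a := adjl es a @ [b], b := adjl es b @ [a])"
  by (rule ext) (simp add: adjl_append adjl_single)

lemma in_set_adjl: "y \<in> set (adjl es x) \<longleftrightarrow> (x, y) \<in> set es \<or> (y, x) \<in> set es"
proof (induction es rule: rev_induct)
  case (snoc e es)
  obtain a b where e: "e = (a, b)" by force
  have "y \<in> set (adjl [(a, b)] x) \<longleftrightarrow> x = a \<and> y = b \<or> y = a \<and> x = b"
    by (cases "a = x"; cases "b = x") (auto simp: adjl_single)
  then show ?case unfolding e adjl_append set_append Un_iff snoc.IH by simp blast
qed simp

lemma distinct_adjl: "distinct (map (\<lambda>(u, v). {u, v}) es) \<Longrightarrow> distinct (adjl es x)"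
proof (induction es rule: rev_induct)
  case (snoc e es)
  obtain a b where e: "e = (a, b)" by force
  \<comment> \<open>Distinctness refers to unordered pairs and thus also excludes a repetition in
    the opposite orientation.\<close>
  have *: "(a, b) \<notin> set es \<and> (b, a) \<notin> set es"
  proof (intro conjI notI)
    assume "(a, b) \<in> set es"
    then have "{a, b} \<in> (\<lambda>(u, v). {u, v}) ` set es" by force
    then show False using snoc.prems by (simp add: e)
  next
    assume "(b, a) \<in> set es"
    then have "{b, a} \<in> (\<lambda>(u, v). {u, v}) ` set es" by force
    then show False using snoc.prems by (simp add: e insert_commute)
  qed
  have "adjl (es @ [e]) x = adjl es x @ (if a = x then [b] else if b = x then [a] else [])"
    by (simp only: adjl_append adjl_single e)
  then show ?case using snoc * by (cases "a = x"; cases "b = x") (simp_all add: in_set_adjl)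
qed simp

section \<open>A fixed instance and its representation in memory\<close>

locale contraction_instance =
  fixes G H :: "nat graph" and vs es vh eh
  assumes simple_G: "simple_graph G" and simple_H: "simple_graph H"
    and sub: "verts H \<subseteq> verts G"
    and lists_G: "lists_graph vs es G" and lists_H: "lists_graph vh eh H"
begin

abbreviation "n \<equiv> length vs"
abbreviation "m \<equiv> length es"
abbreviation "nh \<equiv> length vh"
abbreviation "mh \<equiv> length eh"

lemma set_vs: "set vs = verts G" and distinct_vs: "distinct vs"
  and set_vh: "set vh = verts H" and distinct_vh: "distinct vh"
  and distinct_es: "distinct (map (\<lambda>(u, v). {u, v}) es)"
  and distinct_eh: "distinct (map (\<lambda>(u, v). {u, v}) eh)"
  using lists_G lists_H by (auto simp: lists_graph_def)

lemma edges_G: "{a, b} \<in> edges G \<longleftrightarrow> (a, b) \<in> set es \<or> (b, a) \<in> set es"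
proof -
  have "edges G = (\<lambda>(u, v). {u, v}) ` set es" using lists_G by (auto simp: lists_graph_def)
  then show ?thesis by (auto simp: doubleton_eq_iff image_iff split: prod.splits)
qed

lemma edges_H: "{a, b} \<in> edges H \<longleftrightarrow> (a, b) \<in> set eh \<or> (b, a) \<in> set eh"
proof -
  have "edges H = (\<lambda>(u, v). {u, v}) ` set eh" using lists_H by (auto simp: lists_graph_def)
  then show ?thesis by (auto simp: doubleton_eq_iff image_iff split: prod.splits)
qed

lemma es_nth:
  assumes "i < m"
  shows "fst (es ! i) \<in> verts G" "snd (es ! i) \<in> verts G" "fst (es ! i) \<noteq> snd (es ! i)"
  using simple_graph_edgeD[OF simple_G, of "fst (es ! i)" "snd (es ! i)"]
    edges_G[of "fst (es ! i)" "snd (es ! i)"] nth_mem[OF assms] by auto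

lemma eh_nth:
  assumes "i < mh"
  shows "fst (eh ! i) \<in> verts H" "snd (eh ! i) \<in> verts H" "fst (eh ! i) \<noteq> snd (eh ! i)"
  using simple_graph_edgeD[OF simple_H, of "fst (eh ! i)" "snd (eh ! i)"]
    edges_H[of "fst (eh ! i)" "snd (eh ! i)"] nth_mem[OF assms] by auto

lemma set_adjl_es: "set (adjl es x) = nbhd G x"
  by (intro set_eqI) (simp add: in_set_adjl nbhd_def edges_G)

text \<open>A vertex is not its own neighbour, hence the strict bound, by which no list overflows
  its row of width \<open>n\<close>. Prefixes of the edge list are allowed because loop invariants
  refer to them.\<close>

lemma length_adjl_less:
  assumes "x \<in> verts G"
  shows "length (adjl (take j es) x) < n"
proof -
  have "distinct (adjl (take j es) x)"
    using distinct_es by (intro distinct_adjl) (metis distinct_take take_map)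
  then have "length (adjl (take j es) x) = card (set (adjl (take j es) x))"
    by (simp add: distinct_card)
  also have "set (adjl (take j es) x) \<subseteq> verts G - {x}"
    using simple_graph_edgeD[OF simple_G, unfolded edges_G] by (intro subsetI) (simp add: in_set_adjl, blast dest: in_set_takeD)
  then have "card (set (adjl (take j es) x)) \<le> card (verts G - {x})"
    using simple_G by (intro card_mono) (auto simp: simple_graph_def)
  also have "\<dots> < card (verts G)"
    using simple_G assms by (intro psubset_card_mono) (auto simp: simple_graph_def)
  also have "card (verts G) = n" using distinct_card[OF distinct_vs] set_vs by simp
  finally show ?thesis .
qed

text \<open>Addresses are written as the program evaluates them, with \<open>i + i\<close> in place
  of a product.\<close>

definition input_ok :: "memory \<Rightarrow> bool" where
  "input_ok M \<longleftrightarrow> M rN 0 = n \<and> M rM 0 = m \<and> M rHN 0 = nh \<and> M rHM 0 = mh \<and>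
     (\<forall>i<n. M 0 (M rVB 0 + i) = vs ! i) \<and>
     (\<forall>i<m. M 0 (M rEB 0 + i + i) = fst (es ! i) \<and> M 0 (M rEB 0 + i + i + 1) = snd (es ! i)) \<and>
     (\<forall>i<nh. M 0 (M rHV 0 + i) = vh ! i) \<and>
     (\<forall>i<mh. M 0 (M rHE 0 + i + i) = fst (eh ! i) \<and> M 0 (M rHE 0 + i + i + 1) = snd (eh ! i))"

text \<open>Abstracts from the actual offsets: rows of width \<open>n\<close> are disjoint and
  columns distinct. The same rows thus serve for one list per vertex and for a matrix indexed by two
  vertices.\<close>

definition layout :: "(nat \<Rightarrow> nat) \<Rightarrow> (nat \<Rightarrow> nat) \<Rightarrow> bool" where
  "layout row col \<longleftrightarrow>
     (\<forall>x\<in>verts G. \<forall>y\<in>verts G. \<forall>i<n. \<forall>j<n. row x + i = row y + j \<longrightarrow> x = y \<and> i = j) \<and>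
     (\<forall>x\<in>verts G. col x < n) \<and> inj_on col (verts G)"

definition rows_hold :: "(nat \<Rightarrow> nat) \<Rightarrow> (nat \<Rightarrow> nat) \<Rightarrow> (nat \<Rightarrow> nat list) \<Rightarrow> bool" where
  "rows_hold f row l \<longleftrightarrow> (\<forall>x\<in>verts G. holds (\<lambda>i. f (row x + i)) (l x))"

text \<open>The new entry still falls into the row of \<open>a\<close>, as lists are shorter than
  \<open>n\<close>, and therefore touches no other row.\<close>

lemma rows_hold_snoc:
  assumes "rows_hold f row l" "layout row col" "a \<in> verts G" "\<And>x. x \<in> verts G \<Longrightarrow> length (l x) < n"
  shows "rows_hold (f(row a + length (l a) := b)) row (l(a := l a @ [b]))"
  unfolding rows_hold_def
proof
  fix x assume x: "x \<in> verts G"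
  have h: "holds (\<lambda>i. f (row x + i)) (l x)" using assms x by (auto simp: rows_hold_def)
  show "holds (\<lambda>i. (f(row a + length (l a) := b)) (row x + i)) ((l(a := l a @ [b])) x)"
  proof (cases "x = a")
    case True
    have "(\<lambda>i. (f(row a + length (l a) := b)) (row x + i)) = (\<lambda>i. f (row x + i))(length (l a) := b)"
      using True by (auto simp: fun_eq_iff)
    then show ?thesis using True h by simp
  next
    case False
    have "row x + i \<noteq> row a + length (l a)" if "i < length (l x)" for i
    proof
      assume eq: "row x + i = row a + length (l a)"
      have "i < n" using that assms(4)[OF x] by simp
      then show False using assms(2,3) assms(4)[of a] x eq False unfolding layout_def by blast
    qed
    then show ?thesis using False h by (auto simp: holds_def)
  qed
qed

lemma wp_number_vertices:
  assumes "input_ok M" "(n + 1) * 50 + 10 \<le> c"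
    and Q: "\<And>M' c'. same {rI, rX, rA, aRow, aCol} M M' \<Longrightarrow> layout (M' aRow) (M' aCol) \<Longrightarrow>
      c \<le> c' + (n + 1) * 50 + 10 \<Longrightarrow> Q M' c'"
  shows "wp number_vertices Q M c"
proof -
  let ?I = "\<lambda>j M'. same {rI, rX, rA, aRow, aCol} M M' \<and> M' rA 0 = j * n \<and>
    (\<forall>i<j. M' aRow (vs ! i) = i * n \<and> M' aCol (vs ! i) = i)"
  show ?thesis unfolding number_vertices_def
    apply (simp del: store_apply)
    apply (intro conjI)
    subgoal using assms(2) by simp
    apply (rule wp_For[where I = ?I and N = n and T = 30])
    subgoal using assms(1) by (simp add: input_ok_def)
    subgoal using assms(1) by (simp add: input_ok_def)
    subgoal using assms(2) by simp
    subgoal for j M' c'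
      using assms(1) distinct_vs by (auto simp: input_ok_def nth_eq_iff_index_eq less_Suc_eq)
    subgoal premises p for M' c'
    proof (rule Q)
      have row: "\<And>i. i < n \<Longrightarrow> M' aRow (vs ! i) = i * n" and
        col: "\<And>i. i < n \<Longrightarrow> M' aCol (vs ! i) = i" using p(1) by auto
      have dm: "(i * n + a) div n = i" "(i * n + a) mod n = a" if "a < n" for i a
        using that by (auto simp: div_add1_eq)
      show "layout (M' aRow) (M' aCol)" unfolding layout_def set_vs[symmetric]
      proof (intro conjI ballI allI impI)
        fix x y i j assume *: "x \<in> set vs" "y \<in> set vs" "i < n" "j < n" "M' aRow x + i = M' aRow y + j"
        then obtain a b where ab: "a < n" "b < n" "x = vs ! a" "y = vs ! b" by (metis in_set_conv_nth)
        then have "a * n + i = b * n + j" using * row by simp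
        then have "a = b \<and> i = j" using dm *(3,4) by metis
        then show "x = y" "i = j" using ab by auto
      next
        fix x assume "x \<in> set vs"
        then show "M' aCol x < n" using col by (metis in_set_conv_nth)
      next
        show "inj_on (M' aCol) (set vs)" by (rule inj_onI) (metis col in_set_conv_nth)
      qed
    qed (use p in auto)
    done
qed

end

section \<open>Listing the candidates\<close>

definition mark_neighbours :: com where
  "mark_neighbours =
     For rJ rL (rY ::= Read aNb (Plus (Read aRow (Var rX)) (Var rJ)) ;;
       Write aMk (Var rY) (Const 1) ;; Write aCt (Var rY) (Const 0) ;;
       Cond (Equal (Read aIn (Var rY)) (Const 1)) (incr rD) Skip)"

text \<open>Candidates are recognised by counting. A neighbour \<open>y\<close> of \<open>v\<close>
  in \<open>H\<close> is equal or \<open>H\<close>-adjacent to all neighbours of \<open>v\<close> in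
  \<open>H\<close> iff the edges of \<open>H\<close> from \<open>y\<close> to marked vertices number
  one less than these neighbours, \<open>y\<close> itself making the difference. A single pass over
  the edges of \<open>H\<close> serves all \<open>y\<close>.\<close>

definition count_edges :: com where
  "count_edges =
     For rJ rHM (rY ::= edge1 rHE rJ ;; rZ ::= edge2 rHE rJ ;;
       Cond (Conj (Equal (Read aMk (Var rY)) (Const 1)) (Equal (Read aMk (Var rZ)) (Const 1)))
         (incr_at aCt (Var rY) ;; incr_at aCt (Var rZ)) Skip)"

text \<open>Marks are cleared along the way, so that all are 0 again for the next removed
  vertex.\<close>

definition select_candidates :: com where
  "select_candidates =
     For rJ rL (rY ::= Read aNb (Plus (Read aRow (Var rX)) (Var rJ)) ;;
       Write aMk (Var rY) (Const 0) ;;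
       Cond (Or (Equal (Read aIn (Var rY)) (Const 0))
                (Equal (Plus (Read aCt (Var rY)) (Const 1)) (Var rD)))
         (Write aCand (Plus (Read aRow (Var rX)) (Var rA)) (Var rY) ;; incr rA) Skip)"

definition list_candidates :: com where
  "list_candidates =
     For rI rK (rX ::= Read aRem (Var rI) ;; rL ::= Read aDeg (Var rX) ;;
       rD ::= Const 0 ;; mark_neighbours ;; count_edges ;; rA ::= Const 0 ;; select_candidates ;;
       Write aLen (Var rX) (Var rA) ;; Cond (Less (Var rB) (Var rA)) (rB ::= Var rA) Skip)"

definition cover_count :: "(nat \<times> nat) list \<Rightarrow> nat set \<Rightarrow> nat \<Rightarrow> nat" where
  "cover_count es A y = length (filter (\<lambda>(a, b). a \<in> A \<and> b \<in> A \<and> (y = a \<or> y = b)) es)"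

lemma cover_count_Nil [simp]: "cover_count [] A y = 0"
  by (simp add: cover_count_def)

lemma cover_count_snoc [simp]:
  "cover_count (es @ [e]) A y = cover_count es A y +
     (if fst e \<in> A \<and> snd e \<in> A \<and> (y = fst e \<or> y = snd e) then 1 else 0)"
  by (simp add: cover_count_def case_prod_unfold)

context contraction_instance
begin

definition removed :: "nat list" where "removed = filter (\<lambda>x. x \<notin> verts H) vs"

abbreviation "k \<equiv> length removed"

lemma set_removed: "set removed = verts G - verts H"
  by (auto simp: removed_def set_vs)

lemma removed_nth: "i < k \<Longrightarrow> removed ! i \<in> verts G" "i < k \<Longrightarrow> removed ! i \<notin> verts H"
  using set_removed nth_mem by blast+

lemma distinct_removed: "distinct removed"
  by (simp add: removed_def distinct_vs)

lemma card_verts_G: "card (verts G) = n"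
  using distinct_card[OF distinct_vs] by (simp add: set_vs)

lemma card_verts_H: "card (verts H) = nh"
  using distinct_card[OF distinct_vh] by (simp add: set_vh)

lemma k_eq: "k = n - nh"
proof -
  have "k = card (verts G - verts H)" using distinct_card[OF distinct_removed] by (simp add: set_removed)
  also have "\<dots> = card (verts G) - card (verts H)"
    using sub simple_H by (intro card_Diff_subset) (auto simp: simple_graph_def)
  finally show ?thesis by (simp add: card_verts_G card_verts_H)
qed

lemma nh_le: "nh \<le> n"
  using card_mono[OF _ sub] simple_G by (simp add: card_verts_G card_verts_H simple_graph_def)

lemma wp_mark_kept:
  assumes "input_ok M" "M aIn = (\<lambda>_. 0)" "(n + 1) * 50 \<le> c"
    and Q: "\<And>M' c'. same {rI, aIn} M M' \<Longrightarrow> M' aIn = (\<lambda>x. if x \<in> verts H then 1 else 0) \<Longrightarrow>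
      c \<le> c' + (n + 1) * 50 \<Longrightarrow> Q M' c'"
  shows "wp mark_kept Q M c"
  unfolding mark_kept_def
  apply (rule wp_For[where I = "\<lambda>j M'. same {rI, aIn} M M' \<and>
      M' aIn = (\<lambda>x. if x \<in> set (take j vh) then 1 else 0)" and N = nh and T = 30])
  subgoal using assms(2) by simp
  subgoal using assms(1) by (simp add: input_ok_def)
  subgoal using assms(3) nh_le by (auto intro: order_trans[rotated])
  subgoal for j M' c'
    using assms(1) by (auto simp: input_ok_def fun_eq_iff take_Suc_conv_app_nth)
  subgoal premises p for M' c'
    using p(1) p(3) nh_le by (intro Q) (auto simp: set_vh intro: order_trans add_left_mono)
  done

lemma wp_list_removed:
  assumes "input_ok M" "M aIn = (\<lambda>x. if x \<in> verts H then 1 else 0)" "M rK 0 = 0"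
    "(n + 1) * 50 \<le> c"
    and Q: "\<And>M' c'. same {rI, rX, rK, aRem} M M' \<Longrightarrow> M' rK 0 = k \<Longrightarrow> holds (M' aRem) removed \<Longrightarrow>
      c \<le> c' + (n + 1) * 50 \<Longrightarrow> Q M' c'"
  shows "wp list_removed Q M c"
  unfolding list_removed_def
  apply (rule wp_For[where I = "\<lambda>j M'. same {rI, rX, rK, aRem} M M' \<and>
      M' rK 0 = length (filter (\<lambda>x. x \<notin> verts H) (take j vs)) \<and>
      holds (M' aRem) (filter (\<lambda>x. x \<notin> verts H) (take j vs))" and N = n and T = 30])
  subgoal using assms(3) by simp
  subgoal using assms(1) by (simp add: input_ok_def)
  subgoal using assms(4) by simp
  subgoal for j M' c'
    using assms(1,2) by (auto simp: input_ok_def take_Suc_conv_app_nth)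
  subgoal premises p for M' c'
    using p(1) p(3) by (intro Q) (auto simp: removed_def)
  done

lemma wp_list_neighbours:
  assumes inp: "input_ok M" and lay: "layout (M aRow) (M aCol)" and deg: "M aDeg = (\<lambda>_. 0)"
    and c: "(m + 1) * 100 \<le> c"
    and Q: "\<And>M' c'. same {rI, rX, rY, aNb, aDeg} M M' \<Longrightarrow> rows_hold (M' aNb) (M' aRow) (adjl es) \<Longrightarrow>
      \<forall>x\<in>verts G. M' aDeg x = length (adjl es x) \<Longrightarrow> c \<le> c' + (m + 1) * 100 \<Longrightarrow> Q M' c'"
  shows "wp list_neighbours Q M c"
  unfolding list_neighbours_def
  apply (rule wp_For[where I = "\<lambda>j M'. same {rI, rX, rY, aNb, aDeg} M M' \<and>
      rows_hold (M' aNb) (M' aRow) (adjl (take j es)) \<and>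
      (\<forall>x\<in>verts G. M' aDeg x = length (adjl (take j es) x))" and N = m and T = 80])
  subgoal using deg by (simp add: rows_hold_def)
  subgoal using inp by (simp add: input_ok_def)
  subgoal using c by simp
  subgoal premises p for j M' c'
  proof -
    define a b L where "a = fst (es ! j)" and "b = snd (es ! j)" and "L = adjl (take j es)"
    have ab: "a \<in> verts G" "b \<in> verts G" "a \<noteq> b" using es_nth[OF p(1)] by (auto simp: a_def b_def)
    have e: "take (Suc j) es = take j es @ [(a, b)]"
      using p(1) by (simp add: take_Suc_conv_app_nth a_def b_def)
    have L': "adjl (take (Suc j) es) = L(a := L a @ [b], b := L b @ [a])"
      unfolding e L_def using ab by (simp add: adjl_snoc)
    have len: "length (L x) < n" if "x \<in> verts G" for x
      using length_adjl_less[OF that] by (simp add: L_def)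
    have len': "length ((L(a := L a @ [b])) x) < n" if "x \<in> verts G" for x
      using length_adjl_less[OF that, of "Suc j"] len[OF that] ab unfolding L' by (auto split: if_splits)
    have h: "M' aRow = M aRow" "rows_hold (M' aNb) (M aRow) L" "M' aDeg a = length (L a)"
      "M' aDeg b = length (L b)" "M' 0 (M' rEB 0 + j + j) = a" "M' 0 (M' rEB 0 + j + j + 1) = b"
      using p ab inp by (auto simp: L_def a_def b_def input_ok_def)
    have "rows_hold ((M' aNb)(M aRow a + length (L a) := b)) (M aRow) (L(a := L a @ [b]))"
      using rows_hold_snoc[OF h(2) lay ab(1) len] by simp
    from rows_hold_snoc[OF this lay ab(2) len', of a]
    have "rows_hold ((M' aNb)(M aRow a + length (L a) := b, M aRow b + length (L b) := a))
        (M aRow) (L(a := L a @ [b], b := L b @ [a]))"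
      by (simp only: fun_upd_other[OF ab(3)[symmetric]])
    then show ?thesis using p(2-) h ab unfolding L' by (simp add: L_def)
  qed
  subgoal premises p for M' c'
    using p(1) p(3) by (intro Q) auto
  done

definition ready :: "memory \<Rightarrow> bool" where
  "ready M \<longleftrightarrow> input_ok M \<and> layout (M aRow) (M aCol) \<and>
     M aIn = (\<lambda>x. if x \<in> verts H then 1 else 0) \<and> M rK 0 = k \<and> holds (M aRem) removed \<and>
     rows_hold (M aNb) (M aRow) (adjl es) \<and> (\<forall>x\<in>verts G. M aDeg x = length (adjl es x))"

text \<open>Arrays are numbered so that everything \<open>ready\<close> speaks of lies in array 0
  and arrays 2 to 17; the exception 11 is \<open>rB\<close>, which changes while candidates are
  listed.\<close>

lemma ready_cong: "ready M \<Longrightarrow> \<forall>a. a = 0 \<or> 2 \<le> a \<and> a \<le> 17 \<and> a \<noteq> 11 \<longrightarrow> M' a = M a \<Longrightarrow> ready M'"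
  by (simp add: ready_def input_ok_def)

definition kept_degree :: "nat \<Rightarrow> nat" where
  "kept_degree v = length (filter (\<lambda>y. y \<in> verts H) (adjl es v))"

definition cand :: "nat \<Rightarrow> nat list" where
  "cand v = filter (\<lambda>y. y \<notin> verts H \<or> cover_count eh (set (adjl es v)) y + 1 = kept_degree v) (adjl es v)"

definition max_cand :: "nat list \<Rightarrow> nat" where
  "max_cand xs = Max (insert 0 ((\<lambda>v. length (cand v)) ` set xs))"

lemma max_cand_Nil [simp]: "max_cand [] = 0"
  by (simp add: max_cand_def)

lemma max_cand_snoc [simp]: "max_cand (xs @ [x]) = max (max_cand xs) (length (cand x))"
proof -
  have "insert 0 ((\<lambda>v. length (cand v)) ` set (xs @ [x])) =
      insert (length (cand x)) (insert 0 ((\<lambda>v. length (cand v)) ` set xs))" by auto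
  then show ?thesis unfolding max_cand_def by (simp add: max.commute)
qed

lemma distinct_adjl_es: "distinct (adjl es v)"
  using distinct_es by (rule distinct_adjl)

lemma length_cand_less: "v \<in> verts G \<Longrightarrow> length (cand v) < n"
  using length_adjl_less[of v m] length_filter_le[of _ "adjl es v"] unfolding cand_def
  by (metis (no_types, lifting) order_le_less_trans take_all_iff order_refl)

lemma ready_neighbour:
  "ready M \<Longrightarrow> v \<in> verts G \<Longrightarrow> j < length (adjl es v) \<Longrightarrow> M aNb (M aRow v + j) = adjl es v ! j"
  by (auto simp: ready_def rows_hold_def holds_def)

lemma wp_mark_neighbours:
  assumes r: "ready M" and v: "v \<in> verts G" "M rX 0 = v" "M rL 0 = length (adjl es v)" "M rD 0 = 0"
    and mk: "M aMk = (\<lambda>_. 0)" and c: "(n + 1) * 70 \<le> c"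
    and Q: "\<And>M' c'. same {rJ, rY, rD, aMk, aCt} M M' \<Longrightarrow> M' rD 0 = kept_degree v \<Longrightarrow>
      M' aMk = (\<lambda>x. if x \<in> set (adjl es v) then 1 else 0) \<Longrightarrow> \<forall>x\<in>set (adjl es v). M' aCt x = 0 \<Longrightarrow>
      c \<le> c' + (n + 1) * 70 \<Longrightarrow> Q M' c'"
  shows "wp mark_neighbours Q M c"
proof -
  have le: "(length (adjl es v) + 1) * (50 + 20) \<le> (n + 1) * 70"
    using length_adjl_less[OF v(1), of m] by simp
  show ?thesis
    unfolding mark_neighbours_def
    apply (rule wp_For[where I = "\<lambda>j M'. same {rJ, rY, rD, aMk, aCt} M M' \<and>
        M' rD 0 = length (filter (\<lambda>y. y \<in> verts H) (take j (adjl es v))) \<and>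
        M' aMk = (\<lambda>x. if x \<in> set (take j (adjl es v)) then 1 else 0) \<and>
        (\<forall>x\<in>set (take j (adjl es v)). M' aCt x = 0)" and N = "length (adjl es v)" and T = 50])
    subgoal using v mk by simp
    subgoal using v by simp
    subgoal using c le by linarith
    subgoal for j M' c'
      using ready_neighbour[OF r v(1), of j] v r
      by (auto simp: ready_def take_Suc_conv_app_nth fun_eq_iff)
    subgoal premises p for M' c'
      using p(1) p(3) le by (intro Q) (auto simp: kept_degree_def)
    done
qed

lemma wp_count_edges:
  assumes r: "ready M" and mk: "M aMk = (\<lambda>x. if x \<in> A then 1 else 0)" and ct: "\<forall>x\<in>A. M aCt x = 0"
    and c: "(mh + 1) * 100 \<le> c"
    and Q: "\<And>M' c'. same {rJ, rY, rZ, aCt} M M' \<Longrightarrow> \<forall>x\<in>A. M' aCt x = cover_count eh A x \<Longrightarrow>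
      c \<le> c' + (mh + 1) * 100 \<Longrightarrow> Q M' c'"
  shows "wp count_edges Q M c"
  unfolding count_edges_def
  apply (rule wp_For[where I = "\<lambda>j M'. same {rJ, rY, rZ, aCt} M M' \<and>
      (\<forall>x\<in>A. M' aCt x = cover_count (take j eh) A x)" and N = mh and T = 80])
  subgoal using ct by simp
  subgoal using r by (simp add: ready_def input_ok_def)
  subgoal using c by simp
  subgoal for j M' c'
    using r mk eh_nth(3)[of j] by (auto simp: ready_def input_ok_def take_Suc_conv_app_nth)
  subgoal premises p for M' c'
    using p(1) p(3) by (intro Q) auto
  done

lemma wp_select_candidates:
  assumes r: "ready M" and v: "v \<in> verts G" "M rX 0 = v" "M rL 0 = length (adjl es v)"
      "M rD 0 = kept_degree v" "M rA 0 = 0"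
    and mk: "M aMk = (\<lambda>x. if x \<in> set (adjl es v) then 1 else 0)"
    and ct: "\<forall>x\<in>set (adjl es v). M aCt x = cover_count eh (set (adjl es v)) x"
    and rows: "rows_hold (M aCand) (M aRow) l" "l v = []" "\<And>x. x \<in> verts G \<Longrightarrow> length (l x) < n"
    and c: "(n + 1) * 100 \<le> c"
    and Q: "\<And>M' c'. same {rJ, rY, rA, aMk, aCand} M M' \<Longrightarrow> M' rA 0 = length (cand v) \<Longrightarrow>
      M' aMk = (\<lambda>_. 0) \<Longrightarrow> rows_hold (M' aCand) (M' aRow) (l(v := cand v)) \<Longrightarrow>
      c \<le> c' + (n + 1) * 100 \<Longrightarrow> Q M' c'"
  shows "wp select_candidates Q M c"
proof -
  let ?P = "\<lambda>y. y \<notin> verts H \<or> cover_count eh (set (adjl es v)) y + 1 = kept_degree v"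
  let ?f = "\<lambda>j. filter ?P (take j (adjl es v))"
  have le: "(length (adjl es v) + 1) * (80 + 20) \<le> (n + 1) * 100"
    using length_adjl_less[OF v(1), of m] by simp
  have lenf: "length (?f j) < n" for j
    using length_adjl_less[OF v(1), of m] length_filter_le[of ?P "take j (adjl es v)"] by simp
  have lay: "layout (M aRow) (M aCol)" using r by (simp add: ready_def)
  show ?thesis
    unfolding select_candidates_def
    apply (rule wp_For[where I = "\<lambda>j M'. same {rJ, rY, rA, aMk, aCand} M M' \<and>
        M' rA 0 = length (?f j) \<and>
        M' aMk = (\<lambda>x. if x \<in> set (drop j (adjl es v)) then 1 else 0) \<and>
        rows_hold (M' aCand) (M' aRow) (l(v := ?f j))" and N = "length (adjl es v)" and T = 80])
    subgoal using v mk rows by (simp add: fun_upd_idem)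
    subgoal using v by simp
    subgoal using c le by linarith
    subgoal premises p for j M' c'
    proof -
      define y where "y = adjl es v ! j"
      have y: "M aNb (M aRow v + j) = y" "take (Suc j) (adjl es v) = take j (adjl es v) @ [y]"
        "y \<in> set (adjl es v)"
        using ready_neighbour[OF r v(1) p(1)] p(1) by (auto simp: y_def take_Suc_conv_app_nth)
      have dr: "drop j (adjl es v) = y # drop (Suc j) (adjl es v)"
        using p(1) by (simp add: y_def Cons_nth_drop_Suc)
      \<comment> \<open>A neighbour occurs only once in the list, so clearing its mark affects no
        later position.\<close>
      have "distinct (drop j (adjl es v))" using distinct_adjl_es by simp
      then have ny: "y \<notin> set (drop (Suc j) (adjl es v))" unfolding dr by simp
      have mk': "(\<lambda>x. if x \<in> set (drop j (adjl es v)) then 1 else 0)(y := 0) =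
          (\<lambda>x. if x \<in> set (drop (Suc j) (adjl es v)) then 1 else (0::nat))"
        using ny by (auto simp: dr fun_eq_iff)
      have rh: "rows_hold (M' aCand) (M aRow) (l(v := ?f j))" using p(2) by auto
      have "length ((l(v := ?f j)) x) < n" if "x \<in> verts G" for x
        using rows(3)[OF that] lenf by auto
      from rows_hold_snoc[OF rh lay v(1) this, of y]
      have rh': "rows_hold ((M' aCand)(M aRow v + length (?f j) := y)) (M aRow) (l(v := ?f j @ [y]))"
        by (simp only: fun_upd_upd fun_upd_same)
      have inn: "M aIn = (\<lambda>x. if x \<in> verts H then 1 else 0)" using r by (simp add: ready_def)
      show ?thesis using p(2-) y v(2-) ct mk' rh rh' inn by auto
    qed
    subgoal premises p for M' c'
      using p(1) p(3) le by (intro Q) (auto simp: cand_def)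
    done
qed

definition ready_cands :: "memory \<Rightarrow> bool" where
  "ready_cands M \<longleftrightarrow> ready M \<and>
     rows_hold (M aCand) (M aRow) (\<lambda>x. if x \<in> set removed then cand x else []) \<and>
     (\<forall>x\<in>set removed. M aLen x = length (cand x)) \<and> M rB 0 = max_cand removed"

lemma wp_list_candidates:
  assumes r: "ready M" and mk: "M aMk = (\<lambda>_. 0)" and b: "M rB 0 = 0"
    and c: "(k + 1) * ((n + mh + 1) * 300 + 120) \<le> c"
    and Q: "\<And>M' c'. same {rI, rJ, rX, rY, rZ, rL, rA, rD, rB, aMk, aCt, aCand, aLen} M M' \<Longrightarrow>
      ready_cands M' \<Longrightarrow> c \<le> c' + (k + 1) * ((n + mh + 1) * 300 + 120) \<Longrightarrow> Q M' c'"
  shows "wp list_candidates Q M c"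
proof -
  let ?X = "{rI, rJ, rX, rY, rZ, rL, rA, rD, rB, aMk, aCt, aCand, aLen}"
  let ?l = "\<lambda>j x. if x \<in> set (take j removed) then cand x else []"
  let ?T = "(n + mh + 1) * 300 + 100"
  show ?thesis
    unfolding list_candidates_def
    apply (rule wp_For[where I = "\<lambda>j M'. same ?X M M' \<and> M' aMk = (\<lambda>_. 0) \<and>
        rows_hold (M' aCand) (M' aRow) (?l j) \<and>
        (\<forall>x\<in>set (take j removed). M' aLen x = length (cand x)) \<and>
        M' rB 0 = max_cand (take j removed)" and N = k and T = ?T])
    subgoal using b mk by (simp add: rows_hold_def)
    subgoal using r by (simp add: ready_def)
    subgoal using c by simp
    subgoal premises p for j M' c'
    proof -
      define v where "v = removed ! j"
      have v: "v \<in> verts G" "v \<notin> verts H" using removed_nth[OF p(1)] by (auto simp: v_def)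
      have t: "take (Suc j) removed = take j removed @ [v]"
        using p(1) by (simp add: v_def take_Suc_conv_app_nth)
      have "distinct (take (Suc j) removed)" using distinct_removed by simp
      then have nv: "v \<notin> set (take j removed)" unfolding t by simp
      have l: "?l (Suc j) = (?l j)(v := cand v)" using nv by (auto simp: t fun_eq_iff)
      have rM': "ready M'" using p(2) by (intro ready_cong[OF r]) auto
      have vr: "M' aRem j = v" using rM' p(1) by (auto simp: ready_def holds_def v_def)
      have dg: "M' aDeg v = length (adjl es v)" using rM' v by (auto simp: ready_def)
      show ?thesis
        apply (simp add: p(3) vr dg)
        apply (intro conjI)
        subgoal using p(4) by simp
        subgoal using p(4) by simp
        subgoal using p(4) by simp
        apply (rule wp_mark_neighbours[where v = v])
        subgoal by (rule ready_cong[OF rM']) simp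
        subgoal by (rule v)
        subgoal by simp
        subgoal by simp
        subgoal by simp
        subgoal using p(2) by simp
        subgoal using p(4) by simp
        subgoal premises p1 for M1 c1
          apply simp
          apply (rule wp_count_edges[where A = "set (adjl es v)"])
          subgoal using p1(1) by (intro ready_cong[OF rM']) auto
          subgoal by (rule p1(3))
          subgoal by (rule p1(4))
          subgoal using p(4) p1(5) by simp
          subgoal premises p2 for M2 c2
            apply simp
            apply (intro conjI)
            subgoal using p(4) p1(5) p2(3) by simp
            apply (rule wp_select_candidates[where v = v and l = "?l j"])
            subgoal using p1(1) p2(1) by (intro ready_cong[OF rM']) auto
            subgoal by (rule v)
            subgoal using p1(1) p2(1) by simp
            subgoal using p1(1) p2(1) by simp
            subgoal using p1(2) p2(1) by simp
            subgoal by simp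
            subgoal using p1(3) p2(1) by simp
            subgoal using p2(2) by simp
            subgoal using p(2) p1(1) p2(1) by auto
            subgoal using nv by simp
            subgoal for x using length_cand_less[of x] v(1) length_adjl_less[of x 0] by (cases n) auto
            subgoal using p(4) p1(5) p2(3) by simp
            subgoal premises p3 for M3 c3
            proof -
              have "M3 rX 0 = v" "M3 rA 0 = length (cand v)" "M3 rB 0 = max_cand (take j removed)"
                "M3 aMk = (\<lambda>_. 0)" "M3 rI 0 = j" "M3 aLen = M' aLen"
                "rows_hold (M3 aCand) (M3 aRow) (?l (Suc j))"
                using p1(1) p2(1) p3(1-4) p(2,3) l by auto
              moreover have "same ?X M M3" using p(2) p1(1) p2(1) p3(1) by simp
              moreover have "c' \<le> c3 + 20 + (n + 1) * 170 + (mh + 1) * 100"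
                using p1(5) p2(3) p3(5) p(4) by simp
              moreover have "c3 \<ge> 50" using p1(5) p2(3) p3(5) p(4) by simp
              ultimately show ?thesis using p(2) unfolding l[symmetric] t by (auto simp: max_def)
            qed
            done
          done
        done
    qed
    subgoal premises p for M' c'
    proof (rule Q)
      show "ready_cands M'" using p(1) ready_cong[OF r, of M'] by (auto simp: ready_cands_def)
    qed (use p in auto)
    done
qed

section \<open>Correctness of the counting test and the bound on the largest candidate list\<close>

lemma cover_count_eq:
  assumes "x \<in> A"
  shows "cover_count eh A x = card (nbhd H x \<inter> A)"
proof -
  have H: "a \<noteq> b" if "(a, b) \<in> set eh" for a b
    using simple_graph_edgeD(1)[OF simple_H, of a b] that by (auto simp: edges_H)
  \<comment> \<open>As \<open>x\<close> lies in \<open>A\<close>, an edge at \<open>x\<close> is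
    counted exactly when its other end lies in \<open>A\<close>, that is, when it adds a member of
    \<open>A\<close> to the adjacency list. Restricting \<open>es'\<close> to edges of
    \<open>H\<close> keeps the ends distinct during the induction.\<close>
  have *: "length (filter (\<lambda>(a, b). a \<in> A \<and> b \<in> A \<and> (x = a \<or> x = b)) es') =
      length (filter (\<lambda>y. y \<in> A) (adjl es' x))" if "set es' \<subseteq> set eh" for es'
    using that
  proof (induction es' rule: rev_induct)
    case (snoc e es')
    obtain a b where e: "e = (a, b)" by force
    then have "a \<noteq> b" using H snoc.prems by auto
    then show ?case using snoc assms unfolding e adjl_append
      by (cases "a = x"; cases "b = x") (auto simp: adjl_single)
  qed simp
  have "cover_count eh A x = length (filter (\<lambda>y. y \<in> A) (adjl eh x))"
    unfolding cover_count_def by (rule *) simp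
  also have "\<dots> = card (set (filter (\<lambda>y. y \<in> A) (adjl eh x)))"
    using distinct_adjl[OF distinct_eh] by (subst distinct_card) simp_all
  also have "set (filter (\<lambda>y. y \<in> A) (adjl eh x)) = nbhd H x \<inter> A"
    by (intro set_eqI) (simp add: in_set_adjl nbhd_def edges_H)
  finally show ?thesis .
qed

lemma kept_degree_eq: "kept_degree v = card (nbhd G v \<inter> verts H)"
proof -
  have "kept_degree v = card (set (filter (\<lambda>y. y \<in> verts H) (adjl es v)))"
    unfolding kept_degree_def using distinct_adjl_es by (subst distinct_card) simp_all
  also have "set (filter (\<lambda>y. y \<in> verts H) (adjl es v)) = nbhd G v \<inter> verts H"
    by (auto simp: set_adjl_es)
  finally show ?thesis .
qed

text \<open>\<open>y\<close> together with its counted neighbours is always a subset of the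
  neighbours of \<open>v\<close> in \<open>H\<close>, so equal cardinality means equality of the
  sets.\<close>

lemma set_cand: "set (cand v) = candidates G H v"
proof -
  let ?N = "nbhd G v"
  have "cover_count eh ?N y + 1 = card (?N \<inter> verts H) \<longleftrightarrow> ?N \<inter> verts H \<subseteq> closed_nbhd H y"
    if y: "y \<in> ?N" "y \<in> verts H" for y
  proof -
    have fin: "finite (?N \<inter> verts H)" using finite_nbhd[OF simple_G] by simp
    have ny: "y \<notin> nbhd H y" using simple_graph_edgeD(1)[OF simple_H, of y y] by (auto simp: nbhd_def)
    have sub': "nbhd H y \<inter> ?N \<subseteq> ?N \<inter> verts H"
      using simple_graph_edgeD(3)[OF simple_H] by (auto simp: nbhd_def)
    have "card (insert y (nbhd H y \<inter> ?N)) = cover_count eh ?N y + 1"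
      using cover_count_eq[OF y(1)] ny finite_nbhd[OF simple_H] by simp
    moreover have "insert y (nbhd H y \<inter> ?N) \<subseteq> ?N \<inter> verts H" using y sub' by blast
    ultimately have "cover_count eh ?N y + 1 = card (?N \<inter> verts H) \<longleftrightarrow>
        insert y (nbhd H y \<inter> ?N) = ?N \<inter> verts H"
      using card_subset_eq[OF fin] by metis
    also have "\<dots> \<longleftrightarrow> ?N \<inter> verts H \<subseteq> closed_nbhd H y"
      using y sub' by (auto simp: closed_nbhd_def)
    finally show ?thesis .
  qed
  then show ?thesis
    unfolding cand_def candidates_def set_filter set_adjl_es kept_degree_eq by blast
qed

lemma length_cand: "length (cand v) = card (candidates G H v)"
proof -
  have "distinct (cand v)" using distinct_adjl_es by (simp add: cand_def)
  then show ?thesis by (metis distinct_card set_cand)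
qed

lemma max_cand_le_iff: "max_cand xs \<le> b \<longleftrightarrow> (\<forall>v\<in>set xs. length (cand v) \<le> b)"
  by (simp add: max_cand_def)

lemma max_cand_le:
  assumes "contraction_forest G H p"
  shows "max_cand removed \<le> degeneracy G + 2 * k"
proof -
  have "card (verts G - verts H) = k"
    using distinct_card[OF distinct_removed] by (simp add: set_removed)
  then show ?thesis
    using forest_card_candidates[OF simple_G sub assms]
    by (auto simp: max_cand_le_iff length_cand set_removed)
qed

end

section \<open>Peeling off vertices of small degree\<close>

definition start_queue :: com where
  "start_queue =
     For rI rN (rX ::= item rVB rI ;; Write aRd (Var rX) (Read aDeg (Var rX)) ;;
       Cond (Less (Read aDeg (Var rX)) (Var rD0)) (Write aQ (Var rQT) (Var rX) ;; incr rQT) Skip)"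

text \<open>The remaining degree is compared with the threshold just before it is decremented. It
  leaves the threshold downwards once only, so no vertex is queued twice and no separate mark is
  needed.\<close>

definition peel_neighbours :: com where
  "peel_neighbours =
     For rJ rL (rY ::= Read aNb (Plus (Read aRow (Var rX)) (Var rJ)) ;;
       Cond (Equal (Read aRd (Var rY)) (Var rD0)) (Write aQ (Var rQT) (Var rY) ;; incr rQT) Skip ;;
       Write aRd (Var rY) (Minus (Read aRd (Var rY)) (Const 1)))"

text \<open>If \<open>rB\<close> is at most twice \<open>rK\<close>, truncation gives the threshold
  0; nothing is queued then, and the desired bound on the number of candidates holds
  trivially.\<close>

definition peel :: com where
  "peel =
     rD0 ::= Minus (Var rB) (Plus (Var rK) (Var rK)) ;; rQT ::= Const 0 ;; start_queue ;;
     rQH ::= Const 0 ;;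
     While (Less (Var rQH) (Var rQT))
       (rX ::= Read aQ (Var rQH) ;; incr rQH ;; rL ::= Read aDeg (Var rX) ;; peel_neighbours)"

context contraction_instance
begin

text \<open>The empty set counts as a core; a nonempty one witnesses that the degeneracy is at least
  \<open>d\<close>.\<close>

definition core :: "nat \<Rightarrow> nat set \<Rightarrow> bool" where
  "core d A \<longleftrightarrow> A \<subseteq> verts G \<and> (\<forall>x\<in>A. d \<le> card (nbhd G x \<inter> A))"

definition queue_inv :: "nat \<Rightarrow> nat list \<Rightarrow> (nat \<Rightarrow> nat) \<Rightarrow> bool" where
  "queue_inv d q rd \<longleftrightarrow> distinct q \<and> set q \<subseteq> verts G \<and> (\<forall>y\<in>verts G. y \<in> set q \<longleftrightarrow> rd y < d) \<and>
     (\<forall>A. core d A \<longrightarrow> A \<inter> set q = {})"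

lemma nbhd_sym: "y \<in> nbhd G x \<longleftrightarrow> x \<in> nbhd G y"
  by (simp add: nbhd_def insert_commute)

lemma nbhd_verts: "y \<in> nbhd G x \<Longrightarrow> y \<in> verts G"
  using simple_graph_edgeD(3)[OF simple_G] by (auto simp: nbhd_def)

lemma length_adjl_es: "length (adjl es x) = card (nbhd G x)"
  using distinct_card[OF distinct_adjl_es] by (simp add: set_adjl_es)

text \<open>The handshake lemma, which makes the total work of peeling linear.\<close>

lemma sum_degrees: "(\<Sum>x\<in>verts G. length (adjl es x)) = 2 * m"
proof -
  have fin: "finite (verts G)" using simple_G by (simp add: simple_graph_def)
  have "(\<Sum>x\<in>verts G. length (adjl es' x)) = 2 * length es'" if "set es' \<subseteq> set es" for es'
    using that
  proof (induction es' rule: rev_induct)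
    case (snoc e es')
    obtain a b where e: "e = (a, b)" by force
    then have ab: "a \<noteq> b" "a \<in> verts G" "b \<in> verts G"
      using simple_graph_edgeD[OF simple_G, of a b] snoc.prems by (auto simp: edges_G)
    have "length (adjl (es' @ [e]) x) =
        length (adjl es' x) + ((if x = a then 1 else 0) + (if x = b then 1 else 0))" for x
      unfolding e adjl_append using ab by (auto simp: adjl_single)
    then show ?case using snoc ab fin by (simp add: sum.distrib)
  qed simp
  then show ?thesis by simp
qed

lemma wp_start_queue:
  assumes r: "ready M" and d: "M rD0 0 = d" and q: "M rQT 0 = 0" and c: "(n + 1) * 70 \<le> c"
    and Q: "\<And>M' c' q. same {rI, rX, rQT, aRd, aQ} M M' \<Longrightarrow> holds (M' aQ) q \<Longrightarrow>
      M' rQT 0 = length q \<Longrightarrow> queue_inv d q (M' aRd) \<Longrightarrow>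
      \<forall>y\<in>verts G. M' aRd y = card (nbhd G y) \<Longrightarrow> c \<le> c' + (n + 1) * 70 \<Longrightarrow> Q M' c'"
  shows "wp start_queue Q M c"
  unfolding start_queue_def
  apply (rule wp_For[where I = "\<lambda>j M'. same {rI, rX, rQT, aRd, aQ} M M' \<and>
      (\<exists>q. holds (M' aQ) q \<and> M' rQT 0 = length q \<and>
        q = filter (\<lambda>x. card (nbhd G x) < d) (take j vs)) \<and>
      (\<forall>y\<in>set (take j vs). M' aRd y = card (nbhd G y))" and N = n and T = 50])
  subgoal using q by simp
  subgoal using r by (simp add: ready_def input_ok_def)
  subgoal using c by simp
  subgoal premises p for j M' c'
  proof -
    have "vs ! j \<in> verts G" using p(1) set_vs nth_mem by blast
    then show ?thesis
      using p r d by (auto simp: ready_def input_ok_def take_Suc_conv_app_nth length_adjl_es)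
  qed
  subgoal premises p for M' c'
  proof -
    let ?q = "filter (\<lambda>x. card (nbhd G x) < d) vs"
    have rd: "\<forall>y\<in>verts G. M' aRd y = card (nbhd G y)" using p(1) set_vs by simp
    have "A \<inter> set ?q = {}" if A: "core d A" for A
    proof -
      have "d \<le> card (nbhd G x)" if "x \<in> A" for x
        using A that card_mono[OF finite_nbhd[OF simple_G], of "nbhd G x \<inter> A" x]
        by (fastforce simp: core_def)
      then show ?thesis by force
    qed
    then have "queue_inv d ?q (M' aRd)"
      using rd distinct_vs by (auto simp: queue_inv_def set_vs)
    then show ?thesis using p(1) p(3) rd by (intro Q) auto
  qed
  done

text \<open>\<open>P\<close> consists of the vertices processed before \<open>x\<close>. Every core
  avoids \<open>P\<close> and \<open>x\<close>, so a vertex with fewer than \<open>d\<close>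
  neighbours outside them lies in no core either and may be queued.\<close>

lemma wp_peel_neighbours:
  assumes r: "ready M" and x: "x \<in> verts G" "M rX 0 = x" "M rL 0 = length (adjl es x)"
    and d: "M rD0 0 = d"
    and qs: "holds (M aQ) qs" "M rQT 0 = length qs" "queue_inv d qs (M aRd)"
    and rd: "\<forall>y\<in>verts G. M aRd y = card (nbhd G y - P)"
    and P: "x \<in> set qs" "x \<notin> P" "P \<subseteq> set qs"
    and c: "(card (nbhd G x) + 1) * 70 \<le> c"
    and Q: "\<And>M' c' q. same {rJ, rY, rQT, aRd, aQ} M M' \<Longrightarrow> holds (M' aQ) (qs @ q) \<Longrightarrow>
      M' rQT 0 = length (qs @ q) \<Longrightarrow> queue_inv d (qs @ q) (M' aRd) \<Longrightarrow>
      \<forall>y\<in>verts G. M' aRd y = card (nbhd G y - insert x P) \<Longrightarrow>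
      c \<le> c' + (card (nbhd G x) + 1) * 70 \<Longrightarrow> Q M' c'"
  shows "wp peel_neighbours Q M c"
proof -
  let ?N = "adjl es x"
  let ?done = "\<lambda>j y. if y \<in> set (take j ?N) then 1 else (0::nat)"
  \<comment> \<open>The decrement is never truncated, because \<open>x\<close> is a neighbour of
    \<open>y\<close> outside \<open>P\<close>.\<close>
  have pos: "card (nbhd G y - insert x P) + 1 = card (nbhd G y - P)" if "y \<in> set ?N" for y
  proof -
    have "x \<in> nbhd G y - P" using that P(2) nbhd_sym by (auto simp: set_adjl_es)
    moreover have "nbhd G y - insert x P = (nbhd G y - P) - {x}" by blast
    ultimately show ?thesis
      using card_Suc_Diff1[of "nbhd G y - P" x] finite_nbhd[OF simple_G] by simp
  qed
  show ?thesis
    unfolding peel_neighbours_def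
    apply (rule wp_For[where I = "\<lambda>j M'. same {rJ, rY, rQT, aRd, aQ} M M' \<and>
        (\<exists>q. holds (M' aQ) (qs @ q) \<and> M' rQT 0 = length (qs @ q) \<and> queue_inv d (qs @ q) (M' aRd)) \<and>
        (\<forall>y\<in>verts G. M' aRd y = card (nbhd G y - P) - ?done j y)" and N = "length ?N" and T = 50])
    subgoal using qs rd by (auto intro!: exI[of _ "[]"])
    subgoal using x by simp
    subgoal using c by (simp add: length_adjl_es)
    subgoal premises p for j M' c'
    proof -
      define y where "y = ?N ! j"
      have yN: "y \<in> set ?N" and yV: "y \<in> verts G"
        using p(1) nbhd_verts[of y x] by (auto simp: y_def simp flip: set_adjl_es)
      have t: "take (Suc j) ?N = take j ?N @ [y]"
        using p(1) by (simp add: y_def take_Suc_conv_app_nth)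
      have "distinct (take (Suc j) ?N)" using distinct_adjl_es by simp
      then have ny: "y \<notin> set (take j ?N)" unfolding t by simp
      from p(2) obtain q where q: "holds (M' aQ) (qs @ q)" "M' rQT 0 = length (qs @ q)"
        "queue_inv d (qs @ q) (M' aRd)" by blast
      have rdy: "M' aRd y = card (nbhd G y - insert x P) + 1" using p(2) yV ny pos[OF yN] by auto
      have nb: "M aNb (M aRow x + j) = y" using ready_neighbour[OF r x(1) p(1)] by (simp add: y_def)
      have avoid: "y \<notin> A" if A: "core d A" and "card (nbhd G y - insert x P) < d" for A
      proof
        assume "y \<in> A"
        then have "d \<le> card (nbhd G y \<inter> A)" using A by (auto simp: core_def)
        also have "A \<inter> set (qs @ q) = {}" using A q(3) unfolding queue_inv_def by blast
        then have "A \<inter> insert x P = {}" using P by auto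
        then have "card (nbhd G y \<inter> A) \<le> card (nbhd G y - insert x P)"
          using finite_nbhd[OF simple_G] by (intro card_mono) auto
        finally show False using that(2) by simp
      qed
      have rd': "\<forall>z\<in>verts G. ((M' aRd)(y := M' aRd y - 1)) z = card (nbhd G z - P) - ?done (Suc j) z"
        using p(2) rdy pos[OF yN] ny by (auto simp: t)
      show ?thesis
      proof (cases "M' aRd y = d")
        case True
        have yq: "y \<notin> set (qs @ q)" using q(3) yV True by (auto simp: queue_inv_def)
        have "queue_inv d ((qs @ q) @ [y]) ((M' aRd)(y := M' aRd y - 1))"
          using q(3) yq yV True rdy avoid by (auto simp: queue_inv_def)
        moreover have "holds ((M' aQ)(length (qs @ q) := y)) ((qs @ q) @ [y])"
          using q(1) by (simp only: holds_snoc)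
        ultimately show ?thesis
          using p(2-) nb x d True rd' q(2) by (auto intro!: exI[of _ "q @ [y]"])
      next
        case False
        have "queue_inv d (qs @ q) ((M' aRd)(y := M' aRd y - 1))"
          using q(3) False yV by (auto simp: queue_inv_def)
        then show ?thesis
          using p(2-) nb x d False rd' q by (auto intro!: exI[of _ q])
      qed
    qed
    subgoal premises p for M' c'
    proof -
      from p(1) obtain q where q: "holds (M' aQ) (qs @ q)" "M' rQT 0 = length (qs @ q)"
        "queue_inv d (qs @ q) (M' aRd)" by blast
      have "card (nbhd G y - P) - ?done (length ?N) y = card (nbhd G y - insert x P)" for y
      proof (cases "y \<in> set ?N")
        case True
        then show ?thesis using pos[OF True] by simp
      next
        case False
        then have "x \<notin> nbhd G y" using nbhd_sym by (auto simp: set_adjl_es)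
        then have "nbhd G y - insert x P = nbhd G y - P" by blast
        then show ?thesis using False by simp
      qed
      then show ?thesis using p(1) p(3) q by (intro Q[of M' q]) (auto simp: length_adjl_es)
    qed
    done
qed

lemma core_iff_degeneracy:
  assumes "verts G \<noteq> {}"
  shows "(\<exists>A. core d A \<and> A \<noteq> {}) \<longleftrightarrow> d \<le> degeneracy G"
  using le_degeneracyI[OF simple_G, of _ d] degeneracy_core[OF simple_G assms, of d]
  unfolding core_def by metis

text \<open>The vertices never queued form a core and every core avoids the queue, so they form the
  largest core; for a nonempty graph it is empty iff the degeneracy is below the threshold. For the
  time, each vertex enters the queue at most once and is charged its degree plus 1.\<close>

lemma wp_peel:
  assumes r: "ready_cands M" and c: "(n + m) * 300 + 200 \<le> c"
    and Q: "\<And>M' c'. same {rI, rJ, rX, rY, rL, rQH, rQT, rD0, aRd, aQ} M M' \<Longrightarrow>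
      (0 < M' rD0 0 \<and> M' rQT 0 = n \<longleftrightarrow> degeneracy G + 2 * k < max_cand removed) \<Longrightarrow>
      c \<le> c' + (n + m) * 300 + 200 \<Longrightarrow> Q M' c'"
  shows "wp peel Q M c"
proof -
  let ?X = "{rI, rJ, rX, rY, rL, rQH, rQT, rD0, aRd, aQ}"
  define d where "d = max_cand removed - 2 * k"
  have rr: "ready M" and B: "M rB 0 = max_cand removed" and K: "M rK 0 = k"
    using r by (auto simp: ready_cands_def ready_def)
  have fin: "finite (verts G)" using simple_G by (simp add: simple_graph_def)
  define w where "w x = card (nbhd G x) + 1" for x
  have W: "sum w (verts G) = n + 2 * m"
    using sum_degrees fin by (simp add: w_def sum.distrib length_adjl_es card_verts_G)
  let ?inv = "\<lambda>M1 c1. same ?X M M1 \<and> M1 rD0 0 = d \<and>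
    (\<exists>q h. holds (M1 aQ) q \<and> M1 rQT 0 = length q \<and> h = M1 rQH 0 \<and> h \<le> length q \<and>
      queue_inv d q (M1 aRd) \<and> (\<forall>y\<in>verts G. M1 aRd y = card (nbhd G y - set (take h q))) \<and>
      c \<le> c1 + (n + 1) * 70 + 100 + 100 * sum w (set (take h q)))"
  show ?thesis
    unfolding peel_def
    apply (simp add: B K)
    apply (intro conjI)
    subgoal using c by simp
    subgoal using c by simp
    apply (rule wp_start_queue[where d = d])
    subgoal by (rule ready_cong[OF rr]) simp
    subgoal by (simp add: d_def mult_2)
    subgoal by simp
    subgoal using c by simp
    subgoal premises p for M1 c1 q1
      apply simp
      apply (intro conjI)
      subgoal using c p(6) by simp
      apply (rule wp_While[where I = ?inv])
      subgoal using p c by (auto simp: d_def mult_2 intro!: exI[of _ q1])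
      subgoal premises p2 for M2 c2
      proof -
        from p2(1) obtain q h where q: "holds (M2 aQ) q" "M2 rQT 0 = length q" "M2 rQH 0 = h"
          "queue_inv d q (M2 aRd)" "\<forall>y\<in>verts G. M2 aRd y = card (nbhd G y - set (take h q))"
          "c \<le> c2 + (n + 1) * 70 + 100 + 100 * sum w (set (take h q))" by blast
        have h: "h < length q" using p2(2) q by simp
        define x where "x = q ! h"
        have t: "take (Suc h) q = take h q @ [x]" using h by (simp add: x_def take_Suc_conv_app_nth)
        have "distinct (take (Suc h) q)" using q(4) by (simp add: queue_inv_def)
        then have nx: "x \<notin> set (take h q)" unfolding t by simp
        have xq: "x \<in> set q" using h by (simp add: x_def)
        then have xV: "x \<in> verts G" using q(4) by (auto simp: queue_inv_def)
        have "sum w (set (take (Suc h) q)) \<le> sum w (verts G)"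
          using q(4) fin by (intro sum_mono2) (auto simp: queue_inv_def dest: in_set_takeD)
        then have le: "w x + sum w (set (take h q)) \<le> n + 2 * m" using nx W by (simp add: t)
        then have cw: "100 * w x + 20 \<le> c2" using q(6) c by simp
        have w1: "1 \<le> w x" by (simp add: w_def)
        have rM2: "ready M2" using p2(1) by (intro ready_cong[OF rr]) auto
        have dg: "M2 aDeg x = length (adjl es x)" using rM2 xV by (auto simp: ready_def)
        have qx: "M2 aQ h = x" using q(1) h by (simp add: holds_def x_def)
        show ?thesis
          apply (simp add: q qx dg)
          apply (intro conjI)
          subgoal using cw by simp
          subgoal using cw w1 by simp
          subgoal using cw w1 by simp
          subgoal using cw w1 by simp
          apply (rule wp_peel_neighbours[where x = x and qs = q and P = "set (take h q)" and d = d])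
          subgoal by (rule ready_cong[OF rM2]) simp
          subgoal by (rule xV)
          subgoal by simp
          subgoal by simp
          subgoal using p2(1) by simp
          subgoal using q by simp
          subgoal using q by simp
          subgoal using q by simp
          subgoal using q by simp
          subgoal by (rule xq)
          subgoal by (rule nx)
          subgoal by (auto dest: in_set_takeD)
          subgoal using cw w1 by (simp add: w_def)
          subgoal premises p3 for M3 c3 q'
          proof -
            have "M3 rQH 0 = Suc h" using p3(1) q(3) by simp
            moreover have "take (Suc h) (q @ q') = take h q @ [x]" using h t by simp
            moreover have "c \<le> c3 + (n + 1) * 70 + 100 + 100 * sum w (set (take h q @ [x]))"
              using q(6) p3(6) nx cw by (simp add: w_def)
            moreover have "same ?X M M3" "M3 rD0 0 = d" using p2(1) p3(1) by auto
            ultimately show ?thesis using p3(2-5) h by (auto intro!: exI[of _ "q @ q'"])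
          qed
          done
      qed
      subgoal premises p2 for M2 c2
      proof -
        from p2 obtain q where q: "M2 rQT 0 = length q" "queue_inv d q (M2 aRd)"
          "\<forall>y\<in>verts G. M2 aRd y = card (nbhd G y - set q)"
          "c \<le> c2 + (n + 1) * 70 + 100 + 100 * sum w (set q)" by auto
        have "sum w (set q) \<le> sum w (verts G)"
          using q(2) fin by (intro sum_mono2) (auto simp: queue_inv_def)
        then have c2: "c \<le> c2 + (n + 1) * 70 + 100 + 100 * (n + 2 * m)" using q(4) W by simp
        have "length q = card (set q)" using q(2) by (simp add: queue_inv_def distinct_card)
        then have full: "length q = n \<longleftrightarrow> set q = verts G"
          using q(2) card_subset_eq[OF fin, of "set q"] card_verts_G unfolding queue_inv_def by metis
        have core: "core d (verts G - set q)"
          unfolding core_def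
        proof (intro conjI ballI)
          fix y assume y: "y \<in> verts G - set q"
          have "nbhd G y \<inter> (verts G - set q) = nbhd G y - set q" using nbhd_verts by blast
          then show "d \<le> card (nbhd G y \<inter> (verts G - set q))"
            using y q(2,3) by (auto simp: queue_inv_def)
        qed blast
        have "0 < d \<and> length q = n \<longleftrightarrow> degeneracy G < d"
        proof (cases "verts G = {}")
          \<comment> \<open>In the empty graph the queue trivially contains all vertices; the
            threshold is 0 then, and the conjunct \<open>0 < d\<close> prevents a rejection.\<close>
          case True
          then have "d = 0" using set_removed by (simp add: d_def)
          then show ?thesis by simp
        next
          case False
          have "set q = verts G \<longleftrightarrow> \<not> (\<exists>A. core d A \<and> A \<noteq> {})"
          proof
            assume "set q = verts G"
            moreover have "A \<inter> set q = {}" if "core d A" for A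
              using q(2) that unfolding queue_inv_def by blast
            ultimately have "A = {}" if "core d A" for A
              using that unfolding core_def by blast
            then show "\<not> (\<exists>A. core d A \<and> A \<noteq> {})" by blast
          next
            assume "\<not> (\<exists>A. core d A \<and> A \<noteq> {})"
            then have "verts G - set q = {}" using core by blast
            then show "set q = verts G" using q(2) by (auto simp: queue_inv_def)
          qed
          then show ?thesis using core_iff_degeneracy[OF False, of d] full by auto
        qed
        moreover have "degeneracy G < d \<longleftrightarrow> degeneracy G + 2 * k < max_cand removed"
          by (auto simp: d_def)
        ultimately show ?thesis using p2 q(1) c c2 by (intro conjI Q) auto
      qed
      done
    done
qed

end

section \<open>Testing a choice of parents\<close>

definition reset_walks :: com where
  "reset_walks = For rI rN (Write aW (item rVB rI) (Const 0))"

text \<open>Each vertex of \<open>H\<close> counts as a finished walk that ends in itself. Numbers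
  start at 1 because 0 means unvisited; the removed vertices continue them from
  \<open>nh + 1\<close>.\<close>

definition anchor_kept :: com where
  "anchor_kept =
     For rI rHN (rX ::= item rHV rI ;; Write aW (Var rX) (Plus (Var rI) (Const 1)) ;;
       Write aRes (Plus (Var rI) (Const 1)) (Var rX))"

text \<open>A digit that is too large for its candidate list makes the vertex its own parent, which then
  fails the test for cycles.\<close>

definition choose_parents :: com where
  "choose_parents =
     For rI rK (rX ::= Read aRem (Var rI) ;;
       Cond (Less (Read aDg (Var rI)) (Read aLen (Var rX)))
         (Write aPar (Var rX) (Read aCand (Plus (Read aRow (Var rX)) (Read aDg (Var rI)))))
         (Write aPar (Var rX) (Var rX)))"

text \<open>\<open>aW\<close> holds the number of the walk that first visited a vertex (0 if unvisited), \<open>aRes\<close> maps the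
  number of a walk to the vertex of \<open>H\<close> where it ended.  A walk that meets its own number has run into
  a cycle.  As no vertex is visited twice, all walks together take linear time.\<close>

definition walk :: com where
  "walk = While (Equal (Read aW (Var rX)) (Const 0))
     (Write aW (Var rX) (Var rD) ;; rX ::= Read aPar (Var rX))"

definition walk_all :: com where
  "walk_all =
     rOk ::= Const 1 ;;
     For rI rK (rX ::= Read aRem (Var rI) ;; rD ::= Plus (Plus (Var rHN) (Var rI)) (Const 1) ;; walk ;;
       Cond (Equal (Read aW (Var rX)) (Var rD)) (rOk ::= Const 0)
         (Write aRes (Var rD) (Read aRes (Read aW (Var rX)))))"

abbreviation cell_at :: "nat \<Rightarrow> nat \<Rightarrow> aexp" where
  "cell_at x y \<equiv> Plus (Read aRow (Var x)) (Read aCol (Var y))"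

text \<open>Entries of \<open>aMat\<close>: 0 for no edge of \<open>H\<close>, 1 for an edge of \<open>H\<close>, 2 for an edge of \<open>H\<close> that is the
  image of an edge of \<open>G\<close>.\<close>

definition reset_matrix :: com where
  "reset_matrix =
     For rI rHM (rX ::= edge1 rHE rI ;; rY ::= edge2 rHE rI ;;
       Write aMat (cell_at rX rY) (Const 1) ;; Write aMat (cell_at rY rX) (Const 1))"

definition map_edges :: com where
  "map_edges =
     For rI rM (rX ::= Read aRes (Read aW (edge1 rEB rI)) ;; rY ::= Read aRes (Read aW (edge2 rEB rI)) ;;
       Cond (Equal (Var rX) (Var rY)) Skip
         (Cond (Equal (Read aMat (cell_at rX rY)) (Const 0)) (rOk ::= Const 0)
           (Write aMat (cell_at rX rY) (Const 2) ;; Write aMat (cell_at rY rX) (Const 2))))"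

definition check_hits :: com where
  "check_hits =
     For rI rHM (rX ::= edge1 rHE rI ;; rY ::= edge2 rHE rI ;;
       Cond (Equal (Read aMat (cell_at rX rY)) (Const 1)) (rOk ::= Const 0) Skip)"

definition test_parents :: com where
  "test_parents =
     reset_walks ;; anchor_kept ;; choose_parents ;; walk_all ;;
     Cond (Equal (Var rOk) (Const 1))
       (reset_matrix ;; map_edges ;; check_hits ;;
        Cond (Equal (Var rOk) (Const 1)) (1 ::= Const 1) Skip) Skip"

context contraction_instance
begin

text \<open>Apart from the output, the arrays up to 19 hold the input and the results of the
  preprocessing; all later phases write beyond them.\<close>

lemma ready_cands_cong:
  "ready_cands M \<Longrightarrow> \<forall>a. a = 0 \<or> 2 \<le> a \<and> a \<le> 19 \<longrightarrow> M' a = M a \<Longrightarrow> ready_cands M'"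
  by (simp add: ready_cands_def ready_def input_ok_def)

definition parent :: "(nat \<Rightarrow> nat) \<Rightarrow> nat \<Rightarrow> nat" where
  "parent d i = (if d i < length (cand (removed ! i)) then cand (removed ! i) ! d i else removed ! i)"

text \<open>Adjacency of parents is left out: a selected parent is a candidate, hence a neighbour,
  or else the vertex itself, which then has no root.\<close>

definition good :: "(nat \<Rightarrow> nat) \<Rightarrow> bool" where
  "good p \<longleftrightarrow> (\<forall>v\<in>verts G. \<exists>s. rooted p (verts H) v s) \<and> edges H = quotient_edges G p (verts H)"

lemma cand_subset: "u \<in> set (cand v) \<Longrightarrow> u \<in> nbhd G v"
  by (auto simp: set_cand candidates_def)

lemma parent_in: "i < k \<Longrightarrow> parent d i \<in> verts G"
  using removed_nth(1)[of i] nbhd_verts[OF cand_subset[OF nth_mem]] by (simp add: parent_def)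

section \<open>Walks along parents and detection of cycles\<close>

definition anchored :: "(nat \<Rightarrow> nat) \<Rightarrow> (nat \<Rightarrow> nat) \<Rightarrow> bool" where
  "anchored w res \<longleftrightarrow> (\<forall>x\<in>verts G. w x \<noteq> 0 \<longleftrightarrow> x \<in> verts H) \<and>
     (\<forall>x\<in>verts H. w x \<le> nh \<and> res (w x) = x)"

lemma wp_anchor:
  assumes r: "ready_cands M" and c: "(n + 1) * 200 \<le> c"
    and Q: "\<And>M' c'. same {rI, rX, aW, aRes} M M' \<Longrightarrow> anchored (M' aW) (M' aRes) \<Longrightarrow>
      c \<le> c' + (n + 1) * 200 \<Longrightarrow> Q M' c'"
  shows "wp (reset_walks ;; anchor_kept) Q M c"
proof -
  have inp: "input_ok M" using r by (simp add: ready_cands_def ready_def)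
  show ?thesis
    unfolding reset_walks_def
    apply simp
    apply (rule wp_For[where I = "\<lambda>j M'. same {rI, aW} M M' \<and>
        (\<forall>x\<in>set (take j vs). M' aW x = 0)" and N = n and T = 30])
    subgoal by simp
    subgoal using inp by (simp add: input_ok_def)
    subgoal using c by simp
    subgoal for j M' c' using inp by (auto simp: input_ok_def take_Suc_conv_app_nth)
    subgoal premises p for M1 c1
      unfolding anchor_kept_def
      apply (rule wp_For[where I = "\<lambda>j M'. same {rI, rX, aW, aRes} M M' \<and>
          (\<forall>x\<in>verts G. x \<notin> set (take j vh) \<longrightarrow> M' aW x = 0) \<and>
          (\<forall>i<j. M' aW (vh ! i) = i + 1 \<and> M' aRes (i + 1) = vh ! i)" and N = nh and T = 40])
      subgoal using p(1) by (simp add: set_vs)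
      subgoal using inp by (simp add: input_ok_def)
      subgoal using c p(3) nh_le by simp
      subgoal for j M' c'
        using inp distinct_vh
        by (auto simp: input_ok_def take_Suc_conv_app_nth nth_eq_iff_index_eq less_Suc_eq)
      subgoal premises p2 for M2 c2
      proof (rule Q)
        have *: "M2 aW x \<noteq> 0 \<and> M2 aW x \<le> nh \<and> M2 aRes (M2 aW x) = x" if x: "x \<in> verts H" for x
        proof -
          obtain i where "i < nh" "x = vh ! i" using x set_vh by (metis in_set_conv_nth)
          then show ?thesis using p2(1) by auto
        qed
        moreover have "M2 aW x = 0" if "x \<in> verts G" "x \<notin> verts H" for x
          using p2(1) that by (simp add: set_vh)
        ultimately show "anchored (M2 aW) (M2 aRes)" unfolding anchored_def using sub by metis
      qed (use p p2 nh_le in auto)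
      done
    done
qed

lemma wp_choose_parents:
  assumes r: "ready_cands M" and c: "(n + 1) * 100 \<le> c"
    and Q: "\<And>M' c'. same {rI, rX, aPar} M M' \<Longrightarrow>
      \<forall>i<k. M' aPar (removed ! i) = parent (M aDg) i \<Longrightarrow> c \<le> c' + (n + 1) * 100 \<Longrightarrow> Q M' c'"
  shows "wp choose_parents Q M c"
proof -
  have kn: "k \<le> n" using k_eq by simp
  show ?thesis
    unfolding choose_parents_def
    apply (rule wp_For[where I = "\<lambda>j M'. same {rI, rX, aPar} M M' \<and>
        (\<forall>i<j. M' aPar (removed ! i) = parent (M aDg) i)" and N = k and T = 80])
    subgoal by simp
    subgoal using r by (simp add: ready_cands_def ready_def)
    subgoal using c kn by simp
    subgoal premises p for j M' c'
    proof -
      define v where "v = removed ! j"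
      have v: "v \<in> verts G" "v \<in> set removed" using removed_nth[OF p(1)] p(1) by (auto simp: v_def)
      have *: "M aRem j = v" "M aLen v = length (cand v)"
        "\<And>t. t < length (cand v) \<Longrightarrow> M aCand (M aRow v + t) = cand v ! t"
        using r v p(1) by (auto simp: ready_cands_def ready_def holds_def rows_hold_def v_def)
      have "parent (M aDg) j = (if M aDg j < length (cand v) then cand v ! M aDg j else v)"
        by (simp add: parent_def v_def)
      moreover have "removed ! i \<noteq> v" if "i < j" for i
        using that p(1) distinct_removed by (simp add: v_def nth_eq_iff_index_eq)
      ultimately show ?thesis using p(2-) * by (auto simp: less_Suc_eq v_def[symmetric])
    qed
    subgoal premises p for M' c'
      using p(1) p(3) kn by (intro Q) auto
    done
qed

text \<open>After a cycle has been found the walks go on, but their results may be meaningless; what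
  is kept is the existence of a vertex without a root.\<close>

definition walk_inv :: "(nat \<Rightarrow> nat) \<Rightarrow> nat \<Rightarrow> (nat \<Rightarrow> nat) \<Rightarrow> (nat \<Rightarrow> nat) \<Rightarrow> nat \<Rightarrow> bool" where
  "walk_inv p i w res ok \<longleftrightarrow>
     (\<forall>x\<in>verts G. w x \<le> nh + i) \<and> (\<forall>x\<in>verts H. w x \<noteq> 0) \<and> (\<forall>v\<in>set (take i removed). w v \<noteq> 0) \<and>
     (ok = 1 \<and> (\<forall>x\<in>verts G. w x \<noteq> 0 \<longrightarrow> rooted p (verts H) x (res (w x))) \<or>
      ok = 0 \<and> (\<exists>x\<in>verts G. \<forall>s. \<not> rooted p (verts H) x s))"

text \<open>The potential that pays for the steps of all walks together.\<close>

definition visited :: "(nat \<Rightarrow> nat) \<Rightarrow> nat" where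
  "visited w = card {x \<in> verts G. w x \<noteq> 0}"

lemma visited_le: "visited w \<le> n"
  unfolding visited_def card_verts_G[symmetric]
  using simple_G by (intro card_mono) (auto simp: simple_graph_def)

lemma visited_upd:
  assumes "x \<in> verts G" "w x = 0" "d \<noteq> 0"
  shows "visited (w(x := d)) = visited w + 1"
proof -
  have "{y \<in> verts G. (w(x := d)) y \<noteq> 0} = insert x {y \<in> verts G. w y \<noteq> 0}"
    using assms by auto
  moreover have "finite {y \<in> verts G. w y \<noteq> 0}" using simple_G by (simp add: simple_graph_def)
  ultimately show ?thesis using assms by (simp add: visited_def)
qed

text \<open>\<open>w0\<close> holds the marks before the walk from \<open>v\<close>,
  \<open>w\<close> those at present, and \<open>x\<close> is the current vertex. The vertices marked
  \<open>d\<close> form the path walked so far: parents lead along it to \<open>x\<close>, so they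
  inherit any root of \<open>x\<close>.\<close>

definition trail :: "(nat \<Rightarrow> nat) \<Rightarrow> nat \<Rightarrow> nat \<Rightarrow> (nat \<Rightarrow> nat) \<Rightarrow> (nat \<Rightarrow> nat) \<Rightarrow> nat \<Rightarrow> bool" where
  "trail p v d w0 w x \<longleftrightarrow> x \<in> verts G \<and> (w v = d \<or> x = v) \<and>
     (\<forall>y\<in>verts G. if w y = d then w0 y = 0 \<and> y \<notin> verts H \<and> (p y = x \<or> w (p y) = d) \<and> p y \<in> verts G \<and>
        (\<forall>s. rooted p (verts H) x s \<longrightarrow> rooted p (verts H) y s) else w y = w0 y)"

text \<open>Each step marks an unvisited vertex and costs less than 30, which the growth of
  \<open>visited\<close> pays for. As \<open>visited\<close> cannot exceed \<open>n\<close>, the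
  walk also terminates when it runs into a cycle.\<close>

lemma wp_walk:
  assumes p: "\<And>y. y \<in> verts G - verts H \<Longrightarrow> p y \<in> verts G" "M aPar = p"
    and v: "v \<in> verts G" "M rX 0 = v"
    and d: "M rD 0 = d" "d \<noteq> 0" and w0: "\<And>x. x \<in> verts G \<Longrightarrow> M aW x \<noteq> d"
      "\<And>x. x \<in> verts H \<Longrightarrow> M aW x \<noteq> 0"
    and c: "n * 30 + 30 \<le> c + visited (M aW) * 30"
    and Q: "\<And>M' c'. same {rX, aW} M M' \<Longrightarrow> trail p v d (M aW) (M' aW) (M' rX 0) \<Longrightarrow>
      M' aW (M' rX 0) \<noteq> 0 \<Longrightarrow> c + visited (M aW) * 30 \<le> c' + visited (M' aW) * 30 + 10 \<Longrightarrow> Q M' c'"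
  shows "wp walk Q M c"
proof -
  let ?I = "\<lambda>M' c'. same {rX, aW} M M' \<and> trail p v d (M aW) (M' aW) (M' rX 0) \<and>
    c + visited (M aW) * 30 \<le> c' + visited (M' aW) * 30"
  show ?thesis
    unfolding walk_def
  proof (rule wp_While[where I = ?I])
    show "?I M c" using v w0 by (auto simp: trail_def)
  next
    fix M' c' assume I: "?I M' c'" and b: "bval (Equal (Read aW (Var rX)) (Const 0)) M'"
    define x w where "x = M' rX 0" and "w = M' aW"
    have x: "x \<in> verts G" "w x = 0" using I b by (auto simp: trail_def x_def w_def)
    then have xS: "x \<notin> verts H" and px: "p x \<in> verts G"
      using I w0 p(1) d by (force simp: trail_def w_def)+
    have vis: "visited (w(x := d)) = visited w + 1" using visited_upd x d by blast
    then have "visited w + 1 \<le> n" using visited_le[of "w(x := d)"] by simp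
    then have c': "30 \<le> c' - 30 + 30" "30 \<le> c'" using I c by (auto simp: w_def)
    have w0x: "M aW x = 0" using I x d by (auto simp: trail_def x_def w_def split: if_splits)
    have "trail p v d (M aW) (w(x := d)) (p x)"
      unfolding trail_def
    proof (intro conjI ballI)
      show "p x \<in> verts G" by (rule px)
      show "(w(x := d)) v = d \<or> p x = v" using I by (auto simp: trail_def x_def w_def)
      fix y assume y: "y \<in> verts G"
      have t: "if w y = d then M aW y = 0 \<and> y \<notin> verts H \<and> (p y = x \<or> w (p y) = d) \<and> p y \<in> verts G \<and>
        (\<forall>s. rooted p (verts H) x s \<longrightarrow> rooted p (verts H) y s) else w y = M aW y"
        using I y by (simp add: trail_def x_def w_def)
      have rx: "rooted p (verts H) (p x) s \<Longrightarrow> rooted p (verts H) x s" for s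
        using xS by (simp add: rooted_step_iff[of x])
      show "if (w(x := d)) y = d then M aW y = 0 \<and> y \<notin> verts H \<and>
          (p y = p x \<or> (w(x := d)) (p y) = d) \<and> p y \<in> verts G \<and>
          (\<forall>s. rooted p (verts H) (p x) s \<longrightarrow> rooted p (verts H) y s)
        else (w(x := d)) y = M aW y"
        using t rx w0x xS px by (cases "y = x"; cases "w y = d") auto
    qed
    then show "1 + bcost (Equal (Read aW (Var rX)) (Const 0)) \<le> c' \<and>
        wp (Write aW (Var rX) (Var rD) ;; rX ::= Read aPar (Var rX)) ?I M'
          (c' - (1 + bcost (Equal (Read aW (Var rX)) (Const 0))))"
      using I c' d p(2) vis by (simp add: x_def[symmetric] w_def[symmetric])
  next
    fix M' c' assume I: "?I M' c'" and b: "\<not> bval (Equal (Read aW (Var rX)) (Const 0)) M'"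
    have "30 \<le> c'" using I c visited_le[of "M' aW"] by simp
    moreover have "Q M' (c' - 6)" using I b \<open>30 \<le> c'\<close> by (intro Q) auto
    ultimately show "1 + bcost (Equal (Read aW (Var rX)) (Const 0)) \<le> c' \<and>
        Q M' (c' - (1 + bcost (Equal (Read aW (Var rX)) (Const 0))))" by simp
  qed
qed

lemma trail_step:
  assumes inv: "walk_inv p i w0 res ok" and t: "trail p v d w0 w x" and x: "w x \<noteq> 0"
    and d: "d = nh + i + 1" and v: "v = removed ! i" "i < k"
  shows "\<forall>y\<in>verts G. w y \<le> nh + Suc i" "\<forall>y\<in>verts H. w y \<noteq> 0"
    "\<forall>y\<in>set (take (Suc i) removed). w y \<noteq> 0"
proof -
  have old: "w y = d \<or> w y = w0 y" if "y \<in> verts G" for y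
    using t that by (auto simp: trail_def split: if_splits)
  have pos: "w y \<noteq> 0" if "y \<in> verts G" "w0 y \<noteq> 0" for y
    using old[OF that(1)] that(2) d by auto
  show "\<forall>y\<in>verts G. w y \<le> nh + Suc i"
  proof
    fix y assume "y \<in> verts G"
    then have "w y = d \<or> w y \<le> nh + i" using old[of y] inv by (auto simp: walk_inv_def)
    then show "w y \<le> nh + Suc i" using d by auto
  qed
  show "\<forall>y\<in>verts H. w y \<noteq> 0" using inv pos sub by (auto simp: walk_inv_def)
  have "set (take (Suc i) removed) = insert v (set (take i removed))"
    using v by (simp add: take_Suc_conv_app_nth)
  moreover have "w v \<noteq> 0" using t x d by (auto simp: trail_def)
  moreover have "w y \<noteq> 0" if "y \<in> set (take i removed)" for y
    using pos[of y] that inv set_removed by (auto simp: walk_inv_def dest: in_set_takeD)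
  ultimately show "\<forall>y\<in>set (take (Suc i) removed). w y \<noteq> 0" by auto
qed

text \<open>When the walk meets its own number, the vertices carrying that number lie outside
  \<open>H\<close> and are closed under parents, so none of them has a root.\<close>

lemma walk_inv_cycle:
  assumes inv: "walk_inv p i w0 res ok" and t: "trail p v d w0 w x" and x: "w x = d"
    and d: "d = nh + i + 1" and v: "v = removed ! i" "i < k"
  shows "walk_inv p (Suc i) w res 0"
proof -
  have "\<not> rooted p (verts H) x s" for s
  proof
    assume "rooted p (verts H) x s"
    then have "x \<notin> {y \<in> verts G. w y = d}"
      by (rule not_rooted_closed) (use t x in \<open>auto simp: trail_def split: if_splits\<close>)
    then show False using t x by (simp add: trail_def)
  qed
  moreover have "x \<in> verts G" using t by (simp add: trail_def)
  moreover have "w x \<noteq> 0" using x d by simp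
  ultimately show ?thesis
    using trail_step[OF inv t _ d v] unfolding walk_inv_def by blast
qed

text \<open>The walk has stopped at a vertex numbered earlier, possibly in \<open>H\<close>; the
  whole trail shares the root of that vertex.\<close>

lemma walk_inv_join:
  assumes inv: "walk_inv p i w0 res ok" and t: "trail p v d w0 w x" and x: "w x \<noteq> d" "w x \<noteq> 0"
    and d: "d = nh + i + 1" and v: "v = removed ! i" "i < k"
  shows "walk_inv p (Suc i) w (res(d := res (w x))) ok"
proof -
  have "rooted p (verts H) y ((res(d := res (w x))) (w y))"
    if *: "\<forall>x\<in>verts G. w0 x \<noteq> 0 \<longrightarrow> rooted p (verts H) x (res (w0 x))"
      and y: "y \<in> verts G" "w y \<noteq> 0" for y
  proof (cases "w y = d")
    case True
    have "x \<in> verts G" "w x = w0 x" using t x by (auto simp: trail_def split: if_splits)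
    then have "rooted p (verts H) x (res (w x))" using * x by auto
    then have "rooted p (verts H) y (res (w x))" using t True y(1) by (simp add: trail_def)
    then show ?thesis using True by simp
  next
    case False
    then have "w y = w0 y" using t y(1) by (auto simp: trail_def split: if_splits)
    then show ?thesis using * y False by simp
  qed
  then show ?thesis
    using trail_step[OF inv t x(2) d v] inv unfolding walk_inv_def by blast
qed

lemma walk_inv_init:
  assumes "anchored w res"
  shows "walk_inv p 0 w res 1"
proof -
  have "w x \<le> nh" if "x \<in> verts G" for x
    using assms that unfolding anchored_def by (metis zero_le)
  moreover have "rooted p (verts H) x (res (w x))" if "x \<in> verts G" "w x \<noteq> 0" for x
    using assms that by (auto simp: anchored_def rooted_base_iff)
  ultimately show ?thesis using assms sub by (auto simp: walk_inv_def anchored_def)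
qed

lemma wp_walk_all:
  assumes r: "ready_cands M" and p: "\<And>y. y \<in> verts G - verts H \<Longrightarrow> p y \<in> verts G" "M aPar = p"
    and a: "anchored (M aW) (M aRes)" and c: "(n + 1) * 200 \<le> c"
    and Q: "\<And>M' c'. same {rI, rX, rD, rOk, aW, aRes} M M' \<Longrightarrow>
      walk_inv p k (M' aW) (M' aRes) (M' rOk 0) \<Longrightarrow> c \<le> c' + (n + 1) * 200 \<Longrightarrow> Q M' c'"
  shows "wp walk_all Q M c"
proof -
  have kn: "k \<le> n" using k_eq by simp
  let ?I = "\<lambda>j M' c'. same {rI, rX, rD, rOk, aW, aRes} M M' \<and>
    walk_inv p j (M' aW) (M' aRes) (M' rOk 0) \<and> c \<le> c' + j * 100 + visited (M' aW) * 30 + 20"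
  show ?thesis
    unfolding walk_all_def
    apply simp
    apply (intro conjI)
    subgoal using c by simp
    apply (rule wp_For_credit[where I = ?I and N = k])
    subgoal using c by simp
    subgoal using walk_inv_init[OF a, of p] c by auto
    subgoal using r by (simp add: ready_cands_def ready_def)
    subgoal premises q for j M1 c1
    proof -
      define v where "v = removed ! j"
      have v: "v \<in> verts G" using removed_nth[OF q(1)] by (simp add: v_def)
      have rd: "M aRem j = v" "M rHN 0 = nh" using r q(1)
        by (auto simp: ready_cands_def ready_def holds_def v_def input_ok_def)
      have inv: "walk_inv p j (M1 aW) (M1 aRes) (M1 rOk 0)" using q(2) by blast
      have "j * 100 + 100 \<le> n * 100" using q(1) kn by simp
      then have c1: "n * 30 + 130 \<le> c1 + visited (M1 aW) * 30"
        using q(2) c visited_le[of "M1 aW"] by simp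
      have c1': "130 \<le> c1" using c1 visited_le[of "M1 aW"] by simp
      show ?thesis
        apply (simp add: q rd)
        apply (intro conjI)
        subgoal using c1' by simp
        subgoal using c1' by simp
        subgoal using c1' by simp
        apply (rule wp_walk[where p = p and v = v and d = "nh + j + 1"])
        subgoal by (rule p)
        subgoal using q(2) p by simp
        subgoal by (rule v)
        subgoal by simp
        subgoal using q rd by simp
        subgoal by simp
        subgoal for x using inv by (auto simp: walk_inv_def)
        subgoal for x using inv by (auto simp: walk_inv_def)
        subgoal using c1 by simp
        subgoal premises w for M2 c2
        proof -
          have t: "trail p v (nh + j + 1) (M1 aW) (M2 aW) (M2 rX 0)" using w(2) by simp
          have c2: "c1 + visited (M1 aW) * 30 \<le> c2 + visited (M2 aW) * 30 + 50"
            using w(4) c1' by simp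
          have "n * 30 + 80 \<le> c2 + visited (M2 aW) * 30" using c2 c1 by simp
          then have c2': "80 \<le> c2" using visited_le[of "M2 aW"] by simp
          have cs: "c \<le> c2 + j * 100 + visited (M2 aW) * 30 + 70" using q(2) c2 by simp
          have M2: "M2 rD 0 = nh + j + 1" "M2 aRes = M1 aRes" "M2 rOk = M1 rOk" "M2 rI 0 = j"
            using w(1) q rd by simp_all
          show ?thesis
          proof (cases "M2 aW (M2 rX 0) = nh + j + 1")
            case True
            have "walk_inv p (Suc j) (M2 aW) (M1 aRes) 0"
              using walk_inv_cycle[OF inv t True refl v_def q(1)] .
            then show ?thesis using True M2 c2' cs q(2) w(1) by auto
          next
            case False
            have "walk_inv p (Suc j) (M2 aW) ((M1 aRes)(nh + j + 1 := M1 aRes (M2 aW (M2 rX 0)))) (M1 rOk 0)"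
              using walk_inv_join[OF inv t False w(3) refl v_def q(1)] .
            then show ?thesis using False M2 c2' cs q(2) w(1) by auto
          qed
        qed
        done
    qed
    subgoal premises q for M1 c1
    proof -
      have "k * 100 \<le> n * 100" using kn by simp
      then have "c \<le> c1 + n * 130 + 20" using q(1) visited_le[of "M1 aW"] by simp
      then show ?thesis using q(1) c by (auto intro!: Q)
    qed
    done
qed

end

section \<open>Comparing the edges of the quotient with those of \<open>H\<close>\<close>

definition image_edges :: "('a \<Rightarrow> 'a) \<Rightarrow> ('a \<times> 'a) list \<Rightarrow> 'a set set" where
  "image_edges g es = {{g a, g b} | a b. (a, b) \<in> set es \<and> g a \<noteq> g b}"

lemma image_edges_Nil [simp]: "image_edges g [] = {}"
  by (simp add: image_edges_def)

lemma image_edges_snoc [simp]: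
  "image_edges g (es @ [e]) =
     image_edges g es \<union> (if g (fst e) \<noteq> g (snd e) then {{g (fst e), g (snd e)}} else {})"
  by (cases e) (auto simp: image_edges_def)

context contraction_instance
begin

text \<open>Indexing by the set of both ends builds in the symmetry of the matrix; diagonal cells
  belong to singletons, which are no edges.\<close>

definition mat_is :: "memory \<Rightarrow> (nat set \<Rightarrow> nat) \<Rightarrow> bool" where
  "mat_is M F \<longleftrightarrow> (\<forall>x\<in>verts H. \<forall>y\<in>verts H. M aMat (M aRow x + M aCol y) = F {x, y})"

text \<open>What each test leaves to the next one: cells of edges may hold anything, all others hold
  0. Resetting the edges of \<open>H\<close> then restores the whole matrix in time linear in their
  number.\<close>

definition clean :: "memory \<Rightarrow> bool" where
  "clean M \<longleftrightarrow> (\<exists>F. mat_is M F \<and> (\<forall>e. e \<notin> edges H \<longrightarrow> F e = 0))"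

lemma mat_is_upd:
  assumes "mat_is M F" "layout (M aRow) (M aCol)" "x \<in> verts H" "y \<in> verts H"
    and M': "M' aRow = M aRow" "M' aCol = M aCol"
      "M' aMat = (M aMat)(M aRow x + M aCol y := v, M aRow y + M aCol x := v)"
  shows "mat_is M' (F({x, y} := v))"
proof -
  have inj: "M aRow a + M aCol b = M aRow a' + M aCol b' \<longleftrightarrow> a = a' \<and> b = b'"
    if "a \<in> verts H" "b \<in> verts H" "a' \<in> verts H" "b' \<in> verts H" for a b a' b'
  proof
    assume "M aRow a + M aCol b = M aRow a' + M aCol b'"
    moreover have V: "a \<in> verts G" "b \<in> verts G" "a' \<in> verts G" "b' \<in> verts G"
      using sub that by auto
    ultimately have "a = a'" "M aCol b = M aCol b'"
      using assms(2) unfolding layout_def by metis+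
    moreover have "inj_on (M aCol) (verts G)" using assms(2) by (simp add: layout_def)
    ultimately show "a = a' \<and> b = b'" using V inj_onD by metis
  qed auto
  show ?thesis
    unfolding mat_is_def M'
  proof (intro ballI)
    fix a b assume ab: "a \<in> verts H" "b \<in> verts H"
    have "M aMat (M aRow a + M aCol b) = F {a, b}" using assms(1) ab by (simp add: mat_is_def)
    moreover have "M aRow a + M aCol b = M aRow x + M aCol y \<or>
        M aRow a + M aCol b = M aRow y + M aCol x \<longleftrightarrow> {a, b} = {x, y}"
      using inj[OF ab assms(3,4)] inj[OF ab assms(4,3)] by (simp only: doubleton_eq_iff)
    ultimately show "((M aMat)(M aRow x + M aCol y := v, M aRow y + M aCol x := v))
        (M aRow a + M aCol b) = (F({x, y} := v)) {a, b}"
      by (metis fun_upd_apply)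
  qed
qed

lemma edges_H_list: "e \<in> edges H \<longleftrightarrow> (\<exists>(a, b)\<in>set eh. e = {a, b})"
proof -
  have "edges H = (\<lambda>(u, v). {u, v}) ` set eh" using lists_H by (simp add: lists_graph_def)
  then show ?thesis by (auto simp: image_iff)
qed

lemma wp_reset_matrix:
  assumes r: "ready_cands M" and cl: "clean M" and c: "(mh + 1) * 120 \<le> c"
    and Q: "\<And>M' c'. same {rI, rX, rY, aMat} M M' \<Longrightarrow>
      mat_is M' (\<lambda>e. if e \<in> edges H then 1 else 0) \<Longrightarrow> c \<le> c' + (mh + 1) * 120 \<Longrightarrow> Q M' c'"
  shows "wp reset_matrix Q M c"
proof -
  let ?I = "\<lambda>j M'. same {rI, rX, rY, aMat} M M' \<and>
    (\<exists>F. mat_is M' F \<and> (\<forall>e. e \<notin> edges H \<longrightarrow> F e = 0) \<and> (\<forall>(a, b)\<in>set (take j eh). F {a, b} = 1))"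
  have inp: "input_ok M" and lay: "layout (M aRow) (M aCol)"
    using r by (auto simp: ready_cands_def ready_def)
  show ?thesis
    unfolding reset_matrix_def
    apply (rule wp_For[where I = ?I and N = mh and T = 100])
    subgoal using cl by (simp add: clean_def mat_is_def)
    subgoal using inp by (simp add: input_ok_def)
    subgoal using c by simp
    subgoal premises p for j M' c'
    proof -
      define a b where "a = fst (eh ! j)" and "b = snd (eh ! j)"
      have ab: "a \<in> verts H" "b \<in> verts H" "{a, b} \<in> edges H"
        using eh_nth[OF p(1)] nth_mem[OF p(1)] by (auto simp: a_def b_def edges_H)
      have t: "take (Suc j) eh = take j eh @ [(a, b)]"
        using p(1) by (simp add: a_def b_def take_Suc_conv_app_nth)
      from p(2) obtain F where F: "mat_is M' F" "\<forall>e. e \<notin> edges H \<longrightarrow> F e = 0"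
        "\<forall>(a, b)\<in>set (take j eh). F {a, b} = 1" by blast
      have rc: "M' aRow = M aRow" "M' aCol = M aCol" using p(2) by auto
      have rd: "M' 0 (M' rHE 0 + j + j) = a" "M' 0 (M' rHE 0 + j + j + 1) = b"
        using inp p(1,2) by (auto simp: input_ok_def a_def b_def)
      let ?M = "\<lambda>M''. M'' aRow = M' aRow \<and> M'' aCol = M' aCol \<and>
        M'' aMat = (M' aMat)(M' aRow a + M' aCol b := 1, M' aRow b + M' aCol a := 1)"
      have upd: "mat_is M'' (F({a, b} := 1))" if "?M M''" for M''
        using mat_is_upd[OF F(1) _ ab(1,2), of M'' 1] lay rc that by simp
      have F': "\<forall>e. e \<notin> edges H \<longrightarrow> (F({a, b} := 1)) e = 0"
        "\<forall>(x, y)\<in>set (take (Suc j) eh). (F({a, b} := 1)) {x, y} = 1"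
        using ab(3) F(2,3) by (auto simp: t)
      show ?thesis
        apply (simp add: p(3) rd del: fun_upd_apply)
        apply (intro conjI exI[of _ "F({a, b} := 1)"])
        subgoal using p(4) by simp
        subgoal using p(4) by simp
        subgoal using p(4) by simp
        subgoal using p(4) by simp
        subgoal using p(2) by auto
        subgoal by (rule upd) simp
        subgoal by (rule F'(1))
        subgoal by (rule F'(2))
        subgoal by simp
        done
    qed
    subgoal premises p for M' c'
    proof -
      from p(1) obtain F where F: "mat_is M' F" "\<forall>e. e \<notin> edges H \<longrightarrow> F e = 0"
        "\<forall>(a, b)\<in>set eh. F {a, b} = 1" by auto
      have "F = (\<lambda>e. if e \<in> edges H then 1 else 0)"
        using F(2,3) by (fastforce simp: fun_eq_iff edges_H_list)
      then show ?thesis using p(1,3) F(1) by (intro Q) auto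
    qed
    done
qed

definition hit_value :: "nat set set \<Rightarrow> nat set \<Rightarrow> nat" where
  "hit_value E e = (if e \<in> edges H then (if e \<in> E then 2 else 1) else 0)"

text \<open>An image that is no edge of \<open>H\<close> leaves the matrix unchanged and is recorded
  in \<open>rOk\<close> alone; as the set of images only grows, the flag never has to be raised
  again.\<close>

lemma wp_map_edges:
  assumes r: "ready_cands M" and g: "\<And>x. x \<in> verts G \<Longrightarrow> M aRes (M aW x) = g x"
      "\<And>x. x \<in> verts G \<Longrightarrow> g x \<in> verts H"
    and ok: "M rOk 0 = 1" and mat: "mat_is M (hit_value {})" and c: "(m + 1) * 150 \<le> c"
    and Q: "\<And>M' c'. same {rI, rX, rY, rOk, aMat} M M' \<Longrightarrow> mat_is M' (hit_value (image_edges g es)) \<Longrightarrow>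
      M' rOk 0 = (if image_edges g es \<subseteq> edges H then 1 else 0) \<Longrightarrow> c \<le> c' + (m + 1) * 150 \<Longrightarrow> Q M' c'"
  shows "wp map_edges Q M c"
proof -
  let ?I = "\<lambda>j M'. same {rI, rX, rY, rOk, aMat} M M' \<and> mat_is M' (hit_value (image_edges g (take j es))) \<and>
    M' rOk 0 = (if image_edges g (take j es) \<subseteq> edges H then 1 else 0)"
  have inp: "input_ok M" and lay: "layout (M aRow) (M aCol)"
    using r by (auto simp: ready_cands_def ready_def)
  show ?thesis
    unfolding map_edges_def
    apply (rule wp_For[where I = ?I and N = m and T = 130])
    subgoal using ok mat by (simp add: mat_is_def)
    subgoal using inp by (simp add: input_ok_def)
    subgoal using c by simp
    subgoal premises p for j M' c'
    proof -
      define a b x y E where "a = fst (es ! j)" and "b = snd (es ! j)" and "x = g a" and "y = g b"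
        and "E = image_edges g (take j es)"
      have ab: "a \<in> verts G" "b \<in> verts G" using es_nth[OF p(1)] by (auto simp: a_def b_def)
      then have xy: "x \<in> verts H" "y \<in> verts H" using g(2) by (auto simp: x_def y_def)
      have t: "image_edges g (take (Suc j) es) = E \<union> (if x \<noteq> y then {{x, y}} else {})"
        using p(1) by (simp add: E_def x_def y_def a_def b_def take_Suc_conv_app_nth)
      have rc: "M' aRow = M aRow" "M' aCol = M aCol" using p(2) by auto
      have rd: "M' 0 (M' rEB 0 + j + j) = a" "M' 0 (M' rEB 0 + j + j + 1) = b"
        using inp p(1,2) by (auto simp: input_ok_def a_def b_def)
      have gx: "M' aRes (M' aW a) = x" "M' aRes (M' aW b) = y"
        using p(2) g(1) ab by (auto simp: x_def y_def)
      have mt: "mat_is M' (hit_value E)" using p(2) by (simp add: E_def)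
      have val: "M' aMat (M aRow x + M aCol y) = hit_value E {x, y}"
        using mt xy rc by (simp add: mat_is_def)
      have sm: "same {rI, rX, rY, rOk, aMat} M M'" using p(2) by (elim conjE)
      have okE: "M' rOk 0 = (if E \<subseteq> edges H then 1 else 0)" using p(2) by (simp add: E_def)
      show ?thesis
      proof (cases "x = y")
        case True
        then show ?thesis using p(2-) rd gx okE mt rc by (auto simp: t mat_is_def)
      next
        case ne: False
        show ?thesis
        proof (cases "{x, y} \<in> edges H")
          case True
          have hv: "(hit_value E)({x, y} := 2) = hit_value (insert {x, y} E)"
            using True by (auto simp: hit_value_def fun_eq_iff)
          have upd: "mat_is M'' (hit_value (insert {x, y} E))"
            if "M'' aRow = M aRow \<and> M'' aCol = M aCol \<and>
              M'' aMat = (M' aMat)(M aRow x + M aCol y := 2, M aRow y + M aCol x := 2)" for M''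
            using mat_is_upd[OF mt _ xy, of M'' 2] lay rc that hv by simp
          have "M' aMat (M aRow x + M aCol y) \<noteq> 0" using val True by (simp add: hit_value_def)
          then show ?thesis
            apply (simp add: p(3) rd gx rc ne t fun_upd_same del: fun_upd_apply)
            using sm p(4) okE True by (auto intro!: upd split: if_splits)
        next
          case False
          then have "hit_value (insert {x, y} E) = hit_value E" by (auto simp: hit_value_def fun_eq_iff)
          moreover have "M' aMat (M aRow x + M aCol y) = 0" using val False by (simp add: hit_value_def)
          ultimately show ?thesis using p(2-) rd gx okE rc ne False mt
            by (auto simp: t mat_is_def)
        qed
      qed
    qed
    subgoal premises p for M' c'
      using p(1) p(3) by (intro Q) auto
    done
qed

text \<open>The flag on entry expresses one inclusion between images and edges of \<open>H\<close>;
  this pass adds the other.\<close>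

lemma wp_check_hits:
  assumes r: "ready_cands M" and ok: "M rOk 0 = (if E \<subseteq> edges H then 1 else 0)"
    and mat: "mat_is M (hit_value E)" and c: "(mh + 1) * 100 \<le> c"
    and Q: "\<And>M' c'. same {rI, rX, rY, rOk} M M' \<Longrightarrow>
      M' rOk 0 = (if E = edges H then 1 else 0) \<Longrightarrow> c \<le> c' + (mh + 1) * 100 \<Longrightarrow> Q M' c'"
  shows "wp check_hits Q M c"
proof -
  let ?I = "\<lambda>j M'. same {rI, rX, rY, rOk} M M' \<and>
    M' rOk 0 = (if E \<subseteq> edges H \<and> (\<forall>(a, b)\<in>set (take j eh). {a, b} \<in> E) then 1 else 0)"
  have inp: "input_ok M" using r by (auto simp: ready_cands_def ready_def)
  show ?thesis
    unfolding check_hits_def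
    apply (rule wp_For[where I = ?I and N = mh and T = 80])
    subgoal using ok by simp
    subgoal using inp by (simp add: input_ok_def)
    subgoal using c by simp
    subgoal premises p for j M' c'
    proof -
      define a b where "a = fst (eh ! j)" and "b = snd (eh ! j)"
      have ab: "a \<in> verts H" "b \<in> verts H" "{a, b} \<in> edges H"
        using eh_nth[OF p(1)] nth_mem[OF p(1)] by (auto simp: a_def b_def edges_H)
      have t: "take (Suc j) eh = take j eh @ [(a, b)]"
        using p(1) by (simp add: a_def b_def take_Suc_conv_app_nth)
      have rd: "M' 0 (M' rHE 0 + j + j) = a" "M' 0 (M' rHE 0 + j + j + 1) = b"
        using inp p(1,2) by (auto simp: input_ok_def a_def b_def)
      have val: "M aMat (M aRow a + M aCol b) = (if {a, b} \<in> E then 2 else 1)"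
        using mat ab by (simp add: mat_is_def hit_value_def)
      show ?thesis using p(2-) rd val by (auto simp: t)
    qed
    subgoal premises p for M' c'
    proof -
      have "E \<subseteq> edges H \<and> (\<forall>(a, b)\<in>set eh. {a, b} \<in> E) \<longleftrightarrow> E = edges H"
      proof -
        have "(\<forall>(a, b)\<in>set eh. {a, b} \<in> E) \<longleftrightarrow> edges H \<subseteq> E"
          unfolding subset_iff edges_H_list by blast
        then show ?thesis by blast
      qed
      then show ?thesis using p(1) p(3) by (intro Q) auto
    qed
    done
qed

text \<open>Paths stop as soon as they reach \<open>H\<close>, so parents are consulted at removed
  vertices only.\<close>

lemma good_cong:
  assumes "\<And>y. y \<in> verts G - verts H \<Longrightarrow> p y = q y \<and> q y \<in> verts G"
  shows "good p \<longleftrightarrow> good q"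
proof -
  have r: "rooted p (verts H) x s \<longleftrightarrow> rooted q (verts H) x s" if "x \<in> verts G" for x s
    using rooted_cong[of p "verts H" x s "verts G" q] rooted_cong[of q "verts H" x s "verts G" p]
      assms that by metis
  have "(\<exists>a b. {a, b} \<in> edges G \<and> rooted p (verts H) a s \<and> rooted p (verts H) b t) \<longleftrightarrow>
      (\<exists>a b. {a, b} \<in> edges G \<and> rooted q (verts H) a s \<and> rooted q (verts H) b t)" for s t
    using simple_graph_edgeD(2,3)[OF simple_G] r by (intro ex_cong1 conj_cong refl) auto
  then have "quotient_edges G p (verts H) = quotient_edges G q (verts H)"
    unfolding quotient_edges_def by simp
  moreover have "(\<exists>s. rooted p (verts H) v s) \<longleftrightarrow> (\<exists>s. rooted q (verts H) v s)" if "v \<in> verts G" for v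
    using r[OF that] by (simp only:)
  ultimately show ?thesis unfolding good_def by (simp cong: ball_cong del: ex_simps)
qed

lemma quotient_edges_eq_image:
  assumes g: "\<And>x. x \<in> verts G \<Longrightarrow> rooted p (verts H) x (g x)"
  shows "quotient_edges G p (verts H) = image_edges g es"
proof (intro set_eqI iffI)
  fix e assume "e \<in> quotient_edges G p (verts H)"
  then obtain s t a b where *: "e = {s, t}" "s \<noteq> t" "{a, b} \<in> edges G" "rooted p (verts H) a s"
    "rooted p (verts H) b t" unfolding quotient_edges_def by blast
  have "a \<in> verts G" "b \<in> verts G" using simple_graph_edgeD[OF simple_G *(3)] by auto
  then have "s = g a" "t = g b"
    using rooted_unique[OF *(4) g] rooted_unique[OF *(5) g] by blast+
  moreover have "(a, b) \<in> set es \<or> (b, a) \<in> set es" using *(3) by (simp add: edges_G)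
  moreover have "e = {g b, g a}" using *(1) calculation(1,2) by (simp add: insert_commute)
  ultimately show "e \<in> image_edges g es"
    using *(1,2) unfolding image_edges_def mem_Collect_eq by metis
next
  fix e assume "e \<in> image_edges g es"
  then obtain a b where *: "e = {g a, g b}" "(a, b) \<in> set es" "g a \<noteq> g b"
    unfolding image_edges_def by blast
  then have e: "{a, b} \<in> edges G" by (simp add: edges_G)
  then have "a \<in> verts G" "b \<in> verts G" using simple_graph_edgeD[OF simple_G e] by auto
  then show "e \<in> quotient_edges G p (verts H)"
    unfolding quotient_edges_def using * e g by blast
qed

lemma wp_test_parents:
  assumes r: "ready_cands M" and cl: "clean M" and mh: "mh \<le> m" and c: "(n + m + 1) * 1000 \<le> c"
    and p: "\<forall>i<k. p (removed ! i) = parent (M aDg) i"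
    and Q: "\<And>M' c'. same {1, rI, rX, rY, rD, rOk, aW, aRes, aPar, aMat} M M' \<Longrightarrow> clean M' \<Longrightarrow>
      M' 1 0 = (if good p then 1 else M 1 0) \<Longrightarrow> c \<le> c' + (n + m + 1) * 1000 \<Longrightarrow> Q M' c'"
  shows "wp test_parents Q M c"
proof -
  let ?S = "verts H"
  have "wp (reset_walks ;; anchor_kept) (wp (choose_parents ;; walk_all ;;
      Cond (Equal (Var rOk) (Const 1)) (reset_matrix ;; map_edges ;; check_hits ;;
        Cond (Equal (Var rOk) (Const 1)) (1 ::= Const 1) Skip) Skip) Q) M c"
  proof (rule wp_anchor[OF r])
    show "(n + 1) * 200 \<le> c" using c by simp
  next
    fix M1 c1 assume 1: "same {rI, rX, aW, aRes} M M1" "anchored (M1 aW) (M1 aRes)"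
      "c \<le> c1 + (n + 1) * 200"
    have r1: "ready_cands M1" using 1(1) by (intro ready_cands_cong[OF r]) auto
    show "wp (choose_parents ;; walk_all ;;
      Cond (Equal (Var rOk) (Const 1)) (reset_matrix ;; map_edges ;; check_hits ;;
        Cond (Equal (Var rOk) (Const 1)) (1 ::= Const 1) Skip) Skip) Q M1 c1"
      unfolding wp_Seq
    proof (rule wp_choose_parents[OF r1])
      show "(n + 1) * 100 \<le> c1" using 1(3) c by simp
    next
      fix M2 c2 assume 2: "same {rI, rX, aPar} M1 M2"
        "\<forall>i<k. M2 aPar (removed ! i) = parent (M1 aDg) i" "c1 \<le> c2 + (n + 1) * 100"
      have r2: "ready_cands M2" using 2(1) by (intro ready_cands_cong[OF r1]) auto
      define q where "q = M2 aPar"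
      have q: "q y = p y \<and> p y \<in> verts G" if y: "y \<in> verts G - ?S" for y
      proof -
        obtain i where "i < k" "y = removed ! i" using y set_removed by (metis in_set_conv_nth)
        then show ?thesis using 1(1) 2(2) p parent_in by (simp add: q_def)
      qed
      have goodq: "good q \<longleftrightarrow> good p" using q by (rule good_cong)
      show "wp walk_all (wp (Cond (Equal (Var rOk) (Const 1)) (reset_matrix ;; map_edges ;;
          check_hits ;; Cond (Equal (Var rOk) (Const 1)) (1 ::= Const 1) Skip) Skip) Q) M2 c2"
      proof (rule wp_walk_all[OF r2])
        show "q y \<in> verts G" if "y \<in> verts G - ?S" for y using q that by simp
        show "M2 aPar = q" by (simp add: q_def)
        show "anchored (M2 aW) (M2 aRes)" using 1 2 by simp
        show "(n + 1) * 200 \<le> c2" using 1(3) 2(3) c by simp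
      next
        fix M3 c3 assume 3: "same {rI, rX, rD, rOk, aW, aRes} M2 M3"
          "walk_inv q k (M3 aW) (M3 aRes) (M3 rOk 0)" "c2 \<le> c3 + (n + 1) * 200"
        have r3: "ready_cands M3" using 3(1) by (intro ready_cands_cong[OF r2]) auto
        have cl3: "clean M3" using cl 1(1) 2(1) 3(1) by (simp add: clean_def mat_is_def)
        have c3: "c \<le> c3 + (n + 1) * 500" using 1(3) 2(3) 3(3) by simp
        show "wp (Cond (Equal (Var rOk) (Const 1)) (reset_matrix ;; map_edges ;; check_hits ;;
            Cond (Equal (Var rOk) (Const 1)) (1 ::= Const 1) Skip) Skip) Q M3 c3"
        proof (cases "M3 rOk 0 = 1")
          case False
          then have "\<not> good q" using 3(2) by (auto simp: walk_inv_def good_def)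
          then show ?thesis using False c c3 cl3 1(1) 2(1) 3(1) goodq by (auto intro!: Q)
        next
          case True
          define g where "g x = M3 aRes (M3 aW x)" for x
          have gr: "rooted q ?S x (g x)" if x: "x \<in> verts G" for x
          proof -
            \<comment> \<open>After \<open>k\<close> walks every removed vertex carries a number;
              the vertices of \<open>H\<close> carried one from the start.\<close>
            have "M3 aW x \<noteq> 0"
              using 3(2) x by (cases "x \<in> ?S") (auto simp: walk_inv_def set_removed)
            then show ?thesis using 3(2) True x by (auto simp: walk_inv_def g_def)
          qed
          have good: "good p \<longleftrightarrow> image_edges g es = edges H"
            using gr quotient_edges_eq_image[of q g] goodq by (auto simp: good_def)
          have c3': "(n + m + 1) * 500 \<le> c3" using c c3 by simp
          have "wp reset_matrix (wp (map_edges ;; check_hits ;;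
              Cond (Equal (Var rOk) (Const 1)) (1 ::= Const 1) Skip) Q) M3 (c3 - 5)"
          proof (rule wp_reset_matrix[OF r3 cl3])
            show "(mh + 1) * 120 \<le> c3 - 5" using c3' mh by simp
          next
            fix M4 c4 assume 4: "same {rI, rX, rY, aMat} M3 M4"
              "mat_is M4 (\<lambda>e. if e \<in> edges H then 1 else 0)" "c3 - 5 \<le> c4 + (mh + 1) * 120"
            have r4: "ready_cands M4" using 4(1) by (intro ready_cands_cong[OF r3]) auto
            have c4: "(n + m + 1) * 350 \<le> c4" using 4(3) c3' mh by simp
            show "wp (map_edges ;; check_hits ;;
              Cond (Equal (Var rOk) (Const 1)) (1 ::= Const 1) Skip) Q M4 c4"
              unfolding wp_Seq
            proof (rule wp_map_edges[OF r4])
              show "M4 aRes (M4 aW x) = g x" for x using 4(1) by (simp add: g_def)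
              show "g x \<in> ?S" if "x \<in> verts G" for x using gr[OF that] by (rule rooted_in)
              show "M4 rOk 0 = 1" using 4(1) True by simp
              have "hit_value {} = (\<lambda>e. if e \<in> edges H then 1 else 0)"
                by (simp add: hit_value_def fun_eq_iff)
              then show "mat_is M4 (hit_value {})" using 4(2) by simp
              show "(m + 1) * 150 \<le> c4" using c4 by simp
            next
              fix M5 c5 assume 5: "same {rI, rX, rY, rOk, aMat} M4 M5"
                "mat_is M5 (hit_value (image_edges g es))"
                "M5 rOk 0 = (if image_edges g es \<subseteq> edges H then 1 else 0)"
                "c4 \<le> c5 + (m + 1) * 150"
              have r5: "ready_cands M5" using 5(1) by (intro ready_cands_cong[OF r4]) auto
              have c5: "(n + m + 1) * 200 \<le> c5" using 5(4) c4 by simp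
              show "wp check_hits (wp (Cond (Equal (Var rOk) (Const 1)) (1 ::= Const 1) Skip) Q) M5 c5"
              proof (rule wp_check_hits[OF r5 5(3,2)])
                show "(mh + 1) * 100 \<le> c5" using c5 mh by simp
              next
                fix M6 c6 assume 6: "same {rI, rX, rY, rOk} M5 M6"
                  "M6 rOk 0 = (if image_edges g es = edges H then 1 else 0)"
                  "c5 \<le> c6 + (mh + 1) * 100"
                have c6: "(n + m + 1) * 100 \<le> c6" using 6(3) c5 mh by simp
                have cc: "c \<le> c6 - 10 + (n + m + 1) * 1000"
                  using c3 c3' 4(3) 5(4) 6(3) c6 mh by simp
                have "clean M6" unfolding clean_def
                  using 5(2) 6(1) by (intro exI[of _ "hit_value (image_edges g es)"])
                    (simp add: mat_is_def hit_value_def)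
                then have cl': "clean (store M6 1 0 1)" "clean M6"
                  by (simp_all add: clean_def mat_is_def)
                have sm: "same {1, rI, rX, rY, rD, rOk, aW, aRes, aPar, aMat} M M6" "M6 1 = M 1"
                  using 1(1) 2(1) 3(1) 4(1) 5(1) 6(1) by simp_all
                show "wp (Cond (Equal (Var rOk) (Const 1)) (1 ::= Const 1) Skip) Q M6 c6"
                proof (cases "image_edges g es = edges H")
                  case True
                  have "Q (store M6 1 0 1) (c6 - 8)"
                    using sm cl' cc c6 True good by (intro Q) auto
                  then show ?thesis using True 6(2) c6 by simp
                next
                  case False
                  have "Q M6 (c6 - 6)" using sm cl' cc c6 False good by (intro Q) auto
                  then show ?thesis using False 6(2) c6 by simp
                qed
              qed
            qed
          qed
          then show ?thesis using True c3' by simp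
        qed
      qed
    qed
  qed
  \<comment> \<open>The sequence rule as an equation between predicates, applicable where memory and
    credit are not yet supplied.\<close>
  moreover have "wp (P ;; P') R = wp P (wp P' R)" for P P' R by (simp add: fun_eq_iff)
  ultimately show ?thesis by (simp only: test_parents_def)
qed

end

section \<open>Enumerating all choices of parents\<close>

text \<open>The array \<open>aDg\<close> holds a number with \<open>k\<close> digits in base \<open>b\<close>; the digit \<open>d i\<close> selects a candidate
  for the \<open>i\<close>-th removed vertex.\<close>

definition advance :: com where
  "advance =
     rI ::= Const 0 ;;
     While (Conj (Less (Var rI) (Var rK)) (Neg (Less (Plus (Read aDg (Var rI)) (Const 1)) (Var rB))))
       (Write aDg (Var rI) (Const 0) ;; incr rI) ;;
     Cond (Less (Var rI) (Var rK)) (incr_at aDg (Var rI)) (rGo ::= Const 0)"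

definition search :: com where
  "search = (rGo ::= Const 1 ;; While (Equal (Var rGo) (Const 1)) (test_parents ;; advance))"

text \<open>The edges of \<open>H\<close> may be read only after comparing their number with that of \<open>G\<close>, since the time
  bound does not mention them.\<close>

definition decide_contraction :: com where
  "decide_contraction =
     read_header ;;
     Cond (Less (Var rM) (Var rHM)) Skip
       (number_vertices ;; mark_kept ;; list_removed ;; list_neighbours ;; list_candidates ;; peel ;;
        Cond (Conj (Less (Const 0) (Var rD0)) (Equal (Var rQT) (Var rN))) Skip search)"

section \<open>Digit vectors and the numbers they represent\<close>

definition digits :: "nat \<Rightarrow> nat \<Rightarrow> (nat \<Rightarrow> nat) \<Rightarrow> bool" where
  "digits b k d \<longleftrightarrow> (\<forall>i<k. d i < b)"

definition numeral_value :: "nat \<Rightarrow> nat \<Rightarrow> (nat \<Rightarrow> nat) \<Rightarrow> nat" where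
  "numeral_value b k d = (\<Sum>i<k. d i * b ^ i)"

lemma numeral_value_Suc: "numeral_value b (Suc k) d = numeral_value b k d + d k * b ^ k"
  by (simp add: numeral_value_def)

lemma numeral_value_less: "digits b k d \<Longrightarrow> numeral_value b k d < b ^ k"
proof (induction k)
  case (Suc k)
  then have "numeral_value b k d < b ^ k" "d k + 1 \<le> b" by (auto simp: digits_def)
  moreover have "(d k + 1) * b ^ k \<le> b * b ^ k" using calculation(2) by (rule mult_le_mono1)
  ultimately show ?case unfolding numeral_value_Suc power_Suc add_mult_distrib by linarith
qed (simp add: numeral_value_def)

lemma numeral_value_inj:
  "digits b k d \<Longrightarrow> digits b k e \<Longrightarrow> numeral_value b k d = numeral_value b k e \<Longrightarrow> i < k \<Longrightarrow> d i = e i"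
proof (induction k)
  case (Suc k)
  have d: "digits b k d" "digits b k e" using Suc.prems by (auto simp: digits_def)
  have less: "numeral_value b k d < b ^ k" "numeral_value b k e < b ^ k"
    using d numeral_value_less by auto
  have eq: "numeral_value b k d + d k * b ^ k = numeral_value b k e + e k * b ^ k"
    using Suc.prems(3) by (simp add: numeral_value_Suc)
  have "(numeral_value b k d + d k * b ^ k) div b ^ k = d k"
    "(numeral_value b k e + e k * b ^ k) div b ^ k = e k"
    using less le_less_trans[OF le0 less(1)] by (auto simp: div_add1_eq)
  then have k: "d k = e k" using eq by simp
  show ?case
  proof (cases "i = k")
    case False
    then show ?thesis using Suc.IH[OF d] eq k Suc.prems(4) by simp
  qed (use k in simp)
qed simp

lemma numeral_value_upd:
  assumes "j < k"
  shows "numeral_value b k (d(j := x)) + d j * b ^ j = numeral_value b k d + x * b ^ j"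
proof -
  have "numeral_value b k e = e j * b ^ j + (\<Sum>i\<in>{..<k} - {j}. e i * b ^ i)" for e
    using assms by (simp add: numeral_value_def sum.remove)
  from this[of d] this[of "d(j := x)"] show ?thesis by simp
qed

lemma concat_pairs_nth:
  "i < length es \<Longrightarrow> concat (map (\<lambda>(u, v). [u, v]) es) ! (i + i) = fst (es ! i) \<and>
     concat (map (\<lambda>(u, v). [u, v]) es) ! (i + i + 1) = snd (es ! i)"
proof (induction es arbitrary: i)
  case (Cons e es)
  obtain a b where e: "e = (a, b)" by force
  show ?case
  proof (cases i)
    case (Suc j)
    then show ?thesis using Cons.IH[of j] Cons.prems by (simp add: e)
  qed (simp add: e)
qed simp

lemma length_concat_pairs: "length (concat (map (\<lambda>(u, v). [u, v]) es)) = length es + length es"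
  by (induction es) auto

lemma input_memory_segment:
  "xs = pre @ seg @ post \<Longrightarrow> b = length pre \<Longrightarrow> i < length seg \<Longrightarrow> input_memory xs 0 (b + i) = seg ! i"
  by (simp add: input_memory_def nth_append)

context contraction_instance
begin

text \<open>At least 1, so that the all-zero vector exists even if no vertex has a candidate: this
  vector is tested in any case.\<close>

definition base :: nat where "base = max 1 (max_cand removed)"

definition parent_fun :: "(nat \<Rightarrow> nat) \<Rightarrow> nat \<Rightarrow> nat" where
  "parent_fun d x = parent d (THE i. i < k \<and> removed ! i = x)"

lemma parent_fun_nth: "i < k \<Longrightarrow> parent_fun d (removed ! i) = parent d i"
proof -
  assume i: "i < k"
  then have "(THE j. j < k \<and> removed ! j = removed ! i) = i"
    using distinct_removed by (intro the_equality) (auto simp: nth_eq_iff_index_eq)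
  then show ?thesis by (simp add: parent_fun_def)
qed

lemma base_pos [simp]: "0 < base"
  by (simp add: base_def less_max_iff_disj)

lemma removedE:
  assumes "v \<in> verts G - verts H"
  obtains i where "i < k" "v = removed ! i"
  using assms set_removed by (metis in_set_conv_nth)

lemma good_parent_fun_cong:
  assumes "\<And>i. i < k \<Longrightarrow> d i = e i"
  shows "good (parent_fun d) \<longleftrightarrow> good (parent_fun e)"
proof (rule good_cong)
  fix y assume "y \<in> verts G - verts H"
  then obtain i where i: "i < k" "y = removed ! i" by (rule removedE)
  then show "parent_fun d y = parent_fun e y \<and> parent_fun e y \<in> verts G"
    using parent_in[OF i(1), of e] assms[OF i(1)] parent_def[of d i] parent_def[of e i]
    by (simp add: parent_fun_nth)
qed

text \<open>A rooted choice contains no vertex that is its own parent, so no digit was too large and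
  all parents are neighbours. Conversely, the parents of a forest are candidates, and their
  positions in the candidate lists are the digits.\<close>

lemma good_digits_iff_forest:
  "(\<exists>d. digits base k d \<and> good (parent_fun d)) \<longleftrightarrow> (\<exists>p. contraction_forest G H p)"
proof
  assume "\<exists>d. digits base k d \<and> good (parent_fun d)"
  then obtain d where good: "good (parent_fun d)" by blast
  have "{v, parent_fun d v} \<in> edges G" if v: "v \<in> verts G - verts H" for v
  proof -
    obtain i where i: "i < k" "v = removed ! i" using v by (rule removedE)
    have "d i < length (cand v)"
    proof (rule ccontr)
      assume "\<not> d i < length (cand v)"
      then have self: "parent_fun d v = v" using i by (simp add: parent_fun_nth parent_def)
      obtain s where "rooted (parent_fun d) (verts H) v s" using good v by (auto simp: good_def)
      then have "v \<notin> {v}" by (rule not_rooted_closed) (use v self in auto)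
      then show False by simp
    qed
    then have "parent_fun d v \<in> set (cand v)" using i by (simp add: parent_fun_nth parent_def)
    then show ?thesis using cand_subset by (auto simp: nbhd_def)
  qed
  then have "contraction_forest G H (parent_fun d)"
    using good by (simp add: contraction_forest_def good_def)
  then show "\<exists>p. contraction_forest G H p" by blast
next
  assume "\<exists>p. contraction_forest G H p"
  then obtain p where p: "contraction_forest G H p" by blast
  have "\<exists>j<length (cand (removed ! i)). cand (removed ! i) ! j = p (removed ! i)" if "i < k" for i
    using forest_candidate[OF p, of "removed ! i"] removed_nth[OF that]
    by (simp add: set_cand[symmetric] in_set_conv_nth)
  then obtain d where d: "\<And>i. i < k \<Longrightarrow> d i < length (cand (removed ! i))"
    "\<And>i. i < k \<Longrightarrow> cand (removed ! i) ! d i = p (removed ! i)" by metis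
  have "d i < base" if "i < k" for i
  proof -
    have "length (cand (removed ! i)) \<le> max_cand removed"
      using max_cand_le_iff[of removed "max_cand removed"] that by simp
    then show ?thesis using d(1)[OF that] unfolding base_def by linarith
  qed
  then have dig: "digits base k d" by (simp add: digits_def)
  have "good p" using p by (simp add: good_def contraction_forest_def)
  moreover have "good (parent_fun d) \<longleftrightarrow> good p"
  proof (rule good_cong)
    fix y assume y: "y \<in> verts G - verts H"
    then obtain i where i: "i < k" "y = removed ! i" by (rule removedE)
    then have "parent_fun d y = p y" using d by (simp add: parent_fun_nth parent_def)
    moreover have "p y \<in> verts G"
      using p y simple_graph_edgeD(3)[OF simple_G] by (auto simp: contraction_forest_def)
    ultimately show "parent_fun d y = p y \<and> p y \<in> verts G" by simp
  qed
  ultimately show "\<exists>d. digits base k d \<and> good (parent_fun d)" using dig by blast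
qed

text \<open>While a carry is pending at position \<open>j\<close>, it is worth
  \<open>base ^ j\<close>; the number plus this carry constantly equals the old number plus
  1.\<close>

lemma wp_advance:
  assumes r: "ready_cands M" and d: "digits base k (M aDg)" and go: "M rGo 0 = 1"
    and c: "(n + 1) * 60 \<le> c"
    and Q: "\<And>M' c'. same {rI, rGo, aDg} M M' \<Longrightarrow> digits base k (M' aDg) \<Longrightarrow>
      M' rGo 0 = 1 \<and> numeral_value base k (M' aDg) = numeral_value base k (M aDg) + 1 \<or>
      M' rGo 0 = 0 \<and> numeral_value base k (M aDg) + 1 = base ^ k \<Longrightarrow>
      c \<le> c' + (n + 1) * 60 \<Longrightarrow> Q M' c'"
  shows "wp advance Q M c"
proof -
  have kn: "k \<le> n" using k_eq by simp
  have K: "M rK 0 = k" and B: "M rB 0 = max_cand removed"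
    using r by (auto simp: ready_cands_def ready_def)
  let ?b = "Conj (Less (Var rI) (Var rK)) (Neg (Less (Plus (Read aDg (Var rI)) (Const 1)) (Var rB)))"
  let ?I = "\<lambda>M' c'. \<exists>j. j \<le> k \<and> M' rI 0 = j \<and> same {rI, aDg} M M' \<and> digits base k (M' aDg) \<and>
    numeral_value base k (M' aDg) + base ^ j = numeral_value base k (M aDg) + 1 \<and> c \<le> c' + j * 40 + 3"
  have "wp (While ?b (Write aDg (Var rI) (Const 0) ;; incr rI))
    (wp (Cond (Less (Var rI) (Var rK)) (incr_at aDg (Var rI)) (rGo ::= Const 0)) Q) (store M rI 0 0) (c - 3)"
  proof (rule wp_While[where I = ?I])
    show "?I (store M rI 0 0) (c - 3)" using d by (auto intro!: exI[of _ 0])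
  next
    fix M1 c1 assume "?I M1 c1" and b: "bval ?b M1"
    then obtain j where j: "M1 rI 0 = j" "same {rI, aDg} M M1" "digits base k (M1 aDg)"
      "numeral_value base k (M1 aDg) + base ^ j = numeral_value base k (M aDg) + 1"
      "c \<le> c1 + j * 40 + 3" by blast
    have jk: "j < k" using b j(1,2) K by simp
    \<comment> \<open>If no vertex has a candidate, \<open>rB\<close> is 0 although
      \<open>base\<close> is 1; the comparison then always carries, as is right in base 1.\<close>
    have "\<not> M1 aDg j + 1 < max_cand removed" using b j(1,2) B by simp
    moreover have "M1 aDg j < base" using j(3) jk by (simp add: digits_def)
    ultimately have top: "base = M1 aDg j + 1" unfolding base_def by linarith
    have c1: "40 \<le> c1" using j(5) jk kn c by simp
    have "numeral_value base k ((M1 aDg)(j := 0)) + M1 aDg j * base ^ j = numeral_value base k (M1 aDg)"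
      using numeral_value_upd[OF jk, of base "M1 aDg" 0] by simp
    moreover have "base ^ Suc j = M1 aDg j * base ^ j + base ^ j"
      using arg_cong[OF top, of "\<lambda>z. z * base ^ j"] by (simp only: power_Suc add_mult_distrib mult_1)
    ultimately have "numeral_value base k ((M1 aDg)(j := 0)) + base ^ Suc j = numeral_value base k (M aDg) + 1"
      using j(4) by linarith
    moreover have "digits base k ((M1 aDg)(j := 0))" using j(3) by (simp add: digits_def)
    ultimately show "1 + bcost ?b \<le> c1 \<and>
        wp (Write aDg (Var rI) (Const 0) ;; incr rI) ?I M1 (c1 - (1 + bcost ?b))"
      using j jk c1 by (auto simp: Suc_eq_plus1 intro!: exI[of _ "Suc j"])
  next
    fix M1 c1 assume "?I M1 c1" and b: "\<not> bval ?b M1"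
    then obtain j where j: "j \<le> k" "M1 rI 0 = j" "same {rI, aDg} M M1" "digits base k (M1 aDg)"
      "numeral_value base k (M1 aDg) + base ^ j = numeral_value base k (M aDg) + 1"
      "c \<le> c1 + j * 40 + 3" by blast
    have c1: "50 \<le> c1" using j(1,6) kn c by simp
    have cc: "c \<le> c1 - 40 + (n + 1) * 60" using j(1,6) kn c1 by simp
    have KB: "M1 rK 0 = k" "M1 rB 0 = max_cand removed" "M1 rGo 0 = 1" using j(3) K B go by simp_all
    have "wp (Cond (Less (Var rI) (Var rK)) (incr_at aDg (Var rI)) (rGo ::= Const 0)) Q M1 (c1 - 16)"
    proof (cases "j < k")
      case True
      then have "M1 aDg j + 1 < max_cand removed" using b j(2) KB by simp
      then have "M1 aDg j + 1 < base" by (simp add: base_def)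
      then have "digits base k ((M1 aDg)(j := M1 aDg j + 1))" using j(4) by (simp add: digits_def)
      moreover have "numeral_value base k ((M1 aDg)(j := M1 aDg j + 1)) = numeral_value base k (M aDg) + 1"
        using numeral_value_upd[OF True, of base "M1 aDg" "M1 aDg j + 1"] j(5)
        by (simp add: add_mult_distrib)
      ultimately have "Q (store M1 aDg j (M1 aDg j + 1)) (c1 - 30)"
        using j(3) KB cc c1 by (intro Q) auto
      then show ?thesis using True j(2) KB c1 by simp
    next
      case False
      then have jk: "j = k" using j(1) by simp
      \<comment> \<open>A carry beyond the last digit is worth \<open>base ^ k\<close>, while the
        old number is smaller than that, so it was the largest one.\<close>
      have "numeral_value base k (M aDg) + 1 = base ^ k"
        using j(5) numeral_value_less[OF d] unfolding jk by linarith
      then have "Q (store M1 rGo 0 0) (c1 - 25)" using j(3,4) cc c1 by (intro Q) auto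
      then show ?thesis using False j(2) KB c1 by simp
    qed
    then show "1 + bcost ?b \<le> c1 \<and>
      wp (Cond (Less (Var rI) (Var rK)) (incr_at aDg (Var rI)) (rGo ::= Const 0)) Q M1 (c1 - (1 + bcost ?b))"
      using c1 by (simp del: wp_Cond)
  qed
  then show ?thesis using c unfolding advance_def by (simp del: wp_Cond store_apply)
qed

text \<open>\<open>N\<close> counts the vectors tested so far. The counter passes through every
  number below \<open>base ^ k\<close> once and a number determines its digits, so all choices get
  tested. The 1100 consists of 1000 for a test and an allowance for counter and loop.\<close>

lemma wp_search:
  assumes r: "ready_cands M" and cl: "clean M" and mh: "mh \<le> m" and dg: "M aDg = (\<lambda>_. 0)"
    and ans: "M 1 0 = 0" and c: "base ^ k * ((n + m + 1) * 1100) + 100 \<le> c"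
    and Q: "\<And>M' c'. M' 1 0 = (if \<exists>p. contraction_forest G H p then 1 else 0) \<Longrightarrow> Q M' c'"
  shows "wp search Q M c"
proof -
  let ?X = "{1, rI, rX, rY, rD, rOk, rGo, aDg, aW, aRes, aPar, aMat}"
  let ?T = "(n + m + 1) * 1100"
  define found where
    "found N \<longleftrightarrow> (\<exists>d. digits base k d \<and> numeral_value base k d < N \<and> good (parent_fun d))" for N
  let ?I = "\<lambda>M' c'. \<exists>N. same ?X M M' \<and> clean M' \<and> digits base k (M' aDg) \<and>
    M' 1 0 = (if found N then 1 else 0) \<and> c \<le> c' + N * ?T + 3 \<and>
    (M' rGo 0 = 1 \<and> numeral_value base k (M' aDg) = N \<or> M' rGo 0 = 0 \<and> N = base ^ k)"
  have "wp (While (Equal (Var rGo) (Const 1)) (test_parents ;; advance)) Q (store M rGo 0 1) (c - 3)"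
  proof (rule wp_While[where I = ?I])
    have "numeral_value base k (\<lambda>_. 0) = 0" "\<not> found 0"
      by (simp_all add: numeral_value_def found_def)
    then show "?I (store M rGo 0 1) (c - 3)"
      using cl dg ans by (auto simp: digits_def clean_def mat_is_def intro!: exI[of _ 0])
  next
    fix M1 c1 assume I: "?I M1 c1" and b: "bval (Equal (Var rGo) (Const 1)) M1"
    define N where "N = numeral_value base k (M1 aDg)"
    have go: "M1 rGo 0 = 1" using b by simp
    have I1: "same ?X M M1" "clean M1" "digits base k (M1 aDg)"
      "M1 1 0 = (if found N then 1 else 0)" "c \<le> c1 + N * ?T + 3"
      using I go by (auto simp: N_def)
    have "N + 1 \<le> base ^ k" using numeral_value_less[OF I1(3)] by (simp add: N_def)
    then have "N * ?T + ?T \<le> base ^ k * ?T"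
      using mult_le_mono1[of "N + 1" "base ^ k" ?T] by (simp only: add_mult_distrib mult_1)
    then have c1: "?T + 97 \<le> c1" using c I1(5) by linarith
    have r1: "ready_cands M1" using I1(1) by (intro ready_cands_cong[OF r]) auto
    have "wp test_parents (wp advance ?I) M1 (c1 - 5)"
    proof (rule wp_test_parents[OF r1 I1(2) mh, where p = "parent_fun (M1 aDg)"])
      show "(n + m + 1) * 1000 \<le> c1 - 5" using c1 by simp
      show "\<forall>i<k. parent_fun (M1 aDg) (removed ! i) = parent (M1 aDg) i" by (simp add: parent_fun_nth)
    next
      fix M2 c2 assume 2: "same {1, rI, rX, rY, rD, rOk, aW, aRes, aPar, aMat} M1 M2" "clean M2"
        "M2 1 0 = (if good (parent_fun (M1 aDg)) then 1 else M1 1 0)"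
        "c1 - 5 \<le> c2 + (n + m + 1) * 1000"
      have r2: "ready_cands M2" using 2(1) by (intro ready_cands_cong[OF r1]) auto
      have dg2: "M2 aDg = M1 aDg" using 2(1) by simp
      show "wp advance ?I M2 c2"
      proof (rule wp_advance[OF r2])
        show "digits base k (M2 aDg)" using dg2 I1(3) by simp
        show "M2 rGo 0 = 1" using 2(1) go by simp
        show "(n + 1) * 60 \<le> c2" using 2(4) c1 by simp
      next
        fix M3 c3 assume 3: "same {rI, rGo, aDg} M2 M3" "digits base k (M3 aDg)"
          "M3 rGo 0 = 1 \<and> numeral_value base k (M3 aDg) = numeral_value base k (M2 aDg) + 1 \<or>
           M3 rGo 0 = 0 \<and> numeral_value base k (M2 aDg) + 1 = base ^ k"
          "c2 \<le> c3 + (n + 1) * 60"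
        \<comment> \<open>A vector with the same number agrees with the array on the first
          \<open>k\<close> digits, which determine the parents of all removed vertices.\<close>
        have "good (parent_fun (M1 aDg))"
          if "digits base k d" "numeral_value base k d = N" "good (parent_fun d)" for d
          using numeral_value_inj[OF that(1) I1(3)] that good_parent_fun_cong[of d "M1 aDg"]
          by (simp add: N_def)
        then have "found (N + 1) \<longleftrightarrow> good (parent_fun (M1 aDg)) \<or> found N"
          using I1(3) by (auto simp: found_def less_Suc_eq N_def simp flip: Suc_eq_plus1)
        moreover have "M3 1 0 = M2 1 0" using 3(1) by simp
        ultimately have "M3 1 0 = (if found (N + 1) then 1 else 0)" using 2(3) I1(4) by simp
        moreover have "same ?X M M3" using I1(1) 2(1) 3(1) by simp
        moreover have "clean M3" using 2(2) 3(1) by (simp add: clean_def mat_is_def)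
        moreover have "c1 \<le> c3 + ?T" using c1 2(4) 3(4) by simp
        then have "c \<le> c3 + (N + 1) * ?T + 3" using I1(5) unfolding add_mult_distrib mult_1 by linarith
        ultimately show "?I M3 c3" using 3(2,3) dg2 by (intro exI[of _ "N + 1"]) (simp add: N_def)
      qed
    qed
    then show "1 + bcost (Equal (Var rGo) (Const 1)) \<le> c1 \<and>
        wp (test_parents ;; advance) ?I M1 (c1 - (1 + bcost (Equal (Var rGo) (Const 1))))"
      using c1 by simp
  next
    fix M1 c1 assume I: "?I M1 c1" and b: "\<not> bval (Equal (Var rGo) (Const 1)) M1"
    then have *: "M1 1 0 = (if found (base ^ k) then 1 else 0)" "c \<le> c1 + base ^ k * ?T + 3" by auto
    have "found (base ^ k) \<longleftrightarrow> (\<exists>p. contraction_forest G H p)"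
      unfolding found_def using numeral_value_less good_digits_iff_forest by blast
    then show "1 + bcost (Equal (Var rGo) (Const 1)) \<le> c1 \<and>
        Q M1 (c1 - (1 + bcost (Equal (Var rGo) (Const 1))))"
      using * c by (auto intro!: Q)
  qed
  then show ?thesis using c by (simp add: search_def del: store_apply)
qed

section \<open>Assembling the algorithm and its time bound\<close>

lemma wp_read_header:
  assumes M: "M = input_memory (graph_code vs es @ graph_code vh eh)" and c: "100 \<le> c"
    and Q: "\<And>M' c'. input_ok M' \<Longrightarrow> \<forall>a i. a = 1 \<or> 10 \<le> a \<longrightarrow> M' a i = 0 \<Longrightarrow> c \<le> c' + 100 \<Longrightarrow> Q M' c'"
  shows "wp read_header Q M c"
proof -
  let ?f = "\<lambda>es. concat (map (\<lambda>(u, v). [u, v]) es)"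
  let ?xs = "[n, m] @ vs @ ?f es @ [nh, mh] @ vh @ ?f eh"
  have xs: "graph_code vs es @ graph_code vh eh = ?xs" by (simp add: graph_code_def)
  have seg: "M 0 (b + i) = seg ! i"
    if "?xs = pre @ seg @ post" "b = length pre" "i < length seg" for pre seg post b i
    using input_memory_segment[OF that] unfolding M xs .
  have h: "M 0 0 = n" "M 0 1 = m"
    using seg[of "[]" "[n, m]" _ 0 0] seg[of "[]" "[n, m]" _ 0 1] by simp_all
  have v: "M 0 (2 + i) = vs ! i" if "i < n" for i
    using seg[of "[n, m]" vs _ 2 i] that by simp
  have e: "M 0 (2 + n + i) = ?f es ! i" if "i < m + m" for i
    using seg[of "[n, m] @ vs" "?f es" _ "2 + n" i] that by (simp add: length_concat_pairs)
  have hh: "M 0 (2 + n + m + m) = nh" "M 0 (2 + n + m + m + 1) = mh"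
    using seg[of "[n, m] @ vs @ ?f es" "[nh, mh]" _ "2 + n + m + m" 0]
      seg[of "[n, m] @ vs @ ?f es" "[nh, mh]" _ "2 + n + m + m" 1]
    by (simp_all add: length_concat_pairs)
  have hv: "M 0 (2 + n + m + m + 2 + i) = vh ! i" if "i < nh" for i
    using seg[of "[n, m] @ vs @ ?f es @ [nh, mh]" vh _ "2 + n + m + m + 2" i] that
    by (simp add: length_concat_pairs)
  have he: "M 0 (2 + n + m + m + 2 + nh + i) = ?f eh ! i" if "i < mh + mh" for i
    using seg[of "[n, m] @ vs @ ?f es @ [nh, mh] @ vh" "?f eh" "[]" "2 + n + m + m + 2 + nh" i] that
    by (simp add: length_concat_pairs)
  define M' where "M' = M(rN := (M rN)(0 := n), rM := (M rM)(0 := m), rVB := (M rVB)(0 := 2),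
    rEB := (M rEB)(0 := 2 + n), rHV := (M rHV)(0 := 2 + n + m + m + 2), rHN := (M rHN)(0 := nh),
    rHM := (M rHM)(0 := mh), rHE := (M rHE)(0 := 2 + n + m + m + 2 + nh))"
  have "input_ok M'"
    unfolding input_ok_def
  proof (intro conjI allI impI)
    show "M' 0 (M' rVB 0 + i) = vs ! i" if "i < n" for i using v[OF that] by (simp add: M'_def)
    show "M' 0 (M' rHV 0 + i) = vh ! i" if "i < nh" for i using hv[OF that] by (simp add: M'_def)
    show "M' 0 (M' rEB 0 + i + i) = fst (es ! i)" "M' 0 (M' rEB 0 + i + i + 1) = snd (es ! i)"
      if "i < m" for i
      using e[of "i + i"] e[of "i + i + 1"] concat_pairs_nth[OF that] that
      by (simp_all add: M'_def add.assoc)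
    show "M' 0 (M' rHE 0 + i + i) = fst (eh ! i)" "M' 0 (M' rHE 0 + i + i + 1) = snd (eh ! i)"
      if "i < mh" for i
      using he[of "i + i"] he[of "i + i + 1"] concat_pairs_nth[OF that] that
      by (simp_all add: M'_def add.assoc)
  qed (simp_all add: M'_def)
  moreover have "\<forall>a i. a = 1 \<or> 10 \<le> a \<longrightarrow> M' a i = 0"
    by (auto simp: M'_def M input_memory_def)
  ultimately have q: "Q N c'" if "N = M'" "c \<le> c' + 100" for N c' using Q that by blast
  show ?thesis
    unfolding read_header_def using c hh[simplified]
    by (auto simp: h hh M'_def fun_eq_iff intro!: q)
qed

lemma card_edges: "card (edges G) = m" "card (edges H) = mh"
  using distinct_card[OF distinct_es] distinct_card[OF distinct_eh] lists_G lists_H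
  by (simp_all add: lists_graph_def)

text \<open>The summand with the factor \<open>k + 1\<close> pays for the preprocessing, where
  candidates are listed for each removed vertex; the power pays for the search.\<close>

lemma wp_decide_contraction:
  assumes M: "M = input_memory (graph_code vs es @ graph_code vh eh)"
    and c: "(k + 1) * ((n + m + 1) * 2000) + (max 1 (degeneracy G + 2 * k)) ^ k * ((n + m + 1) * 1100) \<le> c"
  shows "wp decide_contraction (\<lambda>M' _. answer M' = (if labeled_contraction_of H G then 1 else 0)) M c"
proof -
  let ?ans = "\<lambda>M' (_::nat). answer M' = (if labeled_contraction_of H G then 1 else 0)"
  have lc: "labeled_contraction_of H G \<longleftrightarrow> (\<exists>p. contraction_forest G H p)"
    using labeled_contraction_iff_forest[OF simple_G simple_H sub] .
  have big: "\<not> m < mh" if "contraction_forest G H p" for p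
    using forest_card_edges[OF simple_G that] by (simp add: card_edges)
  \<comment> \<open>With these products opaque, the budgets of the phases can be compared by linear
    arithmetic.\<close>
  define X Y P where "X = n + m + 1" and "Y = (k + 1) * X" and "P = (max 1 (degeneracy G + 2 * k)) ^ k"
  have XY: "X \<le> Y" "1 \<le> X" by (simp_all add: X_def Y_def)
  have cY: "2000 * Y + P * (1100 * X) \<le> c"
    using c unfolding X_def[symmetric] P_def[symmetric] Y_def by (simp add: ac_simps)
  have c1: "(n + m + 1) * 2000 \<le> c" using cY XY unfolding X_def[symmetric] by linarith
  have seq: "wp (P ;; P') R = wp P (wp P' R)" for P P' R by (simp add: fun_eq_iff)
  have "wp read_header (wp (Cond (Less (Var rM) (Var rHM)) Skip
      (number_vertices ;; mark_kept ;; list_removed ;; list_neighbours ;; list_candidates ;; peel ;;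
        Cond (Conj (Less (Const 0) (Var rD0)) (Equal (Var rQT) (Var rN))) Skip search)) ?ans) M c"
  proof (rule wp_read_header[OF M])
    show "100 \<le> c" using c1 by simp
  next
    fix M1 d1 assume 1: "input_ok M1" "\<forall>a i. a = 1 \<or> 10 \<le> a \<longrightarrow> M1 a i = 0" "c \<le> d1 + 100"
    have d1: "(n + m + 1) * 2000 \<le> d1 + 100" using c1 1(3) by simp
    show "wp (Cond (Less (Var rM) (Var rHM)) Skip
      (number_vertices ;; mark_kept ;; list_removed ;; list_neighbours ;; list_candidates ;; peel ;;
        Cond (Conj (Less (Const 0) (Var rD0)) (Equal (Var rQT) (Var rN))) Skip search)) ?ans M1 d1"
    proof (cases "m < mh")
      case True
      then show ?thesis using 1(1,2) d1 big lc by (auto simp: input_ok_def answer_def)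
    next
      case mh: False
      then have "(n + mh + 1) * 300 + 120 \<le> 420 * X" by (simp add: X_def)
      then have "(k + 1) * ((n + mh + 1) * 300 + 120) \<le> (k + 1) * (420 * X)" by (rule mult_le_mono2)
      then have lcost: "(k + 1) * ((n + mh + 1) * 300 + 120) \<le> 420 * Y" by (simp add: Y_def ac_simps)
      have "wp number_vertices (wp mark_kept (wp list_removed (wp list_neighbours (wp list_candidates
        (wp peel (wp (Cond (Conj (Less (Const 0) (Var rD0)) (Equal (Var rQT) (Var rN))) Skip search)
          ?ans)))))) M1 (d1 - 6)"
      proof (rule wp_number_vertices[OF 1(1)])
        show "(n + 1) * 50 + 10 \<le> d1 - 6" using d1 by simp
      next
        fix M2 d2 assume 2: "same {rI, rX, rA, aRow, aCol} M1 M2" "layout (M2 aRow) (M2 aCol)"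
          "d1 - 6 \<le> d2 + (n + 1) * 50 + 10"
        have i2: "input_ok M2" using 1(1) 2(1) by (simp add: input_ok_def)
        have z2: "M2 a i = 0" if "a = 1 \<or> a \<in> {rK, rB} \<or> 14 \<le> a \<and> a \<notin> {rI, rX, rA}" for a i
          using 1(2) 2(1) that by auto
        have d2: "(n + m + 1) * 1900 \<le> d2 + 100" "c \<le> d2 + (n + m + 1) * 100 + 200"
          using 2(3) d1 1(3) by simp_all
        show "wp mark_kept (wp list_removed (wp list_neighbours (wp list_candidates
          (wp peel (wp (Cond (Conj (Less (Const 0) (Var rD0)) (Equal (Var rQT) (Var rN))) Skip search)
            ?ans))))) M2 d2"
        proof (rule wp_mark_kept[OF i2])
          show "M2 aIn = (\<lambda>_. 0)" using z2 by (simp add: fun_eq_iff)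
          show "(n + 1) * 50 \<le> d2" using d2 by simp
        next
          fix M3 d3 assume 3: "same {rI, aIn} M2 M3" "M3 aIn = (\<lambda>x. if x \<in> verts H then 1 else 0)"
            "d2 \<le> d3 + (n + 1) * 50"
          have i3: "input_ok M3" using i2 3(1) by (simp add: input_ok_def)
          have d3: "(n + m + 1) * 1800 \<le> d3 + 100" "c \<le> d3 + (n + m + 1) * 200 + 200"
            using 3(3) d2 by simp_all
          show "wp list_removed (wp list_neighbours (wp list_candidates
            (wp peel (wp (Cond (Conj (Less (Const 0) (Var rD0)) (Equal (Var rQT) (Var rN))) Skip search)
              ?ans)))) M3 d3"
          proof (rule wp_list_removed[OF i3 3(2)])
            show "M3 rK 0 = 0" using 3(1) z2 by simp
            show "(n + 1) * 50 \<le> d3" using d3 by simp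
          next
            fix M4 d4 assume 4: "same {rI, rX, rK, aRem} M3 M4" "M4 rK 0 = k"
              "holds (M4 aRem) removed" "d3 \<le> d4 + (n + 1) * 50"
            have i4: "input_ok M4" using i3 4(1) by (simp add: input_ok_def)
            have d4: "(n + m + 1) * 1700 \<le> d4 + 100" "c \<le> d4 + (n + m + 1) * 300 + 200"
              using 4(4) d3 by simp_all
            show "wp list_neighbours (wp list_candidates
              (wp peel (wp (Cond (Conj (Less (Const 0) (Var rD0)) (Equal (Var rQT) (Var rN))) Skip search)
                ?ans))) M4 d4"
            proof (rule wp_list_neighbours[OF i4])
              show "layout (M4 aRow) (M4 aCol)" using 2(2) 3(1) 4(1) by simp
              show "M4 aDeg = (\<lambda>_. 0)" using z2 3(1) 4(1) by (simp add: fun_eq_iff)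
              show "(m + 1) * 100 \<le> d4" using d4 by simp
            next
              fix M5 d5 assume 5: "same {rI, rX, rY, aNb, aDeg} M4 M5"
                "rows_hold (M5 aNb) (M5 aRow) (adjl es)"
                "\<forall>x\<in>verts G. M5 aDeg x = length (adjl es x)" "d4 \<le> d5 + (m + 1) * 100"
              have d5: "(n + m + 1) * 1600 \<le> d5 + 100" "c \<le> d5 + (n + m + 1) * 400 + 200"
                using 5(4) d4 by simp_all
              have r5: "ready M5"
                using i4 2(2) 3(1,2) 4(1-3) 5(1-3) by (simp add: ready_def input_ok_def)
              have z5: "M5 a i = 0" if "a \<in> {1, rB, aMk, aDg, aMat}" for a i
                using z2 3(1) 4(1) 5(1) that by auto
              show "wp list_candidates
                (wp peel (wp (Cond (Conj (Less (Const 0) (Var rD0)) (Equal (Var rQT) (Var rN))) Skip search)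
                  ?ans)) M5 d5"
              proof (rule wp_list_candidates[OF r5])
                show "M5 aMk = (\<lambda>_. 0)" "M5 rB 0 = 0" using z5 by (simp_all add: fun_eq_iff)
                show "(k + 1) * ((n + mh + 1) * 300 + 120) \<le> d5"
                  using lcost cY d5(2) XY unfolding X_def[symmetric] by linarith
              next
                fix M6 d6 assume 6: "same {rI, rJ, rX, rY, rZ, rL, rA, rD, rB, aMk, aCt, aCand, aLen} M5 M6"
                  "ready_cands M6" "d5 \<le> d6 + (k + 1) * ((n + mh + 1) * 300 + 120)"
                have d6: "900 * Y + P * (1100 * X) \<le> d6"
                  using lcost cY d5(2) XY 6(3) unfolding X_def[symmetric] by linarith
                show "wp peel (wp (Cond (Conj (Less (Const 0) (Var rD0)) (Equal (Var rQT) (Var rN)))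
                  Skip search) ?ans) M6 d6"
                proof (rule wp_peel[OF 6(2)])
                  have "(n + m) * 300 + 200 \<le> 500 * X" by (simp add: X_def)
                  then show "(n + m) * 300 + 200 \<le> d6" using d6 XY by linarith
                next
                  fix M7 d7 assume 7: "same {rI, rJ, rX, rY, rL, rQH, rQT, rD0, aRd, aQ} M6 M7"
                    "0 < M7 rD0 0 \<and> M7 rQT 0 = n \<longleftrightarrow> degeneracy G + 2 * k < max_cand removed"
                    "d6 \<le> d7 + (n + m) * 300 + 200"
                  have "(n + m) * 300 + 200 \<le> 500 * X" by (simp add: X_def)
                  then have d7: "400 * Y + P * (1100 * X) \<le> d7" using d6 7(3) XY by linarith
                  have d7': "400 \<le> d7" using d7 XY by linarith
                  have r7: "ready_cands M7" using 7(1) by (intro ready_cands_cong[OF 6(2)]) auto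
                  have n7: "M7 rN 0 = n" using r7 by (simp add: ready_cands_def ready_def input_ok_def)
                  have z7: "M7 a i = 0" if "a \<in> {1, aDg, aMat}" for a i
                    using z5 6(1) 7(1) that by auto
                  show "wp (Cond (Conj (Less (Const 0) (Var rD0)) (Equal (Var rQT) (Var rN)))
                    Skip search) ?ans M7 d7"
                  proof (cases "degeneracy G + 2 * k < max_cand removed")
                    case True
                    then have "\<not> contraction_forest G H p" for p using max_cand_le[of p] by auto
                    then have "?ans M7 (d7 - 10)" using z7 lc by (simp add: answer_def)
                    then show ?thesis using True 7(2) n7 d7' by simp
                  next
                    case False
                    \<comment> \<open>Not being rejected by the peeling test is what bounds the
                      enumeration, even if \<open>H\<close> is no contraction of
                      \<open>G\<close>.\<close>
                    then have "base ^ k \<le> P" unfolding P_def base_def by (intro power_mono) auto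
                    then have "base ^ k * (1100 * X) \<le> P * (1100 * X)" by (rule mult_le_mono1)
                    then have d8: "base ^ k * ((n + m + 1) * 1100) + 100 \<le> d7 - 20"
                      using d7 XY unfolding X_def[symmetric] mult.commute[of X 1100] by linarith
                    have "wp search ?ans M7 e" if "base ^ k * ((n + m + 1) * 1100) + 100 \<le> e" for e
                    proof (rule wp_search[OF r7])
                      show "clean M7" unfolding clean_def
                        using z7 by (intro exI[of _ "\<lambda>_. 0"]) (simp add: mat_is_def)
                      show "mh \<le> m" using mh by simp
                      show "M7 aDg = (\<lambda>_. 0)" "M7 1 0 = 0" using z7 by (simp_all add: fun_eq_iff)
                      show "base ^ k * ((n + m + 1) * 1100) + 100 \<le> e" by (rule that)
                    qed (simp add: answer_def lc)
                    then show ?thesis using False 7(2) n7 d7' d8 by auto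
                  qed
                qed
              qed
            qed
          qed
        qed
      qed
      then show ?thesis using mh 1(1) d1 by (simp add: input_ok_def seq)
    qed
  qed
  then show ?thesis by (simp only: decide_contraction_def seq)
qed

end

text \<open>For \<open>k > 0\<close> the base is at least 2 and for \<open>k = 0\<close> both powers
  are 1, so the maximum disappears. With \<open>k + 1\<close> at most twice the power and
  \<open>n + m + 1 <= 2 * (n + m)\<close>, the constant becomes
  \<open>2 * (4000 + 1100)\<close>.\<close>

lemma time_bound:
  fixes n m k d :: nat
  assumes "n > 0"
  shows "(k + 1) * ((n + m + 1) * 2000) + (max 1 (d + 2 * k)) ^ k * ((n + m + 1) * 1100)
    \<le> 10200 * ((d + 2 * k) ^ k * (n + m))"
proof -
  let ?p = "(d + 2 * k) ^ k"
  have p: "(max 1 (d + 2 * k)) ^ k = ?p" by (cases k) simp_all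
  have k: "k + 1 \<le> 2 * ?p"
  proof (cases k)
    case (Suc j)
    have "d + 2 * k \<le> (d + 2 * k) ^ k" using Suc by (intro self_le_power) auto
    then show ?thesis using Suc by simp
  qed simp
  define X where "X = n + m + 1"
  have "(k + 1) * (X * 2000) \<le> (2 * ?p) * (X * 2000)"
    using k by (rule mult_le_mono1)
  moreover have "(2 * ?p) * (X * 2000) = 4000 * (?p * X)" "?p * (X * 1100) = 1100 * (?p * X)" by simp_all
  moreover have "?p * X \<le> ?p * (2 * (n + m))" using assms by (intro mult_le_mono2) (simp add: X_def)
  moreover have "?p * (2 * (n + m)) = 2 * (?p * (n + m))" by simp
  ultimately show ?thesis unfolding p X_def[symmetric] by linarith
qed

text \<open>Every run costs at least one unit, whereas the bound is 0 for a graph without vertices;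
  the time clause therefore assumes \<open>n > 0\<close>, while halting with the right answer is
  claimed for every input.\<close>

theorem theorem7:
  "\<exists>(P :: com) (C :: nat).
     \<forall>(G :: nat graph) (H :: nat graph) vsG esG vsH esH.
       simple_graph G \<and> simple_graph H \<and> verts H \<subseteq> verts G \<and>
       lists_graph vsG esG G \<and> lists_graph vsH esH H \<longrightarrow>
       (\<exists>t M. exec P (input_memory (graph_code vsG esG @ graph_code vsH esH)) t M \<and>
          answer M = (if labeled_contraction_of H G then 1 else 0) \<and>
          (let n = card (verts G); m = card (edges G); k = card (verts G) - card (verts H)
           in n > 0 \<longrightarrow> t \<le> C * ((degeneracy G + 2 * k) ^ k * (n + m))))"
proof (rule exI[of _ decide_contraction], rule exI[of _ 10200], intro allI impI)
  fix G H :: "nat graph" and vs es vh eh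
  assume "simple_graph G \<and> simple_graph H \<and> verts H \<subseteq> verts G \<and>
    lists_graph vs es G \<and> lists_graph vh eh H"
  then interpret contraction_instance G H vs es vh eh by unfold_locales auto
  let ?c = "(k + 1) * ((n + m + 1) * 2000) + (max 1 (degeneracy G + 2 * k)) ^ k * ((n + m + 1) * 1100)"
  obtain t M where *: "exec decide_contraction (input_memory (graph_code vs es @ graph_code vh eh)) t M"
    "t \<le> ?c" "answer M = (if labeled_contraction_of H G then 1 else 0)"
    using wp_decide_contraction[OF refl order_refl] unfolding wp_def by blast
  have "t \<le> 10200 * ((degeneracy G + 2 * k) ^ k * (n + m))" if "n > 0"
    using *(2) time_bound[OF that, of k m "degeneracy G"] by (rule order_trans)
  then have "let n = card (verts G); m = card (edges G); k = card (verts G) - card (verts H)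
      in n > 0 \<longrightarrow> t \<le> 10200 * ((degeneracy G + 2 * k) ^ k * (n + m))"
    by (simp add: Let_def card_verts_G card_verts_H card_edges k_eq)
  with *(1,3) show "\<exists>t M. exec decide_contraction (input_memory (graph_code vs es @ graph_code vh eh)) t M \<and>
      answer M = (if labeled_contraction_of H G then 1 else 0) \<and>
      (let n = card (verts G); m = card (edges G); k = card (verts G) - card (verts H)
       in n > 0 \<longrightarrow> t \<le> 10200 * ((degeneracy G + 2 * k) ^ k * (n + m)))"
    by blast
qed

end
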